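(* Let $N,p\ge1$ be integers. Any finite dimensional irreducible representation of the (quantum) finite $\mathcal W$-algebra $\mathcal W_p(N)=\mathcal W[gl(Np),N.sl(p)]$ is isomorphic to an evaluation representation or to the subquotient of a tensor product of at most $p$ evaluation representations.
   Context: The algebra. $\mathcal W_p(N)=\mathcal W[gl(Np),N.sl(p)]$ is the (quantum) Hamiltonian reduction of $\mathcal U(gl(Np))$ associated with the $sl(2)$ principal in $N.sl(p)=sl(p)\oplus\cdots\oplus sl(p)$ ($N$ copies), i.e. the finite $\mathcal W$-algebra of a nilpotent element of $gl(Np)$ with $N$ Jordan blocks of size $p$. The paper identifies it with the truncated Yangian $Y(N)_p$, i.e. the unital associative $\mathbb C$-algebra generated by $T^{ij}_n$ ($1\le i,j\le N$, $n\ge0$), with $T^{ij}_0=\delta^{ij}$ and $T^{ij}_n=0$ for $n>p$, subject to $$[T^{ij}_m,T^{kl}_n]=\sum_{r=0}^{\min(m,n)-1}\left(T^{kj}_rT^{il}_{m+n-r-1}-T^{kj}_{m+n-r-1}T^{il}_r\right),$$ the generator $T^{ij}_r$ corresponding to the $\mathcal W$-generator $W^{ij}_{r-1}$. The Yangian $Y(N)$ is defined by the same presentation without the relations $T^{ij}_n=0$, $n>p$, and $\mathcal W_p(N)$ is a quotient of it. Evaluation representations. Given a highest weight irreducible representation $\pi$ of $gl(N)$, the evaluation representation $ev_\pi$ is given by $ev_\pi(T^{ij}_1)=\pi(T^{ij}_1)$, where the $T^{ij}_1$ are identified with the standard basis elements of $gl(N)$, and $ev_\pi(T^{ij}_n)=0$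 for $n>1$. The tensor product of $n$ evaluation representations $ev_{\pi_1},\dots,ev_{\pi_n}$ is defined via the Yangian coproduct $\Delta(T^{ij}_m)=\sum_k\sum_{r=0}^mT^{ik}_r\otimes T^{kj}_{m-r}$ (iterated). All $T^{ij}_r$ with $r>n$ act by zero on it, so for $n\le p$ it is a representation of $\mathcal W_p(N)$. Subquotient. A highest weight vector is a vector $\eta$ with $T^{ij}(u)\eta=0$ for $i<j$ and $T^{ii}(u)\eta=\lambda^i(u)\eta$ for all $i$, where $T^{ij}(u)=\sum_{n\ge0}T^{ij}_nu^{-n}$ and $\lambda^i(u)\in1+u^{-1}\mathbb C[[u^{-1}]]$. "The subquotient" of a tensor product of evaluation representations means the irreducible part of its highest weight submodule: the submodule generated by the tensor product of the highest weight vectors, quotiented by all (sub)singular vectors, i.e. its irreducible highest weight quotient. *)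

theory Defs
  imports
    "HOL-Analysis.Finite_Cartesian_Product"
    "HOL-Algebra.QuotRing"
    "HOL-Library.Poly_Mapping"
begin

section \<open>Free vector spaces and free algebras over the complex numbers\<close>

text \<open>
  The type \<open>'b \<Rightarrow>\<^sub>0 complex\<close> is the complex vector space with basis \<open>'b\<close>. It carries no scalar
  multiplication in the library.
\<close>

definition cscale :: "complex \<Rightarrow> ('b \<Rightarrow>\<^sub>0 complex) \<Rightarrow> ('b \<Rightarrow>\<^sub>0 complex)" where
  "cscale c f = Poly_Mapping.map ((*) c) f"

lemma lookup_cscale: "Poly_Mapping.lookup (cscale c f) b = c * Poly_Mapping.lookup f b"
  unfolding cscale_def by transfer (simp add: when_def)

lemma vector_space_cscale: "vector_space cscale"
  by unfold_locales (auto intro!: poly_mapping_eqI simp: lookup_cscale lookup_add algebra_simps)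

definition free_space :: "'b set \<Rightarrow> ('b \<Rightarrow>\<^sub>0 complex) set" where
  "free_space B = {f. Poly_Mapping.keys f \<subseteq> B}"

text \<open>
  Multiplication on \<open>'m \<Rightarrow>\<^sub>0 complex\<close> is convolution over an additively written monoid \<open>'m\<close>. With the
  free monoid of words over \<open>'g\<close> in place of \<open>'m\<close> this is the free unital associative algebra on \<open>'g\<close>.
\<close>

datatype 'g free_monoid = Word "'g list"

instantiation free_monoid :: (type) monoid_add
begin

definition "0 = Word []"

fun plus_free_monoid :: "'a free_monoid \<Rightarrow> 'a free_monoid \<Rightarrow> 'a free_monoid" where
  "Word xs + Word ys = Word (xs @ ys)"

instance
proof
  fix a b c :: "'a free_monoid"
  show "a + b + c = a + (b + c)" by (cases a; cases b; cases c) simp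
  show "0 + a = a" by (cases a) (simp add: zero_free_monoid_def)
  show "a + 0 = a" by (cases a) (simp add: zero_free_monoid_def)
qed

end

definition free_algebra :: "('g free_monoid \<Rightarrow>\<^sub>0 complex) ring" where
  "free_algebra = \<lparr>carrier = UNIV, mult = (*), one = 1, zero = 0, add = (+)\<rparr>"

lemma ring_free_algebra: "ring free_algebra"
proof (intro ringI abelian_groupI monoidI)
  fix x :: "'a free_monoid \<Rightarrow>\<^sub>0 complex"
  show "\<exists>y\<in>carrier free_algebra. y \<oplus>\<^bsub>free_algebra\<^esub> x = \<zero>\<^bsub>free_algebra\<^esub>"
    by (rule bexI[of _ "- x"]) (auto simp: free_algebra_def)
qed (auto simp: free_algebra_def algebra_simps)


section \<open>The truncated Yangian as a presentation of the finite W-algebra\<close>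

text \<open>
  The index set \<open>{1,\<dots>,N}\<close> is a finite linearly ordered type \<open>'n\<close>, so that \<open>N = CARD('n) \<ge> 1\<close>.
  The triple \<open>(i, j, n)\<close> is the label of the generator \<open>T\<^sup>i\<^sup>j\<^sub>n\<close>.
\<close>

type_synonym 'n free_yangian = "('n \<times> 'n \<times> nat) free_monoid \<Rightarrow>\<^sub>0 complex"

definition gen :: "'n \<Rightarrow> 'n \<Rightarrow> nat \<Rightarrow> 'n free_yangian" where
  "gen i j n = Poly_Mapping.single (Word [(i, j, n)]) 1"

definition yangian_relators :: "'n free_yangian set" where
  "yangian_relators =
     {gen i j 0 - (if i = j then 1 else 0) | i j. True} \<union>
     {(gen i j m * gen k l n - gen k l n * gen i j m) -
      (\<Sum>r<min m n. gen k j r * gen i l (m + n - r - 1) - gen k j (m + n - r - 1) * gen i l r)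
      | i j k l m n. True}"

definition truncation_relators :: "nat \<Rightarrow> 'n free_yangian set" where
  "truncation_relators p = {gen i j n | i j n. p < n}"

definition W_ideal :: "nat \<Rightarrow> 'n free_yangian set" where
  "W_ideal p = genideal free_algebra (yangian_relators \<union> truncation_relators p)"

definition W_algebra :: "nat \<Rightarrow> 'n free_yangian set ring" where
  "W_algebra p = free_algebra Quot W_ideal p"

definition W_class :: "nat \<Rightarrow> 'n free_yangian \<Rightarrow> 'n free_yangian set" where
  "W_class p x = W_ideal p +>\<^bsub>free_algebra\<^esub> x"

abbreviation W_gen :: "nat \<Rightarrow> 'n \<Rightarrow> 'n \<Rightarrow> nat \<Rightarrow> 'n free_yangian set" where
  "W_gen p i j n \<equiv> W_class p (gen i j n)"


section \<open>Representations\<close>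

text \<open>
  Vector spaces are subspaces \<open>V\<close> of an ambient space with scalar multiplication \<open>s\<close>. Actions are
  families of maps \<open>\<rho> a\<close> with \<open>a\<close> in an index set \<open>A\<close>; only their values on \<open>V\<close> matter.
\<close>

definition linear_map_on ::
  "(complex \<Rightarrow> 'v \<Rightarrow> 'v) \<Rightarrow> 'v::ab_group_add set \<Rightarrow> (complex \<Rightarrow> 'w \<Rightarrow> 'w) \<Rightarrow> ('v \<Rightarrow> 'w::ab_group_add) \<Rightarrow> bool"
where
  "linear_map_on s V s' f \<longleftrightarrow>
     (\<forall>x\<in>V. \<forall>y\<in>V. f (x + y) = f x + f y) \<and> (\<forall>c. \<forall>x\<in>V. f (s c x) = s' c (f x))"

definition invariant_subspace ::
  "(complex \<Rightarrow> 'v \<Rightarrow> 'v) \<Rightarrow> 'a set \<Rightarrow> ('a \<Rightarrow> 'v \<Rightarrow> 'v) \<Rightarrow> 'v::ab_group_add set \<Rightarrow> bool"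
where
  "invariant_subspace s A \<rho> S \<longleftrightarrow> module.subspace s S \<and> (\<forall>a\<in>A. \<forall>x\<in>S. \<rho> a x \<in> S)"

definition irreducible_rep ::
  "(complex \<Rightarrow> 'v \<Rightarrow> 'v) \<Rightarrow> 'a set \<Rightarrow> ('a \<Rightarrow> 'v \<Rightarrow> 'v) \<Rightarrow> 'v::ab_group_add set \<Rightarrow> bool"
where
  "irreducible_rep s A \<rho> V \<longleftrightarrow>
     V \<noteq> {0} \<and> (\<forall>S. S \<subseteq> V \<and> invariant_subspace s A \<rho> S \<longrightarrow> S = {0} \<or> S = V)"

definition generated_submodule ::
  "(complex \<Rightarrow> 'v \<Rightarrow> 'v) \<Rightarrow> 'a set \<Rightarrow> ('a \<Rightarrow> 'v \<Rightarrow> 'v) \<Rightarrow> 'v::ab_group_add \<Rightarrow> 'v set"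
where
  "generated_submodule s A \<rho> \<eta> = \<Inter>{S. invariant_subspace s A \<rho> S \<and> \<eta> \<in> S}"

text \<open>
  For a highest weight module \<open>M\<close> the sum of all proper submodules is the largest proper submodule,
  and the quotient by it is the irreducible highest weight quotient of \<open>M\<close>.
\<close>

definition proper_submodule_sum ::
  "(complex \<Rightarrow> 'v \<Rightarrow> 'v) \<Rightarrow> 'a set \<Rightarrow> ('a \<Rightarrow> 'v \<Rightarrow> 'v) \<Rightarrow> 'v::ab_group_add set \<Rightarrow> 'v set"
where
  "proper_submodule_sum s A \<rho> M = module.span s (\<Union>{S. invariant_subspace s A \<rho> S \<and> S \<subset> M})"

definition W_rep ::
  "nat \<Rightarrow> (complex \<Rightarrow> 'v \<Rightarrow> 'v) \<Rightarrow> ('n free_yangian set \<Rightarrow> 'v \<Rightarrow> 'v) \<Rightarrow> 'v::ab_group_add set \<Rightarrow> bool"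
where
  "W_rep p s \<rho> V \<longleftrightarrow>
     invariant_subspace s (carrier (W_algebra p)) \<rho> V \<and>
     (\<forall>a\<in>carrier (W_algebra p). linear_map_on s V s (\<rho> a)) \<and>
     (\<forall>a\<in>carrier (W_algebra p). \<forall>b\<in>carrier (W_algebra p). \<forall>x\<in>V.
        \<rho> (a \<oplus>\<^bsub>W_algebra p\<^esub> b) x = \<rho> a x + \<rho> b x \<and>
        \<rho> (a \<otimes>\<^bsub>W_algebra p\<^esub> b) x = \<rho> a (\<rho> b x)) \<and>
     (\<forall>c. \<forall>x\<in>V. \<rho> (W_class p (cscale c 1)) x = s c x)"

definition W_isomorphic ::
  "nat \<Rightarrow> (complex \<Rightarrow> 'v \<Rightarrow> 'v) \<Rightarrow> ('n free_yangian set \<Rightarrow> 'v \<Rightarrow> 'v) \<Rightarrow> 'v::ab_group_add set \<Rightarrow>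
   (complex \<Rightarrow> 'w \<Rightarrow> 'w) \<Rightarrow> ('n free_yangian set \<Rightarrow> 'w \<Rightarrow> 'w) \<Rightarrow> 'w::ab_group_add set \<Rightarrow> bool"
where
  "W_isomorphic p s \<rho> V s' \<sigma> U \<longleftrightarrow>
     (\<exists>\<phi>. bij_betw \<phi> V U \<and> linear_map_on s V s' \<phi> \<and>
        (\<forall>a\<in>carrier (W_algebra p). \<forall>x\<in>V. \<phi> (\<rho> a x) = \<sigma> a (\<phi> x)))"

definition coset :: "'w::ab_group_add set \<Rightarrow> 'w \<Rightarrow> 'w set" where
  "coset K x = (\<lambda>k. x + k) ` K"

text \<open>
  The quotient \<open>M / K\<close> is the set of cosets, with operations and action induced from
  representatives; \<open>\<phi>\<close> is an isomorphism from \<open>M / K\<close> to \<open>V\<close>.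
\<close>

definition W_isomorphic_quotient ::
  "nat \<Rightarrow> (complex \<Rightarrow> 'v \<Rightarrow> 'v) \<Rightarrow> ('n free_yangian set \<Rightarrow> 'v \<Rightarrow> 'v) \<Rightarrow> 'v::ab_group_add set \<Rightarrow>
   (complex \<Rightarrow> 'w \<Rightarrow> 'w) \<Rightarrow> ('n free_yangian set \<Rightarrow> 'w \<Rightarrow> 'w) \<Rightarrow> 'w::ab_group_add set \<Rightarrow> 'w set \<Rightarrow> bool"
where
  "W_isomorphic_quotient p s \<rho> V s' \<sigma> M K \<longleftrightarrow>
     (\<exists>\<phi>. bij_betw \<phi> (coset K ` M) V \<and>
        (\<forall>x\<in>M. \<forall>y\<in>M. \<phi> (coset K (x + y)) = \<phi> (coset K x) + \<phi> (coset K y)) \<and>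
        (\<forall>c. \<forall>x\<in>M. \<phi> (coset K (s' c x)) = s c (\<phi> (coset K x))) \<and>
        (\<forall>a\<in>carrier (W_algebra p). \<forall>x\<in>M. \<phi> (coset K (\<sigma> a x)) = \<rho> a (\<phi> (coset K x))))"


section \<open>Highest weight representations of the general linear Lie algebra\<close>

text \<open>
  A highest weight irreducible representation of \<open>gl(N)\<close> is a quotient of the enveloping algebra,
  hence of countable dimension. It is therefore taken on the space with basis a set of natural numbers.
\<close>

type_synonym 'n gl = "complex ^ 'n ^ 'n"

definition matrix_unit :: "'n \<Rightarrow> 'n \<Rightarrow> 'n::finite gl" where
  "matrix_unit i j = (\<chi> a b. if a = i \<and> b = j then 1 else 0)"

definition gl_rep ::
  "nat set \<Rightarrow> ('n::finite gl \<Rightarrow> (nat \<Rightarrow>\<^sub>0 complex) \<Rightarrow> (nat \<Rightarrow>\<^sub>0 complex)) \<Rightarrow> bool"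
where
  "gl_rep B \<pi> \<longleftrightarrow>
     (\<forall>X. linear_map_on cscale (free_space B) cscale (\<pi> X) \<and> \<pi> X ` free_space B \<subseteq> free_space B) \<and>
     (\<forall>v\<in>free_space B.
        (\<forall>X Y. \<pi> (X + Y) v = \<pi> X v + \<pi> Y v) \<and>
        (\<forall>c X. \<pi> (\<chi> i j. c * X $ i $ j) v = cscale c (\<pi> X v)) \<and>
        (\<forall>X Y. \<pi> (X ** Y - Y ** X) v = \<pi> X (\<pi> Y v) - \<pi> Y (\<pi> X v)))"

definition gl_highest_weight_vector ::
  "('n::{finite,linorder} gl \<Rightarrow> (nat \<Rightarrow>\<^sub>0 complex) \<Rightarrow> (nat \<Rightarrow>\<^sub>0 complex)) \<Rightarrow>
   (nat \<Rightarrow>\<^sub>0 complex) \<Rightarrow> bool"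
where
  "gl_highest_weight_vector \<pi> \<eta> \<longleftrightarrow>
     \<eta> \<noteq> 0 \<and> (\<forall>i j. i < j \<longrightarrow> \<pi> (matrix_unit i j) \<eta> = 0) \<and>
     (\<exists>wt. \<forall>i. \<pi> (matrix_unit i i) \<eta> = cscale (wt i) \<eta>)"

definition gl_highest_weight_irrep ::
  "nat set \<Rightarrow> ('n::{finite,linorder} gl \<Rightarrow> (nat \<Rightarrow>\<^sub>0 complex) \<Rightarrow> (nat \<Rightarrow>\<^sub>0 complex)) \<Rightarrow>
   (nat \<Rightarrow>\<^sub>0 complex) \<Rightarrow> bool"
where
  "gl_highest_weight_irrep B \<pi> \<eta> \<longleftrightarrow>
     gl_rep B \<pi> \<and> irreducible_rep cscale UNIV \<pi> (free_space B) \<and>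
     \<eta> \<in> free_space B \<and> gl_highest_weight_vector \<pi> \<eta>"


section \<open>Evaluation representations and their tensor products\<close>

definition ev_op ::
  "('n::finite gl \<Rightarrow> ('b \<Rightarrow>\<^sub>0 complex) \<Rightarrow> ('b \<Rightarrow>\<^sub>0 complex)) \<Rightarrow>
   'n \<Rightarrow> 'n \<Rightarrow> nat \<Rightarrow> ('b \<Rightarrow>\<^sub>0 complex) \<Rightarrow> ('b \<Rightarrow>\<^sub>0 complex)"
where
  "ev_op \<pi> i j n v =
     (if n = 0 then (if i = j then v else 0) else if n = 1 then \<pi> (matrix_unit i j) v else 0)"

definition evaluation_rep ::
  "nat \<Rightarrow> nat set \<Rightarrow> ('n::finite gl \<Rightarrow> (nat \<Rightarrow>\<^sub>0 complex) \<Rightarrow> (nat \<Rightarrow>\<^sub>0 complex)) \<Rightarrow>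
   ('n free_yangian set \<Rightarrow> (nat \<Rightarrow>\<^sub>0 complex) \<Rightarrow> (nat \<Rightarrow>\<^sub>0 complex)) \<Rightarrow> bool"
where
  "evaluation_rep p B \<pi> \<sigma> \<longleftrightarrow>
     W_rep p cscale \<sigma> (free_space B) \<and>
     (\<forall>i j n. \<forall>v\<in>free_space B. \<sigma> (W_gen p i j n) v = ev_op \<pi> i j n v)"

text \<open>
  The tensor product of the spaces with bases \<open>B\<^sub>1, \<dots>, B\<^sub>n\<close> is the space with basis
  \<open>B\<^sub>1 \<times> \<dots> \<times> B\<^sub>n\<close>, that is, \<open>free_space (listset [B\<^sub>1, \<dots>, B\<^sub>n])\<close>. The first definition is the map
  \<open>(v, w) \<mapsto> v \<otimes> w\<close> in these coordinates.
\<close>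

definition tensor_cons ::
  "('b \<Rightarrow>\<^sub>0 complex) \<Rightarrow> ('b list \<Rightarrow>\<^sub>0 complex) \<Rightarrow> ('b list \<Rightarrow>\<^sub>0 complex)"
where
  "tensor_cons v w =
     (\<Sum>x\<in>Poly_Mapping.keys v. \<Sum>ys\<in>Poly_Mapping.keys w.
        Poly_Mapping.single (x # ys) (Poly_Mapping.lookup v x * Poly_Mapping.lookup w ys))"

definition pure_tensor :: "('b \<Rightarrow>\<^sub>0 complex) list \<Rightarrow> ('b list \<Rightarrow>\<^sub>0 complex)" where
  "pure_tensor vs = foldr tensor_cons vs (Poly_Mapping.single [] 1)"

text \<open>
  The operator \<open>F \<otimes> G\<close>, that is, the linear extension of \<open>e\<^sub>x \<otimes> e\<^sub>y\<^sub>s \<mapsto> F e\<^sub>x \<otimes> G e\<^sub>y\<^sub>s\<close>.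
\<close>

definition tensor_op ::
  "(('b \<Rightarrow>\<^sub>0 complex) \<Rightarrow> ('b \<Rightarrow>\<^sub>0 complex)) \<Rightarrow>
   (('b list \<Rightarrow>\<^sub>0 complex) \<Rightarrow> ('b list \<Rightarrow>\<^sub>0 complex)) \<Rightarrow> ('b list \<Rightarrow>\<^sub>0 complex) \<Rightarrow> ('b list \<Rightarrow>\<^sub>0 complex)"
where
  "tensor_op F G f =
     (\<Sum>zs\<in>Poly_Mapping.keys f. cscale (Poly_Mapping.lookup f zs)
        (tensor_cons (F (Poly_Mapping.single (hd zs) 1)) (G (Poly_Mapping.single (tl zs) 1))))"

text \<open>
  The action of \<open>T\<^sup>i\<^sup>j\<^sub>m\<close> on a tensor product through the iterated coproduct; the empty list gives the
  counit \<open>T\<^sup>i\<^sup>j\<^sub>m \<mapsto> \<delta>\<^sup>i\<^sup>j \<delta>\<^sub>m\<^sub>0\<close>.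
\<close>

fun ev_tensor_op ::
  "('n::finite gl \<Rightarrow> ('b \<Rightarrow>\<^sub>0 complex) \<Rightarrow> ('b \<Rightarrow>\<^sub>0 complex)) list \<Rightarrow>
   'n \<Rightarrow> 'n \<Rightarrow> nat \<Rightarrow> ('b list \<Rightarrow>\<^sub>0 complex) \<Rightarrow> ('b list \<Rightarrow>\<^sub>0 complex)"
where
  "ev_tensor_op [] i j m f = (if i = j \<and> m = 0 then f else 0)"
| "ev_tensor_op (\<pi> # \<pi>s) i j m f =
     (\<Sum>k\<in>UNIV. \<Sum>r\<le>m. tensor_op (ev_op \<pi> i k r) (ev_tensor_op \<pi>s k j (m - r)) f)"

definition ev_tensor_rep ::
  "nat \<Rightarrow> nat set list \<Rightarrow>
   ('n::finite gl \<Rightarrow> (nat \<Rightarrow>\<^sub>0 complex) \<Rightarrow> (nat \<Rightarrow>\<^sub>0 complex)) list \<Rightarrow>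
   ('n free_yangian set \<Rightarrow> (nat list \<Rightarrow>\<^sub>0 complex) \<Rightarrow> (nat list \<Rightarrow>\<^sub>0 complex)) \<Rightarrow> bool"
where
  "ev_tensor_rep p Bs \<pi>s \<sigma> \<longleftrightarrow>
     W_rep p cscale \<sigma> (free_space (listset Bs)) \<and>
     (\<forall>i j m. \<forall>f\<in>free_space (listset Bs). \<sigma> (W_gen p i j m) f = ev_tensor_op \<pi>s i j m f)"

end

theory Submission
  imports Defs "HOL-Computational_Algebra.Fundamental_Theorem_Algebra"
begin

text \<open>
  A finite dimensional irreducible representation contains a highest weight vector \<open>\<eta>\<close>: on the
  eigenspace of \<open>- \<Sum>\<^sub>k k T\<^sup>k\<^sup>k\<^sub>1\<close> whose eigenvalue has the largest real part the raising generators
  vanish, and modulo them the generators \<open>T\<^sup>i\<^sup>i\<^sub>n\<close> commute. Since \<open>T\<^sup>i\<^sup>i\<^sub>n = 0\<close> for \<open>n > p\<close>, each weight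
  \<open>\<lambda>\<^sup>i(u)\<close> is a polynomial in \<open>u\<^sup>-\<^sup>1\<close> and factors as \<open>\<Prod>\<^sub>k (1 + a\<^sup>i\<^sub>k u\<^sup>-\<^sup>1)\<close> over \<open>k < p\<close>. The tensor product
  of the \<open>p\<close> evaluation representations of the irreducible \<open>gl(N)\<close>-modules of highest weights
  \<open>(a\<^sup>i\<^sub>k)\<^sub>i\<close> has a highest weight vector with the same weights. These modules may be infinite
  dimensional, so no condition of Drinfeld type enters, and the second alternative always holds
  with \<open>n = p\<close>.

  Two representations with highest weight vectors of the same weights are compared through the left ideal
  \<open>J\<close> of elements that annihilate both vectors: every \<open>a\<close> admits \<open>q \<in> 1 + J\<close> with \<open>q a \<in> \<complex> + J\<close>.
\<close>

section \<open>Modules over free algebras\<close>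

text \<open>Uniqueness of an irreducible highest weight module is usually read off from a Verma
  module, which rests on a Poincare-Birkhoff-Witt theorem. The common left ideal \<open>J\<close>
  avoids it. Suppose \<open>a\<close> kills the second vector but not the first. Irreducibility
  gives \<open>b\<close> with \<open>b * a\<close> fixing the first vector, and some
  \<open>q\<close> has \<open>q * (b * a)\<close> equal to a scalar modulo \<open>J\<close>. The
  first vector shows that this scalar is 1, so the second vector would be both fixed and killed. The
  element \<open>q\<close> is a polynomial in a combination of the \<open>gen k k 1\<close> under
  which every nonempty word of lowering generators has a negative integer weight; its roots are such
  weights.

  The same difficulty recurs for gl(N), where a nonzero vector of arbitrary complex highest weight
  has to be exhibited. Polynomial vector fields with a scalar twist supply one, namely the
  polynomial 1, and a maximal left ideal above its annihilator yields the irreducible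
  module.\<close>

lemma poly_mapping_sum_single:
  "f = (\<Sum>b\<in>Poly_Mapping.keys f. Poly_Mapping.single b (Poly_Mapping.lookup f b))"
proof (rule poly_mapping_eqI)
  fix k
  have "(\<Sum>b\<in>Poly_Mapping.keys f. Poly_Mapping.lookup (Poly_Mapping.single b (Poly_Mapping.lookup f b)) k)
      = (\<Sum>b\<in>Poly_Mapping.keys f. if b = k then Poly_Mapping.lookup f k else 0)"
    by (rule sum.cong) (auto simp: lookup_single when_def)
  also have "\<dots> = Poly_Mapping.lookup f k"
    by (auto simp: sum.delta' in_keys_iff)
  finally show "Poly_Mapping.lookup f k =
      Poly_Mapping.lookup (\<Sum>b\<in>Poly_Mapping.keys f. Poly_Mapping.single b (Poly_Mapping.lookup f b)) k"
    by (simp add: lookup_sum)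
qed

lemma poly_mapping_single_induct [case_names single add]:
  fixes f :: "'b \<Rightarrow>\<^sub>0 complex"
  assumes single: "\<And>b c. P (Poly_Mapping.single b c)"
    and add: "\<And>f g. P f \<Longrightarrow> P g \<Longrightarrow> P (f + g)"
  shows "P f"
proof -
  have "P (\<Sum>b\<in>B. Poly_Mapping.single b (h b))" if "finite B" for B and h :: "'b \<Rightarrow> complex"
    using that
  proof induction
    case empty
    show ?case using single[of undefined 0] by simp
  qed (simp add: single add)
  then show ?thesis by (subst poly_mapping_sum_single) simp
qed

lemma cscale_single: "cscale c (Poly_Mapping.single b d) = Poly_Mapping.single b (c * d)"
  by (rule poly_mapping_eqI) (simp add: lookup_cscale lookup_single when_def)

lemma cscale_add_right: "cscale c (f + g) = cscale c f + cscale c g"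
  by (rule poly_mapping_eqI) (simp add: lookup_cscale lookup_add algebra_simps)

lemma cscale_diff_right: "cscale c (f - g) = cscale c f - cscale c g"
  by (rule poly_mapping_eqI) (simp add: lookup_cscale lookup_minus algebra_simps)

lemma cscale_zero_right [simp]: "cscale c 0 = 0"
  by (rule poly_mapping_eqI) (simp add: lookup_cscale)

lemma cscale_one [simp]: "cscale 1 f = f"
  by (rule poly_mapping_eqI) (simp add: lookup_cscale)

lemma cscale_zero_left [simp]: "cscale 0 f = 0"
  by (rule poly_mapping_eqI) (simp add: lookup_cscale)

lemma cscale_cscale [simp]: "cscale c (cscale d f) = cscale (c * d) f"
  by (rule poly_mapping_eqI) (simp add: lookup_cscale mult.assoc)

lemma cscale_one_eq_single:
  "cscale c (1 :: 'm::monoid_add \<Rightarrow>\<^sub>0 complex) = Poly_Mapping.single 0 c"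
  by (metis cscale_single mult.right_neutral single_one)

lemma cscale_eq_mult:
  fixes f :: "'m::monoid_add \<Rightarrow>\<^sub>0 complex"
  shows "cscale c f = cscale c 1 * f"
proof (induction f rule: poly_mapping_single_induct)
  case (single b d)
  show ?case by (simp add: cscale_one_eq_single mult_single cscale_single)
qed (simp add: cscale_add_right algebra_simps)

lemma cscale_eq_mult_right:
  fixes f :: "'m::monoid_add \<Rightarrow>\<^sub>0 complex"
  shows "cscale c f = f * cscale c 1"
proof (induction f rule: poly_mapping_single_induct)
  case (single b d)
  show ?case by (simp add: cscale_one_eq_single mult_single cscale_single mult.commute)
qed (simp add: cscale_add_right algebra_simps)

lemma cscale_mult_left:
  fixes f :: "'m::monoid_add \<Rightarrow>\<^sub>0 complex"
  shows "cscale c f * g = cscale c (f * g)"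
  by (metis cscale_eq_mult mult.assoc)

lemma cscale_mult_right:
  fixes f :: "'m::monoid_add \<Rightarrow>\<^sub>0 complex"
  shows "f * cscale c g = cscale c (f * g)"
  by (metis cscale_eq_mult_right mult.assoc)

section \<open>Linear extension from a basis\<close>

definition lext ::
  "(complex \<Rightarrow> 'v \<Rightarrow> 'v) \<Rightarrow> ('b \<Rightarrow> 'v) \<Rightarrow> ('b \<Rightarrow>\<^sub>0 complex) \<Rightarrow> 'v::ab_group_add"
where
  "lext s g f = (\<Sum>b\<in>Poly_Mapping.keys f. s (Poly_Mapping.lookup f b) (g b))"

context
  fixes s :: "complex \<Rightarrow> 'v::ab_group_add \<Rightarrow> 'v"
  assumes vs: "vector_space s"
begin

interpretation vector_space s by (rule vs)

lemma lext_superset: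
  assumes "finite A" "Poly_Mapping.keys f \<subseteq> A"
  shows "lext s g f = (\<Sum>b\<in>A. s (Poly_Mapping.lookup f b) (g b))"
  unfolding lext_def using assms
  by (intro sum.mono_neutral_left) (auto simp: in_keys_iff)

lemma lext_single: "lext s g (Poly_Mapping.single b c) = s c (g b)"
  by (subst lext_superset[of "{b}"]) auto

lemma lext_zero [simp]: "lext s g 0 = 0"
  by (simp add: lext_def)

lemma lext_add: "lext s g (f + h) = lext s g f + lext s g h"
proof -
  let ?A = "Poly_Mapping.keys f \<union> Poly_Mapping.keys h"
  have "lext s g (f + h) = (\<Sum>b\<in>?A. s (Poly_Mapping.lookup (f + h) b) (g b))"
    by (rule lext_superset) (use keys_add[of f h] in auto)
  moreover have "lext s g f = (\<Sum>b\<in>?A. s (Poly_Mapping.lookup f b) (g b))"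
    by (rule lext_superset) auto
  moreover have "lext s g h = (\<Sum>b\<in>?A. s (Poly_Mapping.lookup h b) (g b))"
    by (rule lext_superset) auto
  ultimately show ?thesis
    by (simp add: lookup_add scale_left_distrib sum.distrib)
qed

lemma lext_cscale: "lext s g (cscale c f) = s c (lext s g f)"
proof -
  have "lext s g (cscale c f) = (\<Sum>b\<in>Poly_Mapping.keys f. s (Poly_Mapping.lookup (cscale c f) b) (g b))"
    by (rule lext_superset) (auto simp: in_keys_iff lookup_cscale)
  then show ?thesis by (simp add: lookup_cscale lext_def scale_sum_right)
qed

lemma lext_in_subspace:
  assumes "subspace W" "\<And>b. b \<in> Poly_Mapping.keys f \<Longrightarrow> g b \<in> W"
  shows "lext s g f \<in> W"
  unfolding lext_def using assms by (auto intro!: subspace_sum subspace_scale)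

end

text \<open>All laws are restricted to vectors of \<open>V\<close>, because \<open>W_rep\<close>
  says nothing about the action elsewhere.\<close>

locale free_module =
  fixes s :: "complex \<Rightarrow> 'v::ab_group_add \<Rightarrow> 'v"
    and act :: "('g free_monoid \<Rightarrow>\<^sub>0 complex) \<Rightarrow> 'v \<Rightarrow> 'v"
    and V :: "'v set"
  assumes vs: "vector_space s"
    and V_subspace: "module.subspace s V"
    and act_closed: "v \<in> V \<Longrightarrow> act a v \<in> V"
    and act_add_right: "v \<in> V \<Longrightarrow> w \<in> V \<Longrightarrow> act a (v + w) = act a v + act a w"
    and act_add_left: "v \<in> V \<Longrightarrow> act (a + b) v = act a v + act b v"
    and act_mult: "v \<in> V \<Longrightarrow> act (a * b) v = act a (act b v)"
    and act_const: "v \<in> V \<Longrightarrow> act (cscale c 1) v = s c v"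
begin

sublocale vector_space s by (rule vs)

lemma act_one: "v \<in> V \<Longrightarrow> act 1 v = v"
  using act_const[of v 1] by simp

lemma act_cscale: "v \<in> V \<Longrightarrow> act (cscale c a) v = s c (act a v)"
  by (metis act_closed act_const act_mult cscale_eq_mult)

text \<open>Homogeneity is not an axiom of the locale: scalars act through the central elements
  \<open>cscale c 1\<close>, so it follows from multiplicativity.\<close>

lemma act_scale: "v \<in> V \<Longrightarrow> act a (s c v) = s c (act a v)"
  by (metis act_const act_mult act_cscale cscale_eq_mult_right)

lemma act_zero_left: "v \<in> V \<Longrightarrow> act 0 v = 0"
  using act_const[of v 0] by simp

lemma act_diff_left: "v \<in> V \<Longrightarrow> act (a - b) v = act a v - act b v"
  using act_add_left[of v "a - b" b] by (simp add: algebra_simps)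

lemma act_sum_left: "v \<in> V \<Longrightarrow> act (\<Sum>i\<in>I. a i) v = (\<Sum>i\<in>I. act (a i) v)"
  by (induction I rule: infinite_finite_induct) (simp_all add: act_add_left act_zero_left)

lemma zero_in_V: "0 \<in> V"
  using V_subspace by (rule subspace_0)

lemma act_zero_right: "act a 0 = 0"
  using act_scale[OF zero_in_V, of a 0] by simp

text \<open>Since the annihilator of all of \<open>V\<close> is two-sided, minimality of
  \<open>genideal\<close> extends the vanishing of the relators on \<open>V\<close> to the whole of
  \<open>W_ideal p\<close>.\<close>

lemma annihilator_ideal: "ideal {a. \<forall>v\<in>V. act a v = 0} free_algebra"
proof (rule idealI)
  show "ring (free_algebra :: ('g free_monoid \<Rightarrow>\<^sub>0 complex) ring)" by (rule ring_free_algebra)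
  let ?A = "{a. \<forall>v\<in>V. act a v = 0}"
  interpret ring "free_algebra :: ('g free_monoid \<Rightarrow>\<^sub>0 complex) ring" by (rule ring_free_algebra)
  have inv: "\<ominus>\<^bsub>free_algebra\<^esub> a = - a" for a :: "'g free_monoid \<Rightarrow>\<^sub>0 complex"
    by (rule add.inv_equality) (simp_all add: free_algebra_def)
  show "subgroup ?A (add_monoid free_algebra)"
  proof (rule add.subgroupI)
    show "?A \<subseteq> carrier free_algebra" by (simp add: free_algebra_def)
    show "?A \<noteq> {}" using act_zero_left by auto
    show "\<ominus>\<^bsub>free_algebra\<^esub> a \<in> ?A" if "a \<in> ?A" for a
    proof -
      have "act (0 - a) v = 0" if "v \<in> V" for v
        using that \<open>a \<in> ?A\<close> by (simp only: act_diff_left) (simp add: act_zero_left)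
      then show ?thesis by (simp add: inv)
    qed
    show "a \<oplus>\<^bsub>free_algebra\<^esub> b \<in> ?A" if "a \<in> ?A" "b \<in> ?A" for a b
      using that by (simp add: act_add_left free_algebra_def)
  qed
  show "x \<otimes>\<^bsub>free_algebra\<^esub> a \<in> ?A" if "a \<in> ?A" for a x
    using that by (simp add: act_mult act_zero_right free_algebra_def)
  show "a \<otimes>\<^bsub>free_algebra\<^esub> x \<in> ?A" if "a \<in> ?A" for a x
    using that by (simp add: act_mult act_closed free_algebra_def)
qed

end

section \<open>From operators for the generators to the free algebra\<close>

definition feval ::
  "(complex \<Rightarrow> 'v \<Rightarrow> 'v) \<Rightarrow> ('g \<Rightarrow> 'v \<Rightarrow> 'v) \<Rightarrow> ('g free_monoid \<Rightarrow>\<^sub>0 complex) \<Rightarrow> 'v::ab_group_add \<Rightarrow> 'v"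
where
  "feval s T a v = lext s (\<lambda>w. case w of Word xs \<Rightarrow> foldr T xs v) a"

lemma feval_letter:
  assumes "vector_space s"
  shows "feval s T (Poly_Mapping.single (Word [x]) 1) v = T x v"
proof -
  interpret vector_space s by (rule assms)
  show ?thesis by (simp add: feval_def lext_single[OF assms])
qed

lemma free_module_feval:
  assumes vs: "vector_space s" and sub: "module.subspace s V"
    and closed: "\<And>x v. v \<in> V \<Longrightarrow> T x v \<in> V"
    and add: "\<And>x v w. v \<in> V \<Longrightarrow> w \<in> V \<Longrightarrow> T x (v + w) = T x v + T x w"
    and scale: "\<And>x v c. v \<in> V \<Longrightarrow> T x (s c v) = s c (T x v)"
  shows "free_module s (feval s T) V"
proof -
  interpret vector_space s by (rule vs)
  note lext = lext_add[OF vs] lext_single[OF vs]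
  have closed': "foldr T xs v \<in> V" if "v \<in> V" for xs v
    using that by (induction xs) (simp_all add: closed)
  have add': "foldr T xs (v + w) = foldr T xs v + foldr T xs w" if "v \<in> V" "w \<in> V" for xs v w
    using that by (induction xs) (simp_all add: add closed')
  have scale': "foldr T xs (s c v) = s c (foldr T xs v)" if "v \<in> V" for xs c v
    using that by (induction xs) (simp_all add: scale closed')
  have cl: "feval s T a v \<in> V" if "v \<in> V" for a v
    unfolding feval_def
    by (rule lext_in_subspace[OF vs sub]) (use that in \<open>auto split: free_monoid.split intro: closed'\<close>)
  have ar: "feval s T a (v + w) = feval s T a v + feval s T a w" if "v \<in> V" "w \<in> V" for a v w
  proof (induction a rule: poly_mapping_single_induct)
    case (single b c)
    show ?case
      by (cases b) (simp add: feval_def lext add' that scale_right_distrib)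
  qed (simp add: feval_def lext algebra_simps)
  have sr: "feval s T a (s c v) = s c (feval s T a v)" if "v \<in> V" for a c v
  proof (induction a rule: poly_mapping_single_induct)
    case (single b d)
    show ?case
      by (cases b) (simp add: feval_def lext scale' that mult.commute)
  qed (simp add: feval_def lext scale_right_distrib)
  have mult: "feval s T (a * b) v = feval s T a (feval s T b v)" if v: "v \<in> V" for a b v
  proof (induction b rule: poly_mapping_single_induct)
    case (single w d)
    show ?case
    proof (induction a rule: poly_mapping_single_induct)
      case (single u c)
      show ?case
        by (cases u; cases w) (simp add: feval_def lext mult_single scale' closed' v)
    next
      case (add a a')
      then show ?case by (simp add: feval_def lext distrib_right)
    qed
  next
    case (add b b')
    have "feval s T (b + b') v = feval s T b v + feval s T b' v"
      by (simp add: feval_def lext)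
    with add show ?case by (simp add: ar cl v distrib_left) (simp add: feval_def lext)
  qed
  show ?thesis
  proof
    show "feval s T (cscale c 1) v = s c v" for c v
      by (simp add: feval_def cscale_one_eq_single zero_free_monoid_def lext)
  qed (use sub cl ar mult in \<open>auto simp: feval_def lext\<close>)
qed

section \<open>Representations of the W-algebra\<close>

lemma W_ideal_ideal: "ideal (W_ideal p) free_algebra"
  unfolding W_ideal_def
  by (rule ring.genideal_ideal[OF ring_free_algebra]) (simp add: free_algebra_def)

lemma W_class_add: "W_class p (a + b) = W_class p a \<oplus>\<^bsub>W_algebra p\<^esub> W_class p b"
proof -
  interpret ideal "W_ideal p" free_algebra by (rule W_ideal_ideal)
  show ?thesis
    using a_rcos_sum[of a b]
    by (simp add: W_class_def W_algebra_def FactRing_def free_algebra_def)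
qed

lemma W_class_mult: "W_class p (a * b) = W_class p a \<otimes>\<^bsub>W_algebra p\<^esub> W_class p b"
proof -
  interpret ideal "W_ideal p" free_algebra by (rule W_ideal_ideal)
  show ?thesis
    using rcoset_mult_add[of a b]
    by (simp add: W_class_def W_algebra_def FactRing_def free_algebra_def)
qed

lemma carrier_W_algebra: "carrier (W_algebra p) = range (W_class p)"
  by (auto simp: W_algebra_def FactRing_def A_RCOSETS_def' W_class_def free_algebra_def)

lemma W_class_eq_iff: "W_class p a = W_class p b \<longleftrightarrow> a - b \<in> W_ideal p"
proof -
  interpret ideal "W_ideal p" free_algebra by (rule W_ideal_ideal)
  have inv: "\<ominus>\<^bsub>free_algebra\<^esub> a = - a" for a :: "'a free_yangian"
    by (rule add.inv_equality) (simp_all add: free_algebra_def)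
  have "a \<ominus>\<^bsub>free_algebra\<^esub> b = a - b"
    by (simp add: a_minus_def inv) (simp add: free_algebra_def)
  then show ?thesis
    using ring.quotient_eq_iff_same_a_r_cos[OF ring_free_algebra W_ideal_ideal, of a b p]
    by (simp add: W_class_def) (simp add: free_algebra_def)
qed

lemma free_module_of_W_rep:
  assumes "vector_space s" "W_rep p s \<rho> V"
  shows "free_module s (\<lambda>a. \<rho> (W_class p a)) V"
proof -
  have car: "W_class p a \<in> carrier (W_algebra p)" for a
    by (simp add: carrier_W_algebra)
  note rep = assms(2)[unfolded W_rep_def invariant_subspace_def linear_map_on_def]
  show ?thesis
  proof
    fix a b v w c
    assume v: "v \<in> V"
    show "\<rho> (W_class p a) v \<in> V" "\<rho> (W_class p (cscale c 1)) v = s c v"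
      using rep v car by blast+
    show "\<rho> (W_class p a) (v + w) = \<rho> (W_class p a) v + \<rho> (W_class p a) w" if "w \<in> V"
      using rep v car that by blast
    show "\<rho> (W_class p (a + b)) v = \<rho> (W_class p a) v + \<rho> (W_class p b) v"
      "\<rho> (W_class p (a * b)) v = \<rho> (W_class p a) (\<rho> (W_class p b) v)"
      using rep v car unfolding W_class_add W_class_mult by blast+
  qed (use assms rep in \<open>auto simp: vector_space_def\<close>)
qed

lemma W_rep_relator:
  assumes "vector_space s" "W_rep p s \<rho> V" "r \<in> yangian_relators \<union> truncation_relators p" "v \<in> V"
  shows "\<rho> (W_class p r) v = 0"
proof -
  interpret free_module s "\<lambda>a. \<rho> (W_class p a)" V
    by (rule free_module_of_W_rep) fact+
  have "r \<in> W_ideal p"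
    unfolding W_ideal_def
    by (rule subsetD[OF ring.genideal_self[OF ring_free_algebra] assms(3)])
      (simp add: free_algebra_def)
  then have "W_class p r = W_class p 0" by (simp add: W_class_eq_iff)
  then show ?thesis using act_zero_left[OF assms(4)] by simp
qed

text \<open>A coset acts through an arbitrarily chosen representative. Once the relators act by
  zero, the choice is immaterial on \<open>V\<close>; this is \<open>W_action_class\<close>.\<close>

definition W_action ::
  "nat \<Rightarrow> ('n free_yangian \<Rightarrow> 'v \<Rightarrow> 'v) \<Rightarrow> 'n free_yangian set \<Rightarrow> 'v \<Rightarrow> 'v"
where
  "W_action p act A = act (SOME a. W_class p a = A)"

context
  fixes s :: "complex \<Rightarrow> 'v::ab_group_add \<Rightarrow> 'v"
    and act :: "'n free_yangian \<Rightarrow> 'v \<Rightarrow> 'v" and V p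
  assumes fm: "free_module s act V"
    and rel: "\<And>r v. r \<in> yangian_relators \<union> truncation_relators p \<Longrightarrow> v \<in> V \<Longrightarrow> act r v = 0"
begin

interpretation free_module s act V by (rule fm)

lemma W_action_class:
  assumes "v \<in> V"
  shows "W_action p act (W_class p a) v = act a v"
proof -
  have "W_ideal p \<subseteq> {a. \<forall>v\<in>V. act a v = 0}"
    unfolding W_ideal_def
    by (rule ring.genideal_minimal[OF ring_free_algebra annihilator_ideal]) (use rel in auto)
  moreover have "W_class p (SOME b. W_class p b = W_class p a) = W_class p a"
    by (rule someI) simp
  ultimately have "act ((SOME b. W_class p b = W_class p a) - a) v = 0"
    using assms by (auto simp: W_class_eq_iff)
  then show ?thesis
    using assms by (simp add: act_diff_left W_action_def)
qed

lemma W_rep_W_action: "W_rep p s (W_action p act) V"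
  unfolding W_rep_def invariant_subspace_def linear_map_on_def carrier_W_algebra
  by (auto simp: W_action_class V_subspace subspace_add subspace_scale act_closed act_add_right
      act_scale act_const act_add_left act_mult W_class_add[symmetric] W_class_mult[symmetric])

end

section \<open>Highest weight left ideals\<close>

definition word :: "'g list \<Rightarrow> 'g free_monoid \<Rightarrow>\<^sub>0 complex" where
  "word xs = Poly_Mapping.single (Word xs) 1"

lemma word_append: "word (xs @ ys) = word xs * word ys"
  by (simp add: word_def mult_single)

lemma word_Nil [simp]: "word [] = 1"
  by (metis single_one word_def zero_free_monoid_def)

lemma word_Cons: "word ((i, j, n) # xs) = gen i j n * word xs"
  by (simp add: word_def gen_def mult_single)

lemma word_induct [case_names word cscale add]:
  assumes "\<And>xs. P (word xs)" "\<And>c a. P a \<Longrightarrow> P (cscale c a)" "\<And>a b. P a \<Longrightarrow> P b \<Longrightarrow> P (a + b)"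
  shows "P a"
proof (induction a rule: poly_mapping_single_induct)
  case (single w c)
  have "Poly_Mapping.single w c = cscale c (word (case w of Word xs \<Rightarrow> xs))"
    by (cases w) (simp add: word_def cscale_single)
  then show ?case using assms by metis
qed (rule assms)

section \<open>The grading element and the weights of words\<close>

definition height :: "'n::{finite,linorder} \<Rightarrow> nat" where
  "height k = card {l. l < k}"

lemma height_less: "i < j \<Longrightarrow> height i < height j"
  unfolding height_def by (rule psubset_card_mono) auto

text \<open>Modulo the relations, the commutator with this element multiplies
  \<open>gen i j n\<close> by \<open>height j - height i\<close>. The minus sign makes the raising
  generators, those with \<open>i < j\<close>, positive.\<close>

definition grading :: "'n::{finite,linorder} free_yangian" where
  "grading = - (\<Sum>k\<in>UNIV. cscale (of_nat (height k)) (gen k k 1))"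

text \<open>Abstract because two ideals are meant: the largest two-sided ideal inside a highest
  weight left ideal, and the annihilator of a finite dimensional module.\<close>

locale yangian_ideal =
  fixes I :: "'n::{finite,linorder} free_yangian set"
  assumes I_zero: "0 \<in> I"
    and I_add: "a \<in> I \<Longrightarrow> b \<in> I \<Longrightarrow> a + b \<in> I"
    and I_left: "a \<in> I \<Longrightarrow> b * a \<in> I"
    and I_right: "a \<in> I \<Longrightarrow> a * b \<in> I"
    and I_relators: "yangian_relators \<subseteq> I"
begin

lemma I_minus: "a \<in> I \<Longrightarrow> - a \<in> I"
  using I_left[of a "-1"] by simp

lemma I_diff: "a \<in> I \<Longrightarrow> b \<in> I \<Longrightarrow> a - b \<in> I"
  using I_add[of a "- b"] I_minus by simp

lemma I_cscale: "a \<in> I \<Longrightarrow> cscale c a \<in> I"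
  by (metis I_left cscale_eq_mult)

lemma I_sum: "(\<And>i. i \<in> A \<Longrightarrow> f i \<in> I) \<Longrightarrow> (\<Sum>i\<in>A. f i) \<in> I"
  by (induction A rule: infinite_finite_induct) (auto intro: I_zero I_add)

lemma gen_zero: "gen i j 0 - (if i = j then 1 else 0) \<in> I"
  by (rule subsetD[OF I_relators]) (unfold yangian_relators_def, blast)

lemma gen_commutator:
  "(gen i j m * gen k l n - gen k l n * gen i j m) -
     (\<Sum>r<min m n. gen k j r * gen i l (m + n - r - 1) - gen k j (m + n - r - 1) * gen i l r) \<in> I"
  by (rule subsetD[OF I_relators]) (unfold yangian_relators_def, blast)

text \<open>At level 1 only the term \<open>r = 0\<close> of the quadratic relation remains, and its
  level 0 generators are Kronecker deltas modulo \<open>I\<close>.\<close>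

lemma cartan_commutator:
  "(gen k k 1 * gen i j n - gen i j n * gen k k 1) -
     ((if k = i then gen i j n else 0) - (if k = j then gen i j n else 0)) \<in> I"
proof (cases "n = 0")
  \<comment> \<open>Here the sum over \<open>r\<close> is empty. The two weight terms cancel if
    \<open>i = j\<close>; otherwise \<open>gen i j 0\<close> itself lies in
    \<open>I\<close>.\<close>
  case True
  have "gen k k 1 * gen i j 0 - gen i j 0 * gen k k 1 \<in> I"
    using gen_commutator[of k k 1 i j 0] by simp
  moreover have "(if k = i then gen i j 0 else 0) - (if k = j then gen i j 0 else 0) \<in> I"
    using gen_zero[of i j] by (auto intro: I_zero I_minus)
  ultimately show ?thesis unfolding True by (rule I_diff)
next
  case False
  let ?\<delta> = "\<lambda>i j. if i = j then 1 else 0 :: 'n free_yangian"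
  have "min 1 n = Suc 0" using False by simp
  with gen_commutator[of k k 1 i j n]
  have 1: "(gen k k 1 * gen i j n - gen i j n * gen k k 1) -
      (gen i k 0 * gen k j n - gen i k n * gen k j 0) \<in> I" (is "?a - ?b \<in> I")
    by simp
  have "(gen i k 0 - ?\<delta> i k) * gen k j n \<in> I" "gen i k n * (gen k j 0 - ?\<delta> k j) \<in> I"
    by (rule I_right[OF gen_zero], rule I_left[OF gen_zero])
  then have "(gen i k 0 - ?\<delta> i k) * gen k j n - gen i k n * (gen k j 0 - ?\<delta> k j) \<in> I"
    by (rule I_diff)
  from I_add[OF 1 this] show ?thesis
    by (auto simp: algebra_simps)
qed

lemma grading_gen:
  "grading * gen i j n - gen i j n * grading - cscale (of_nat (height j) - of_nat (height i)) (gen i j n) \<in> I"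
proof -
  let ?C = "\<lambda>k. (gen k k 1 * gen i j n - gen i j n * gen k k 1) -
     ((if k = i then gen i j n else 0) - (if k = j then gen i j n else 0))"
  have "(\<Sum>k\<in>UNIV. cscale (of_nat (height k)) (?C k)) \<in> I"
    by (intro I_sum I_cscale cartan_commutator)
  moreover have "(\<Sum>k\<in>UNIV. cscale (of_nat (height k)) (?C k)) =
      - (grading * gen i j n - gen i j n * grading)
      - (\<Sum>k\<in>UNIV. cscale (of_nat (height k)) (if k = i then gen i j n else 0))
      + (\<Sum>k\<in>UNIV. cscale (of_nat (height k)) (if k = j then gen i j n else 0))"
    by (simp add: grading_def cscale_diff_right sum_subtractf sum_distrib_left sum_distrib_right
        cscale_mult_left cscale_mult_right)
  moreover have "(\<Sum>k\<in>UNIV. cscale (of_nat (height k)) (if k = i' then g else 0)) =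
      cscale (of_nat (height i')) g" for i' :: 'n and g :: "'n free_yangian"
    by (simp add: if_distrib[of "cscale _"] cong: if_cong)
  ultimately have 1: "- (grading * gen i j n - gen i j n * grading)
      - cscale (of_nat (height i)) (gen i j n) + cscale (of_nat (height j)) (gen i j n) \<in> I"
    by simp
  have 2: "cscale (of_nat (height j) - of_nat (height i)) (gen i j n) =
      cscale (of_nat (height j)) (gen i j n) - cscale (of_nat (height i)) (gen i j n)"
    by (rule poly_mapping_eqI) (simp add: lookup_cscale lookup_minus algebra_simps)
  from I_minus[OF 1] show ?thesis unfolding 2 by (simp add: algebra_simps)
qed

fun weight :: "('n \<times> 'n \<times> nat) list \<Rightarrow> int" where
  "weight [] = 0"
| "weight ((i, j, n) # xs) = int (height j) - int (height i) + weight xs"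

lemma grading_word:
  "grading * word xs - word xs * grading - cscale (of_int (weight xs)) (word xs) \<in> I"
proof (induction xs rule: weight.induct)
  case 1
  show ?case by (simp add: I_zero)
next
  case (2 i j n xs)
  let ?d = "of_nat (height j) - of_nat (height i) :: complex"
  have "(grading * gen i j n - gen i j n * grading - cscale ?d (gen i j n)) * word xs +
      gen i j n * (grading * word xs - word xs * grading - cscale (of_int (weight xs)) (word xs)) \<in> I"
    by (intro I_add I_left I_right grading_gen 2)
  moreover have "cscale (of_int (weight ((i, j, n) # xs))) (word ((i, j, n) # xs)) =
      cscale ?d (gen i j n) * word xs + gen i j n * cscale (of_int (weight xs)) (word xs)"
    unfolding word_Cons cscale_mult_left cscale_mult_right
    by (rule poly_mapping_eqI) (simp add: lookup_cscale lookup_add algebra_simps)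
  ultimately show ?case
    by (simp add: word_Cons algebra_simps)
qed

end

text \<open>These are the properties of the annihilator of a vector with weights \<open>wt\<close>.
  No module is mentioned, so \<open>J\<close> can be the common annihilator of vectors in two
  modules. Relators are absorbed to the left of any \<open>a\<close> because they vanish on the
  whole module and not merely on the vector.\<close>

locale hw_ideal =
  fixes wt :: "'n::{finite,linorder} \<Rightarrow> nat \<Rightarrow> complex" and J :: "'n free_yangian set"
  assumes J_zero: "0 \<in> J"
    and J_add: "a \<in> J \<Longrightarrow> b \<in> J \<Longrightarrow> a + b \<in> J"
    and J_left: "a \<in> J \<Longrightarrow> b * a \<in> J"
    and J_relators: "r \<in> yangian_relators \<Longrightarrow> r * a \<in> J"
    and J_raising: "i < j \<Longrightarrow> gen i j n \<in> J"
    and J_cartan: "gen i i n - cscale (wt i n) 1 \<in> J"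
begin

lemma J_minus: "a \<in> J \<Longrightarrow> - a \<in> J"
  using J_left[of a "-1"] by simp

lemma J_cscale: "a \<in> J \<Longrightarrow> cscale c a \<in> J"
  by (metis J_left cscale_eq_mult)

lemma J_sum: "(\<And>i. i \<in> A \<Longrightarrow> f i \<in> J) \<Longrightarrow> (\<Sum>i\<in>A. f i) \<in> J"
  by (induction A rule: infinite_finite_induct) (auto intro: J_zero J_add)

sublocale core: yangian_ideal "{x. \<forall>a. x * a \<in> J}"
  by unfold_locales (auto simp: J_zero J_add J_left J_relators distrib_right mult.assoc)

lemma core_in_J: "x \<in> {x. \<forall>a. x * a \<in> J} \<Longrightarrow> x \<in> J"
  by (metis (mono_tags, lifting) mem_Collect_eq mult_1_right)

definition top_weight :: complex where
  "top_weight = - (\<Sum>k\<in>UNIV. of_nat (height k) * wt k 1)"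

lemma grading_top_weight: "grading - cscale top_weight 1 \<in> J"
proof -
  have "- (\<Sum>k\<in>UNIV. cscale (of_nat (height k)) (gen k k 1 - cscale (wt k 1) 1)) \<in> J"
    by (intro J_minus J_sum J_cscale J_cartan)
  moreover have "cscale top_weight 1 = - (\<Sum>k\<in>UNIV. cscale (of_nat (height k) * wt k 1) (1 :: 'n free_yangian))"
    by (rule poly_mapping_eqI)
      (simp add: lookup_cscale lookup_sum top_weight_def sum_distrib_right)
  ultimately show ?thesis
    by (simp add: grading_def cscale_diff_right sum_subtractf)
qed

lemma grading_word_weight:
  "(grading - cscale (top_weight + of_int (core.weight xs)) 1) * word xs \<in> J"
proof -
  have "grading * word xs - word xs * grading - cscale (of_int (core.weight xs)) (word xs) \<in> J"
    by (rule core_in_J[OF core.grading_word])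
  moreover have "word xs * (grading - cscale top_weight 1) \<in> J"
    by (intro J_left grading_top_weight)
  ultimately have "(grading * word xs - word xs * grading - cscale (of_int (core.weight xs)) (word xs))
      + word xs * (grading - cscale top_weight 1) \<in> J"
    by (rule J_add)
  moreover have "cscale (c + d) 1 * word xs = cscale c (word xs) + cscale d (word xs)" for c d
    unfolding cscale_eq_mult[symmetric]
    by (rule poly_mapping_eqI) (simp add: lookup_cscale lookup_add algebra_simps)
  moreover have "word xs * cscale c 1 = cscale c (word xs)" for c
    by (simp add: cscale_eq_mult_right[symmetric])
  ultimately show ?thesis
    by (simp add: algebra_simps)
qed

text \<open>A Lagrange interpolation polynomial in \<open>grading\<close>: its roots are
  \<open>top_weight - 1\<close>, ..., \<open>top_weight - D\<close>, and the divisors normalise its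
  value at \<open>top_weight\<close> to 1.\<close>

primrec projector :: "nat \<Rightarrow> 'n free_yangian" where
  "projector 0 = 1"
| "projector (Suc d) =
     cscale (1 / of_nat (Suc d)) (grading - cscale (top_weight - of_nat (Suc d)) 1) * projector d"

lemma projector_eigen:
  assumes "(grading - cscale \<nu> 1) * a \<in> J"
  shows "projector D * a - cscale (\<Prod>d<D. (\<nu> - top_weight + of_nat (Suc d)) / of_nat (Suc d)) a \<in> J"
proof (induction D)
  case 0
  show ?case by (simp add: J_zero)
next
  case (Suc D)
  let ?c = "\<Prod>d<D. (\<nu> - top_weight + of_nat (Suc d)) / of_nat (Suc d)"
  let ?e = "1 / of_nat (Suc D) :: complex"
  let ?X = "cscale ?e (grading - cscale (top_weight - of_nat (Suc D)) 1)"
  let ?z = "\<nu> - top_weight + of_nat (Suc D)"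
  define X :: "'n free_yangian" where "X = ?X"
  have 1: "X * (projector D * a - cscale ?c a) + cscale (?c * ?e) ((grading - cscale \<nu> 1) * a) \<in> J"
    by (intro J_add J_left Suc J_cscale assms)
  have 2: "cscale (?c * (?z / of_nat (Suc D))) a = cscale (?c * ?e) (cscale ?z a)"
    by simp
  have 3: "cscale ?z a = cscale \<nu> 1 * a - cscale (top_weight - of_nat (Suc D)) 1 * a"
    unfolding cscale_eq_mult[symmetric]
    by (rule poly_mapping_eqI) (simp add: lookup_cscale lookup_minus algebra_simps)
  have 4: "X * cscale ?c a = cscale (?c * ?e) ((grading - cscale (top_weight - of_nat (Suc D)) 1) * a)"
    by (simp add: X_def cscale_mult_left cscale_mult_right mult.commute)
  have "X * projector D * a - cscale (?c * (?z / of_nat (Suc D))) a =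
      X * (projector D * a - cscale ?c a) + cscale (?c * ?e) ((grading - cscale \<nu> 1) * a)"
    unfolding 2 3 right_diff_distrib 4 cscale_diff_right left_diff_distrib
    by (simp add: mult.assoc)
  with 1 show ?case by (simp add: X_def)
qed

lemma projector_one: "projector D - 1 \<in> J"
proof -
  have "projector D * 1 - cscale (\<Prod>d<D. (top_weight - top_weight + of_nat (Suc d)) / of_nat (Suc d)) 1 \<in> J"
    by (rule projector_eigen) (simp add: grading_top_weight)
  moreover have "(\<Prod>d<D. (top_weight - top_weight + of_nat (Suc d)) / of_nat (Suc d)) = (1 :: complex)"
    by (rule prod.neutral) (simp del: of_nat_Suc)
  ultimately show ?thesis by simp
qed

text \<open>Words of different weights need different numbers of factors of the projector. Asking
  for one scalar that serves all large \<open>D'\<close> makes the set closed under sums.\<close>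

definition eventually_scalar :: "'n free_yangian set" where
  "eventually_scalar = {a. \<exists>D c. \<forall>D'\<ge>D. projector D' * a - cscale c 1 \<in> J}"

lemma eventually_scalar_J: "a \<in> J \<Longrightarrow> a \<in> eventually_scalar"
  unfolding eventually_scalar_def by (auto intro!: exI[of _ 0] J_left)

lemma eventually_scalar_add:
  assumes "a \<in> eventually_scalar" "b \<in> eventually_scalar"
  shows "a + b \<in> eventually_scalar"
proof -
  from assms obtain D c E d where
    "\<forall>D'\<ge>D. projector D' * a - cscale c 1 \<in> J" "\<forall>D'\<ge>E. projector D' * b - cscale d 1 \<in> J"
    unfolding eventually_scalar_def by auto
  then have "projector D' * a - cscale c 1 + (projector D' * b - cscale d 1) \<in> J"
    if "D' \<ge> max D E" for D'
    using that by (auto intro: J_add)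
  moreover have "cscale (c + d) 1 = cscale c (1 :: 'n free_yangian) + cscale d 1"
    by (rule poly_mapping_eqI) (simp add: lookup_cscale lookup_add algebra_simps)
  ultimately have "\<forall>D'\<ge>max D E. projector D' * (a + b) - cscale (c + d) 1 \<in> J"
    by (simp add: algebra_simps)
  then show ?thesis unfolding eventually_scalar_def by blast
qed

lemma eventually_scalar_cscale:
  assumes "a \<in> eventually_scalar"
  shows "cscale e a \<in> eventually_scalar"
proof -
  from assms obtain D c where "\<forall>D'\<ge>D. projector D' * a - cscale c 1 \<in> J"
    unfolding eventually_scalar_def by auto
  then have "\<forall>D'\<ge>D. cscale e (projector D' * a - cscale c 1) \<in> J"
    by (auto intro: J_cscale)
  then have "\<forall>D'\<ge>D. projector D' * cscale e a - cscale (e * c) 1 \<in> J"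
    by (simp add: cscale_diff_right cscale_mult_right)
  then show ?thesis unfolding eventually_scalar_def by blast
qed

lemma eventually_scalar_diff:
  "a \<in> eventually_scalar \<Longrightarrow> b \<in> eventually_scalar \<Longrightarrow> a - b \<in> eventually_scalar"
proof -
  assume "a \<in> eventually_scalar" "b \<in> eventually_scalar"
  moreover have eq: "a - b = a + cscale (-1) b"
    by (rule poly_mapping_eqI) (simp add: lookup_cscale lookup_minus lookup_add)
  ultimately show ?thesis unfolding eq by (intro eventually_scalar_add eventually_scalar_cscale)
qed

lemma eventually_scalar_sum:
  "(\<And>i. i \<in> A \<Longrightarrow> f i \<in> eventually_scalar) \<Longrightarrow> (\<Sum>i\<in>A. f i) \<in> eventually_scalar"
  by (induction A rule: infinite_finite_induct)
    (auto intro: eventually_scalar_add eventually_scalar_J J_zero)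

lemma lowering_weight:
  assumes "\<forall>(i, j, n)\<in>set xs. j < i"
  shows "core.weight xs \<le> - int (length xs)"
  using assms
proof (induction xs rule: core.weight.induct)
  case (2 i j n xs)
  then have "height j < height i" by (auto intro: height_less)
  with 2 show ?case by simp
qed simp

lemma lowering_word_eventually_scalar:
  assumes "\<forall>(i, j, n)\<in>set xs. j < i"
  shows "word xs \<in> eventually_scalar"
proof (cases "xs = []")
  case True
  have "\<forall>D'\<ge>0. projector D' * word xs - cscale 1 1 \<in> J"
    using True projector_one by simp
  then show ?thesis unfolding eventually_scalar_def by blast
next
  case False
  \<comment> \<open>The weight of a nonempty lowering word is \<open>- (d + 1)\<close>. It is the
    root of the factor with index \<open>d\<close>, so every projector with more than
    \<open>d\<close> factors kills the word modulo \<open>J\<close>.\<close>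
  define d where "d = nat (- core.weight xs) - 1"
  have "core.weight xs \<le> -1"
    using lowering_weight[OF assms] False by (cases xs) auto
  then have d: "core.weight xs = - int (Suc d)" by (simp add: d_def)
  have "projector D * word xs - cscale 0 1 \<in> J" if "D \<ge> Suc d" for D
  proof -
    have z: "(\<Prod>e<D. (top_weight + of_int (core.weight xs) - top_weight + of_nat (Suc e)) / of_nat (Suc e)) = (0 :: complex)"
      by (rule prod_zero) (use that d in \<open>auto intro!: bexI[of _ d]\<close>)
    show ?thesis using projector_eigen[OF grading_word_weight, of D xs] unfolding z by simp
  qed
  then show ?thesis unfolding eventually_scalar_def by blast
qed

section \<open>Sorting words by level\<close>

definition level :: "('n \<times> 'n \<times> nat) list \<Rightarrow> nat" where
  "level xs = (\<Sum>(i, j, n)\<leftarrow>xs. n)"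

lemma level_append [simp]: "level (xs @ ys) = level xs + level ys"
  by (simp add: level_def)

lemma level_Cons [simp]: "level ((i, j, n) # xs) = n + level xs"
  by (simp add: level_def)

text \<open>
  The quadratic relations express a commutator by words of smaller level, so words can be sorted
  by induction on the level.
\<close>

lemma swap_eventually_scalar:
  assumes small: "\<And>zs. level zs < D \<Longrightarrow> word zs \<in> eventually_scalar"
    and D: "level (u @ x # y # v) \<le> D"
  shows "word (u @ x # y # v) - word (u @ y # x # v) \<in> eventually_scalar"
proof -
  obtain i j m where x: "x = (i, j, m)" by (cases x)
  obtain k l n where y: "y = (k, l, n)" by (cases y)
  let ?S = "\<Sum>r<min m n. gen k j r * gen i l (m + n - r - 1) - gen k j (m + n - r - 1) * gen i l r"
  let ?C = "gen i j m * gen k l n - gen k l n * gen i j m"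
  have "(?C - ?S) * word v \<in> J"
    using core.gen_commutator by blast
  then have "word u * ((?C - ?S) * word v) \<in> J" by (rule J_left)
  then have 1: "word u * ((?C - ?S) * word v) \<in> eventually_scalar"
    by (rule eventually_scalar_J)
  have "word u * (?S * word v) =
    (\<Sum>r<min m n. word (u @ (k, j, r) # (i, l, m + n - r - 1) # v)
      - word (u @ (k, j, m + n - r - 1) # (i, l, r) # v))"
    unfolding word_append word_Cons
    by (simp add: sum_distrib_left sum_distrib_right algebra_simps)
  also have "\<dots> \<in> eventually_scalar"
    by (intro eventually_scalar_sum eventually_scalar_diff small) (use D in \<open>auto simp: x y\<close>)
  finally have "word u * ((?C - ?S) * word v) + word u * (?S * word v) \<in> eventually_scalar"
    by (rule eventually_scalar_add[OF 1])
  moreover have "word u * (?C * word v) = word u * ((?C - ?S) * word v) + word u * (?S * word v)"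
    by (metis (no_types) diff_add_cancel distrib_left distrib_right)
  moreover have "word (u @ x # y # v) - word (u @ y # x # v) = word u * (?C * word v)"
    unfolding word_append x y word_Cons
    by (simp add: algebra_simps)
  ultimately show ?thesis by (simp only:)
qed

lemma move_right_eventually_scalar:
  assumes "\<And>zs. level zs < D \<Longrightarrow> word zs \<in> eventually_scalar"
    and "level (u @ x # v) \<le> D"
  shows "word (u @ x # v) - word (u @ v @ [x]) \<in> eventually_scalar"
  using assms(2)
proof (induction v arbitrary: u)
  case Nil
  show ?case by (simp add: eventually_scalar_J J_zero)
next
  case (Cons y v)
  have "level (u @ x # y # v) = level ((u @ [y]) @ x # v)"
    by (cases x; cases y) simp
  then have "word ((u @ [y]) @ x # v) - word ((u @ [y]) @ v @ [x]) \<in> eventually_scalar"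
    using Cons by (intro Cons.IH) simp
  moreover have "word (u @ x # y # v) - word (u @ y # x # v) \<in> eventually_scalar"
    by (rule swap_eventually_scalar[OF assms(1) Cons.prems])
  ultimately have "(word (u @ x # y # v) - word (u @ y # x # v)) +
      (word ((u @ [y]) @ x # v) - word ((u @ [y]) @ v @ [x])) \<in> eventually_scalar"
    by (intro eventually_scalar_add)
  then show ?case by simp
qed

text \<open>A letter that is not lowering can be moved to the right end at the cost of words of
  smaller level. There a raising letter is absorbed by \<open>J\<close> and a Cartan letter becomes
  a scalar, which leaves the word without that letter. If the removed letter has level 0, only the
  length drops, hence the lexicographic measure.\<close>

lemma word_eventually_scalar: "word xs \<in> eventually_scalar"
proof (induction xs rule: wf_induct_rule[OF wf_measures[of "[level, length]"]])
  case (1 xs)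
  show ?case
  proof (cases "\<forall>(i, j, n)\<in>set xs. j < i")
    case True
    then show ?thesis by (rule lowering_word_eventually_scalar)
  next
    case False
    then have "\<exists>z\<in>set xs. \<not> (case z of (i, j, n) \<Rightarrow> j < i)" by auto
    then obtain u x v where xs: "xs = u @ x # v" and x: "\<not> (case x of (i, j, n) \<Rightarrow> j < i)"
      by (metis split_list)
    obtain i j m where x': "x = (i, j, m)" by (cases x)
    have small: "word zs \<in> eventually_scalar" if "level zs < level xs" for zs
      using 1 that by simp
    have uv: "word (u @ v) \<in> eventually_scalar"
      by (rule 1) (cases "m = 0"; simp add: xs x')
    have "word (u @ v @ [x]) = word (u @ v) * gen i j m"
      by (simp add: word_append x' word_Cons mult.assoc)
    also have "\<dots> \<in> eventually_scalar"
    proof (cases "i = j")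
      case True
      have "word (u @ v) * (gen i i m - cscale (wt i m) 1) \<in> eventually_scalar"
        by (intro eventually_scalar_J J_left J_cartan)
      from eventually_scalar_add[OF this eventually_scalar_cscale[OF uv, of "wt i m"]]
      show ?thesis using True by (simp add: algebra_simps cscale_eq_mult_right[symmetric])
    next
      case False
      then have "i < j" using x x' by simp
      then show ?thesis by (intro eventually_scalar_J J_left J_raising)
    qed
    finally have "word (u @ v @ [x]) \<in> eventually_scalar" .
    moreover have "word (u @ x # v) - word (u @ v @ [x]) \<in> eventually_scalar"
      by (rule move_right_eventually_scalar[where D = "level xs", OF small])
        (simp_all only: xs order_refl)
    ultimately have "(word (u @ x # v) - word (u @ v @ [x])) + word (u @ v @ [x]) \<in> eventually_scalar"
      by (intro eventually_scalar_add)
    then show ?thesis by (simp add: xs)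
  qed
qed

text \<open>
  The element \<open>q\<close> projects a highest weight module onto the line of the highest weight vector,
  as far as the finitely many weights that occur in \<open>a\<close> are concerned.
\<close>

lemma hw_projection: "\<exists>q c. q - 1 \<in> J \<and> q * a - cscale c 1 \<in> J"
proof -
  have "a \<in> eventually_scalar"
    by (induction a rule: word_induct)
      (auto intro: word_eventually_scalar eventually_scalar_cscale eventually_scalar_add)
  then show ?thesis
    unfolding eventually_scalar_def using projector_one by auto
qed

end

section \<open>Irreducible highest weight quotients\<close>

definition hw_vector ::
  "(complex \<Rightarrow> 'v \<Rightarrow> 'v) \<Rightarrow> ('n::{finite,linorder} free_yangian \<Rightarrow> 'v \<Rightarrow> 'v) \<Rightarrow>
   ('n \<Rightarrow> nat \<Rightarrow> complex) \<Rightarrow> 'v::ab_group_add \<Rightarrow> bool"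
where
  "hw_vector s act wt \<eta> \<longleftrightarrow> \<eta> \<noteq> 0 \<and> (\<forall>i j n. i < j \<longrightarrow> act (gen i j n) \<eta> = 0) \<and>
     (\<forall>i n. act (gen i i n) \<eta> = s (wt i n) \<eta>)"

text \<open>The first module is the irreducible one to be identified; the second will be the tensor
  product, of which a subquotient is taken.\<close>

locale hw_pair =
  X: free_module s act V + Y: free_module s' act' U
  for s :: "complex \<Rightarrow> 'v::ab_group_add \<Rightarrow> 'v"
    and act :: "'n::{finite,linorder} free_yangian \<Rightarrow> 'v \<Rightarrow> 'v" and V
    and s' :: "complex \<Rightarrow> 'w::ab_group_add \<Rightarrow> 'w"
    and act' :: "'n free_yangian \<Rightarrow> 'w \<Rightarrow> 'w" and U +
  fixes wt \<eta> \<eta>'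
  assumes rel: "r \<in> yangian_relators \<Longrightarrow> v \<in> V \<Longrightarrow> act r v = 0"
    and rel': "r \<in> yangian_relators \<Longrightarrow> w \<in> U \<Longrightarrow> act' r w = 0"
    and hw: "\<eta> \<in> V" "hw_vector s act wt \<eta>"
    and hw': "\<eta>' \<in> U" "hw_vector s' act' wt \<eta>'"
    and irred: "\<And>S. S \<subseteq> V \<Longrightarrow> X.subspace S \<Longrightarrow> (\<And>a x. x \<in> S \<Longrightarrow> act a x \<in> S) \<Longrightarrow> S = {0} \<or> S = V"
begin

lemma hw_ideal_pair: "hw_ideal wt {a. act a \<eta> = 0 \<and> act' a \<eta>' = 0}"
proof
  fix a b :: "'n free_yangian"
  assume "a \<in> {a. act a \<eta> = 0 \<and> act' a \<eta>' = 0}"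
  then show "b * a \<in> {a. act a \<eta> = 0 \<and> act' a \<eta>' = 0}"
    using hw(1) hw'(1) by (simp add: X.act_mult Y.act_mult X.act_zero_right Y.act_zero_right)
next
  fix r a :: "'n free_yangian"
  assume "r \<in> yangian_relators"
  then show "r * a \<in> {a. act a \<eta> = 0 \<and> act' a \<eta>' = 0}"
    using hw(1) hw'(1) by (simp add: X.act_mult Y.act_mult rel rel' X.act_closed Y.act_closed)
qed (use hw hw' in \<open>auto simp: hw_vector_def X.act_zero_left Y.act_zero_left X.act_add_left
      Y.act_add_left X.act_diff_left Y.act_diff_left X.act_const Y.act_const\<close>)

interpretation hw_ideal wt "{a. act a \<eta> = 0 \<and> act' a \<eta>' = 0}"
  by (rule hw_ideal_pair)

text \<open>The element \<open>q * x - cscale c 1\<close> annihilates both vectors, so the two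
  modules share the scalar \<open>c\<close>, and the first module determines it to be 1.\<close>

lemma recover_hw:
  assumes "act x \<eta> = \<eta>"
  shows "\<exists>q. act' (q * x) \<eta>' = \<eta>'"
proof -
  obtain q c where q: "act (q - 1) \<eta> = 0" "act' (q - 1) \<eta>' = 0"
      "act (q * x - cscale c 1) \<eta> = 0" "act' (q * x - cscale c 1) \<eta>' = 0"
    using hw_projection[of x] by auto
  then have 1: "act q \<eta> = \<eta>" "act (q * x) \<eta> = s c \<eta>" and 2: "act' (q * x) \<eta>' = s' c \<eta>'"
    using hw(1) hw'(1)
    by (simp_all add: X.act_diff_left Y.act_diff_left X.act_one Y.act_one X.act_const Y.act_const)
  have "s c \<eta> = s 1 \<eta>"
    using 1 assms hw(1) by (simp add: X.act_mult)
  then have "c = 1"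
    using hw(2) by (simp add: X.scale_cancel_right hw_vector_def del: X.scale_one)
  then show ?thesis using 2 by auto
qed

lemma generates:
  assumes "v \<in> V" "v \<noteq> 0" "w \<in> V"
  shows "\<exists>a. w = act a v"
proof -
  let ?S = "range (\<lambda>a. act a v)"
  have "?S = {0} \<or> ?S = V"
  proof (rule irred)
    show "?S \<subseteq> V" using assms X.act_closed by auto
    show "act a x \<in> ?S" if "x \<in> ?S" for a x
      using that assms by (auto simp: X.act_mult[symmetric])
    show "X.subspace ?S"
    proof (rule X.subspaceI)
      show "0 \<in> ?S" using X.act_zero_left[OF assms(1)] by (metis rangeI)
      show "x + y \<in> ?S" if "x \<in> ?S" "y \<in> ?S" for x y
        using that assms by (auto simp: X.act_add_left[symmetric])
      show "s c x \<in> ?S" if "x \<in> ?S" for c x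
        using that assms by (auto simp: X.act_cscale[symmetric])
    qed
  qed
  moreover have "v \<in> ?S" using X.act_one[OF assms(1)] by (metis rangeI)
  ultimately show ?thesis using assms by auto
qed

lemma recover_hw_nonzero:
  assumes "act a \<eta> \<noteq> 0"
  shows "\<exists>q. act' (q * a) \<eta>' = \<eta>'"
proof -
  obtain b where "\<eta> = act b (act a \<eta>)"
    using generates[OF X.act_closed[OF hw(1)] assms hw(1)] by blast
  then have "act (b * a) \<eta> = \<eta>" using hw(1) by (simp add: X.act_mult)
  then show ?thesis using recover_hw[of "b * a"] by (auto simp: mult.assoc[symmetric])
qed

text \<open>It makes the assignment of \<open>act a \<eta>\<close> to \<open>act' a \<eta>'\<close>
  a well-defined homomorphism from the submodule generated by \<open>\<eta>'\<close> to
  \<open>V\<close>.\<close>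

lemma act_eq_transfer:
  assumes "act' a \<eta>' = act' b \<eta>'"
  shows "act a \<eta> = act b \<eta>"
proof (rule ccontr)
  assume "act a \<eta> \<noteq> act b \<eta>"
  then have "act (a - b) \<eta> \<noteq> 0" using hw(1) by (simp add: X.act_diff_left)
  then obtain q where "act' (q * (a - b)) \<eta>' = \<eta>'" using recover_hw_nonzero by blast
  moreover have "act' (q * (a - b)) \<eta>' = 0"
    using hw'(1) assms by (simp add: Y.act_mult Y.act_diff_left Y.act_zero_right)
  ultimately show False using hw'(2) by (simp add: hw_vector_def)
qed

definition M :: "'w set" where "M = range (\<lambda>a. act' a \<eta>')"

text \<open>The kernel of the homomorphism from \<open>M\<close> onto \<open>V\<close>; it turns out
  to be the largest proper submodule of \<open>M\<close>.\<close>

definition K :: "'w set" where "K = {act' a \<eta>' | a. act a \<eta> = 0}"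

lemma M_subspace: "Y.subspace M"
proof (rule Y.subspaceI)
  show "0 \<in> M" using Y.act_zero_left[OF hw'(1)] by (metis M_def rangeI)
qed (use hw'(1) in \<open>auto simp: M_def Y.act_add_left[symmetric] Y.act_cscale[symmetric]\<close>)

lemma K_subspace: "Y.subspace K"
proof (rule Y.subspaceI)
  show "0 \<in> K"
    unfolding K_def mem_Collect_eq
    by (intro exI[of _ 0] conjI Y.act_zero_left[OF hw'(1), symmetric] X.act_zero_left[OF hw(1)])
next
  fix x y assume "x \<in> K" "y \<in> K"
  then obtain a b where "x = act' a \<eta>'" "y = act' b \<eta>'" "act a \<eta> = 0" "act b \<eta> = 0"
    by (auto simp: K_def)
  then have "x + y = act' (a + b) \<eta>'" "act (a + b) \<eta> = 0"
    using hw(1) hw'(1) by (simp_all add: X.act_add_left Y.act_add_left)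
  then show "x + y \<in> K" by (auto simp: K_def)
next
  fix c x assume "x \<in> K"
  then obtain a where "x = act' a \<eta>'" "act a \<eta> = 0"
    by (auto simp: K_def)
  then have "s' c x = act' (cscale c a) \<eta>'" "act (cscale c a) \<eta> = 0"
    using hw(1) hw'(1) by (simp_all add: X.act_cscale Y.act_cscale)
  then show "s' c x \<in> K" by (auto simp: K_def)
qed

lemma K_invariant: "x \<in> K \<Longrightarrow> act' a x \<in> K"
proof -
  assume "x \<in> K"
  then obtain b where "x = act' b \<eta>'" "act b \<eta> = 0"
    by (auto simp: K_def)
  then have "act' a x = act' (a * b) \<eta>'" "act (a * b) \<eta> = 0"
    using hw(1) hw'(1) by (simp_all add: X.act_mult Y.act_mult X.act_zero_right)
  then show ?thesis by (auto simp: K_def)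
qed

lemma act'_in_K_iff: "act' a \<eta>' \<in> K \<longleftrightarrow> act a \<eta> = 0"
proof
  assume "act' a \<eta>' \<in> K"
  then obtain b where "act' a \<eta>' = act' b \<eta>'" "act b \<eta> = 0" by (auto simp: K_def)
  then show "act a \<eta> = 0" using act_eq_transfer[of a b] by simp
qed (auto simp: K_def)

lemma M_invariant: "x \<in> M \<Longrightarrow> act' a x \<in> M"
  using hw'(1) by (auto simp: M_def Y.act_mult[symmetric])

lemma hw_in_M: "\<eta>' \<in> M"
  using Y.act_one[OF hw'(1)] by (metis M_def rangeI)

lemma K_proper: "K \<subset> M"
proof -
  have "\<eta>' \<notin> K"
    using act'_in_K_iff[of 1] hw hw' by (simp add: X.act_one Y.act_one hw_vector_def)
  then show ?thesis using hw_in_M by (auto simp: K_def M_def)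
qed

text \<open>From any element outside \<open>K\<close> the vector \<open>\<eta>'\<close> can be
  recovered, and \<open>\<eta>'\<close> generates all of \<open>M\<close>.\<close>

lemma proper_submodule_in_K:
  assumes "S \<subset> M" "\<And>a x. x \<in> S \<Longrightarrow> act' a x \<in> S"
  shows "S \<subseteq> K"
proof
  fix x assume x: "x \<in> S"
  then obtain a where a: "x = act' a \<eta>'" using assms(1) by (auto simp: M_def)
  have False if nz: "act a \<eta> \<noteq> 0"
  proof -
    obtain q where "act' (q * a) \<eta>' = \<eta>'" using recover_hw_nonzero[OF nz] by blast
    then have "\<eta>' = act' q x" using hw'(1) a by (simp add: Y.act_mult)
    then have "\<eta>' \<in> S" using assms(2) x by metis
    then have "M \<subseteq> S" using assms(2) by (auto simp: M_def)
    then show False using assms(1) by blast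
  qed
  then show "x \<in> K" unfolding a by (auto simp: act'_in_K_iff)
qed

lemma coset_K_eq_iff: "coset K x = coset K y \<longleftrightarrow> x - y \<in> K"
proof
  assume "coset K x = coset K y"
  moreover have "x \<in> coset K x"
    using Y.subspace_0[OF K_subspace] by (auto simp: coset_def intro!: image_eqI[of _ _ 0])
  ultimately show "x - y \<in> K" by (auto simp: coset_def)
next
  assume xy: "x - y \<in> K"
  have "coset K u \<subseteq> coset K v" if "u - v \<in> K" for u v
  proof
    fix z assume "z \<in> coset K u"
    then obtain k where k: "z = u + k" "k \<in> K" by (auto simp: coset_def)
    then have "z = v + ((u - v) + k)" by simp
    then show "z \<in> coset K v"
      using Y.subspace_add[OF K_subspace that k(2)] unfolding coset_def by (rule image_eqI)
  qed
  moreover have "y - x \<in> K" using Y.subspace_neg[OF K_subspace xy] by simp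
  ultimately show "coset K x = coset K y" using xy by blast
qed

lemma quotient_map:
  obtains \<phi> where "bij_betw \<phi> (coset K ` M) V" "\<And>a. \<phi> (coset K (act' a \<eta>')) = act a \<eta>"
proof -
  define \<phi> where "\<phi> C = act (SOME a. coset K (act' a \<eta>') = C) \<eta>" for C
  have \<phi>: "\<phi> (coset K (act' a \<eta>')) = act a \<eta>" for a
  proof -
    have "coset K (act' (SOME b. coset K (act' b \<eta>') = coset K (act' a \<eta>')) \<eta>') = coset K (act' a \<eta>')"
      (is "coset K (act' ?b \<eta>') = _")
      by (rule someI) simp
    then have "act' (?b - a) \<eta>' \<in> K" using hw'(1) by (simp add: coset_K_eq_iff Y.act_diff_left)
    then show ?thesis using hw(1) by (simp add: act'_in_K_iff X.act_diff_left \<phi>_def)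
  qed
  have "inj_on \<phi> (coset K ` M)"
  proof (rule inj_onI, clarsimp simp: M_def \<phi>)
    fix a b assume "act a \<eta> = act b \<eta>"
    then show "coset K (act' a \<eta>') = coset K (act' b \<eta>')"
      using hw(1) hw'(1) by (simp add: coset_K_eq_iff act'_in_K_iff Y.act_diff_left[symmetric] X.act_diff_left)
  qed
  moreover have "\<phi> ` coset K ` M = V"
  proof
    show "\<phi> ` coset K ` M \<subseteq> V" by (auto simp: M_def \<phi> X.act_closed hw(1))
    show "V \<subseteq> \<phi> ` coset K ` M"
    proof
      fix v assume "v \<in> V"
      then obtain a where "v = act a \<eta>" using generates[OF hw(1)] hw(2) by (auto simp: hw_vector_def)
      then show "v \<in> \<phi> ` coset K ` M" by (auto simp: M_def \<phi>[symmetric])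
    qed
  qed
  ultimately show ?thesis using that \<phi> by (auto simp: bij_betw_def)
qed

end

theorem irreducible_hw_quotient:
  assumes vs: "vector_space s" and rep: "W_rep p s \<rho> V"
    and irr: "irreducible_rep s (carrier (W_algebra p)) \<rho> V"
    and hw: "\<eta> \<in> V" "hw_vector s (\<lambda>a. \<rho> (W_class p a)) wt \<eta>"
    and vs': "vector_space s'" and rep': "W_rep p s' \<sigma> U"
    and hw': "\<eta>' \<in> U" "hw_vector s' (\<lambda>a. \<sigma> (W_class p a)) wt \<eta>'"
  defines "N \<equiv> generated_submodule s' (carrier (W_algebra p)) \<sigma> \<eta>'"
  shows "W_isomorphic_quotient p s \<rho> V s' \<sigma> N (proper_submodule_sum s' (carrier (W_algebra p)) \<sigma> N)"
proof -
  interpret X: free_module s "\<lambda>a. \<rho> (W_class p a)" V by (rule free_module_of_W_rep[OF vs rep])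
  interpret Y: free_module s' "\<lambda>a. \<sigma> (W_class p a)" U by (rule free_module_of_W_rep[OF vs' rep'])
  interpret hw_pair s "\<lambda>a. \<rho> (W_class p a)" V s' "\<lambda>a. \<sigma> (W_class p a)" U wt \<eta> \<eta>'
  proof
    fix S assume "S \<subseteq> V" "X.subspace S" "\<And>a x. x \<in> S \<Longrightarrow> \<rho> (W_class p a) x \<in> S"
    then show "S = {0} \<or> S = V"
      using irr unfolding irreducible_rep_def invariant_subspace_def carrier_W_algebra by blast
  qed (use hw hw' W_rep_relator[OF vs rep] W_rep_relator[OF vs' rep'] in auto)
  have inv: "invariant_subspace s' (carrier (W_algebra p)) \<sigma> S \<longleftrightarrow>
      Y.subspace S \<and> (\<forall>a. \<forall>x\<in>S. \<sigma> (W_class p a) x \<in> S)" for S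
    unfolding invariant_subspace_def carrier_W_algebra by blast
  have N: "N = M"
  proof
    show "N \<subseteq> M"
      unfolding N_def generated_submodule_def
      using M_subspace M_invariant hw_in_M by (intro Inter_lower) (auto simp: inv)
    show "M \<subseteq> N"
      unfolding N_def generated_submodule_def M_def by (auto simp: inv)
  qed
  have KM: "proper_submodule_sum s' (carrier (W_algebra p)) \<sigma> N = K"
    unfolding proper_submodule_sum_def N
  proof
    show "K \<subseteq> Y.span (\<Union>{S. invariant_subspace s' (carrier (W_algebra p)) \<sigma> S \<and> S \<subset> M})"
      using K_subspace K_invariant K_proper
      by (intro subset_trans[OF _ Y.span_superset] Union_upper) (auto simp: inv)
    show "Y.span (\<Union>{S. invariant_subspace s' (carrier (W_algebra p)) \<sigma> S \<and> S \<subset> M}) \<subseteq> K"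
    proof (rule Y.span_minimal[OF Union_least K_subspace])
      fix S assume "S \<in> {S. invariant_subspace s' (carrier (W_algebra p)) \<sigma> S \<and> S \<subset> M}"
      then show "S \<subseteq> K" by (intro proper_submodule_in_K) (auto simp: inv)
    qed
  qed
  obtain \<phi> where bij: "bij_betw \<phi> (coset K ` M) V"
    and \<phi>: "\<And>a. \<phi> (coset K (\<sigma> (W_class p a) \<eta>')) = \<rho> (W_class p a) \<eta>"
    using quotient_map by blast
  show ?thesis
    unfolding W_isomorphic_quotient_def KM unfolding N
  proof (intro exI[of _ \<phi>] conjI ballI allI bij)
    fix x y c
    assume "x \<in> M"
    then obtain a where a: "x = \<sigma> (W_class p a) \<eta>'" by (auto simp: M_def)
    show "\<phi> (coset K (x + y)) = \<phi> (coset K x) + \<phi> (coset K y)" if "y \<in> M"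
    proof -
      from that obtain b where b: "y = \<sigma> (W_class p b) \<eta>'" by (auto simp: M_def)
      show ?thesis
        unfolding a b Y.act_add_left[OF hw'(1), symmetric] \<phi> by (rule X.act_add_left[OF hw(1)])
    qed
    show "\<phi> (coset K (s' c x)) = s c (\<phi> (coset K x))"
      unfolding a Y.act_cscale[OF hw'(1), symmetric] \<phi> by (rule X.act_cscale[OF hw(1)])
    show "\<phi> (coset K (\<sigma> A x)) = \<rho> A (\<phi> (coset K x))" if "A \<in> carrier (W_algebra p)" for A
    proof -
      from that obtain b where b: "A = W_class p b" by (auto simp: carrier_W_algebra)
      show ?thesis
        unfolding a b Y.act_mult[OF hw'(1), symmetric] \<phi> by (rule X.act_mult[OF hw(1)])
    qed
  qed
qed

section \<open>Representations of the general linear Lie algebra of arbitrary highest weight\<close>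

text \<open>The formal partial derivative of polynomials whose monomials are exponent functions.
  Truncated subtraction does no harm: if the exponent of \<open>k\<close> is 0, the coefficient
  vanishes.\<close>

definition partial ::
  "'k \<Rightarrow> (('k \<Rightarrow>\<^sub>0 nat) \<Rightarrow>\<^sub>0 complex) \<Rightarrow> (('k \<Rightarrow>\<^sub>0 nat) \<Rightarrow>\<^sub>0 complex)"
where
  "partial k = lext cscale (\<lambda>m. Poly_Mapping.single (m - Poly_Mapping.single k 1)
     (of_nat (Poly_Mapping.lookup m k)))"

definition var :: "'k \<Rightarrow> (('k \<Rightarrow>\<^sub>0 nat) \<Rightarrow>\<^sub>0 complex)" where
  "var k = Poly_Mapping.single (Poly_Mapping.single k 1) 1"

lemma partial_add: "partial k (f + g) = partial k f + partial k g"
  unfolding partial_def by (rule lext_add[OF vector_space_cscale])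

lemma partial_cscale: "partial k (cscale c f) = cscale c (partial k f)"
  unfolding partial_def by (rule lext_cscale[OF vector_space_cscale])

lemma partial_single:
  "partial k (Poly_Mapping.single m c) =
     Poly_Mapping.single (m - Poly_Mapping.single k 1) (c * of_nat (Poly_Mapping.lookup m k))"
  by (simp add: partial_def lext_single[OF vector_space_cscale] cscale_single)

lemma partial_one: "partial k 1 = 0"
  by (metis lookup_zero mult_zero_right of_nat_0 partial_single single_one single_zero)

lemma partial_var: "partial k (var l) = (if k = l then 1 else 0)"
  by (simp add: var_def partial_single lookup_single when_def)

lemma partial_mult: "partial k (f * g) = partial k f * g + f * partial k g"
proof (induction f rule: poly_mapping_single_induct)
  case (single m c)
  show ?case
  proof (induction g rule: poly_mapping_single_induct)
    case (single m' d)
    have shift: "(m1 - Poly_Mapping.single k 1) + m2 = m1 + m2 - Poly_Mapping.single k 1"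
      if "Poly_Mapping.lookup m1 k \<noteq> 0" for m1 m2 :: "'a \<Rightarrow>\<^sub>0 nat"
      using that by (intro poly_mapping_eqI) (auto simp: lookup_add lookup_minus lookup_single when_def)
    have 1: "Poly_Mapping.single (m - Poly_Mapping.single k 1 + m') (c * of_nat (Poly_Mapping.lookup m k) * d)
        = Poly_Mapping.single (m + m' - Poly_Mapping.single k 1) (c * d * of_nat (Poly_Mapping.lookup m k))"
      by (cases "Poly_Mapping.lookup m k = 0") (simp_all add: shift mult_ac del: One_nat_def)
    have 2: "Poly_Mapping.single (m + (m' - Poly_Mapping.single k 1)) (c * (d * of_nat (Poly_Mapping.lookup m' k)))
        = Poly_Mapping.single (m + m' - Poly_Mapping.single k 1) (c * d * of_nat (Poly_Mapping.lookup m' k))"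
      using shift[of m' m]
      by (cases "Poly_Mapping.lookup m' k = 0") (simp_all add: add.commute mult_ac del: One_nat_def)
    show ?case
      unfolding mult_single partial_single 1 2
      by (simp add: lookup_add single_add[symmetric] algebra_simps)
  next
    case (add g g')
    then show ?case by (simp add: partial_add algebra_simps)
  qed
next
  case (add f f')
  then show ?case by (simp add: partial_add algebra_simps)
qed

lemma partial_commute: "partial k (partial l f) = partial l (partial k f)"
proof (induction f rule: poly_mapping_single_induct)
  case (single m c)
  have "m - Poly_Mapping.single l 1 - Poly_Mapping.single k 1
      = m - Poly_Mapping.single k (1::nat) - Poly_Mapping.single l 1"
    by (rule poly_mapping_eqI) (simp add: lookup_minus)
  then show ?case
    by (cases "k = l") (simp_all add: partial_single lookup_minus lookup_single_not_eq mult_ac)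
qed (simp add: partial_add)

section \<open>Polynomial vector fields\<close>

definition derivation ::
  "('k::finite \<Rightarrow> (('k \<Rightarrow>\<^sub>0 nat) \<Rightarrow>\<^sub>0 complex)) \<Rightarrow>
   (('k \<Rightarrow>\<^sub>0 nat) \<Rightarrow>\<^sub>0 complex) \<Rightarrow> (('k \<Rightarrow>\<^sub>0 nat) \<Rightarrow>\<^sub>0 complex)"
where
  "derivation P f = (\<Sum>k\<in>UNIV. P k * partial k f)"

lemma derivation_add: "derivation P (f + g) = derivation P f + derivation P g"
  by (simp add: derivation_def partial_add distrib_left sum.distrib)

lemma derivation_cscale: "derivation P (cscale c f) = cscale c (derivation P f)"
proof -
  have "cscale c (\<Sum>k\<in>UNIV. P k * partial k f) = (\<Sum>k\<in>UNIV. cscale c (P k * partial k f))"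
    by (subst cscale_eq_mult) (simp add: sum_distrib_left cscale_eq_mult[of c "_ * _", symmetric])
  then show ?thesis by (simp add: derivation_def partial_cscale cscale_mult_right)
qed

lemma derivation_one: "derivation P 1 = 0"
  by (simp add: derivation_def partial_one)

lemma derivation_minus: "derivation P (- f) = - derivation P f"
  using derivation_add[of P f "- f"] derivation_cscale[of P 0 0]
  by (simp add: eq_neg_iff_add_eq_0 add.commute)

lemma derivation_mult: "derivation P (f * g) = derivation P f * g + f * derivation P g"
  by (simp add: derivation_def partial_mult sum.distrib sum_distrib_left sum_distrib_right algebra_simps)

lemma derivation_var: "derivation P (var k) = P k"
  by (simp add: derivation_def partial_var if_distrib[of "(*) _"] cong: if_cong)

lemma derivation_sum: "derivation P (\<Sum>i\<in>A. f i) = (\<Sum>i\<in>A. derivation P (f i))"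
  using derivation_cscale[of P 0 0]
  by (induction A rule: infinite_finite_induct) (simp_all add: derivation_add)

text \<open>The second order terms are symmetric in \<open>P\<close> and \<open>Q\<close>, since
  partial derivatives commute, and cancel. Identities between commutators of vector fields thereby
  reduce to their components.\<close>

lemma derivation_commutator:
  "derivation P (derivation Q f) - derivation Q (derivation P f) =
     derivation (\<lambda>k. derivation P (Q k) - derivation Q (P k)) f"
proof -
  have *: "derivation P (derivation Q f) = (\<Sum>l\<in>UNIV. derivation P (Q l) * partial l f)
      + (\<Sum>l\<in>UNIV. \<Sum>k\<in>UNIV. Q l * (P k * partial k (partial l f)))" for P Q
    by (subst derivation_def[of Q])
      (simp add: derivation_sum derivation_mult sum.distrib, simp add: derivation_def sum_distrib_left)
  have "(\<Sum>l\<in>UNIV. \<Sum>k\<in>UNIV. Q l * (P k * partial k (partial l f)))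
      = (\<Sum>l\<in>UNIV. \<Sum>k\<in>UNIV. P l * (Q k * partial k (partial l f)))"
    by (subst sum.swap) (simp add: partial_commute mult_ac)
  then show ?thesis
    unfolding * by (simp add: derivation_def[of "\<lambda>k. _ k - _ k"] sum_subtractf left_diff_distrib)
qed

text \<open>
  For each \<open>K\<close> the variables \<open>y\<^sub>a\<^sub>b\<close> with \<open>a \<le> K < b\<close> are coordinates on the big cell of the
  Grassmannian of \<open>K\<close>-dimensional subspaces, on which the matrix units act by the vector fields
  below; \<open>gl_cocycle\<close> is the logarithmic derivative of the section of the determinant line bundle,
  so that its multiples twist the action on functions.
\<close>

definition gl_left :: "'n::linorder \<Rightarrow> 'n \<Rightarrow> 'n \<Rightarrow> ((('n \<times> 'n \<times> 'n) \<Rightarrow>\<^sub>0 nat) \<Rightarrow>\<^sub>0 complex)" where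
  "gl_left K a i = (if i \<le> K then (if a = i then 1 else 0) else - var (K, a, i))"

definition gl_right :: "'n::linorder \<Rightarrow> 'n \<Rightarrow> 'n \<Rightarrow> ((('n \<times> 'n \<times> 'n) \<Rightarrow>\<^sub>0 nat) \<Rightarrow>\<^sub>0 complex)" where
  "gl_right K j b = (if j \<le> K then var (K, j, b) else (if j = b then 1 else 0))"

definition gl_field ::
  "'n::{finite,linorder} \<Rightarrow> 'n \<Rightarrow> ((('n \<times> 'n \<times> 'n) \<Rightarrow>\<^sub>0 nat) \<Rightarrow>\<^sub>0 complex) \<Rightarrow> ((('n \<times> 'n \<times> 'n) \<Rightarrow>\<^sub>0 nat) \<Rightarrow>\<^sub>0 complex)"
where
  "gl_field i j = derivation (\<lambda>(K, a, b). - (gl_left K a i * gl_right K j b))"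

definition gl_cocycle :: "'n::linorder \<Rightarrow> 'n \<Rightarrow> 'n \<Rightarrow> ((('n \<times> 'n \<times> 'n) \<Rightarrow>\<^sub>0 nat) \<Rightarrow>\<^sub>0 complex)" where
  "gl_cocycle K i j = (if j \<le> K then gl_left K j i else 0)"

text \<open>With Y the matrix of the coordinates, \<open>gl_left\<close> has the block form (1, -Y)
  in the rows up to \<open>K\<close>, and \<open>gl_right\<close> is the block column of Y above 1
  in the columns beyond \<open>K\<close>. Padded by zeros, they are complementary projections with
  sum the identity.\<close>

lemma gl_left_right:
  "(if K < k then gl_right K j k else 0) + (if j \<le> K then gl_left K j k else 0) = (if j = k then 1 else 0)"
  by (auto simp: gl_left_def gl_right_def)

lemma gl_field_zero: "gl_field i j 0 = 0"
  using derivation_cscale[of _ 0 0] by (simp add: gl_field_def)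

lemma gl_field_left:
  "gl_field i j (gl_left K a k) = gl_left K a i * (if K < k then gl_right K j k else 0)"
  by (auto simp: gl_field_def gl_left_def[of K a k] derivation_one derivation_minus derivation_var
      gl_field_zero[unfolded gl_field_def])

lemma gl_field_right:
  "gl_field i j (gl_right K k b) = - ((if k \<le> K then gl_left K k i else 0) * gl_right K j b)"
  by (auto simp: gl_field_def gl_right_def[of K k b] derivation_one derivation_var
      gl_field_zero[unfolded gl_field_def])

lemma gl_field_commutator:
  fixes i j k l :: "'n::{finite,linorder}"
  shows
  "gl_field i j (gl_field k l f) - gl_field k l (gl_field i j f) =
     (if j = k then gl_field i l f else 0) - (if l = i then gl_field k j f else 0)"
proof -
  let ?P = "\<lambda>(i :: 'n) j. \<lambda>(K, a, b). - (gl_left K a i * gl_right K j b)"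
  have "gl_field i j (?P k l y) - gl_field k l (?P i j y) =
      (if j = k then ?P i l y else 0) - (if l = i then ?P k j y else 0)" for y
  proof (cases y)
    case (fields K a b)
    \<comment> \<open>Each derivative yields one half of a Kronecker delta: \<open>A1\<close> and
      \<open>B1\<close> arise from differentiating \<open>gl_left\<close>, \<open>A2\<close> and
      \<open>B2\<close> from differentiating \<open>gl_right\<close>. The sums of the halves are the
      deltas of the gl(N) commutator.\<close>
    define A1 where "A1 = (if K < k then gl_right K j k else 0)"
    define A2 where "A2 = (if j \<le> K then gl_left K j k else 0)"
    define B1 where "B1 = (if K < i then gl_right K l i else 0)"
    define B2 where "B2 = (if l \<le> K then gl_left K l i else 0)"
    have A: "(if j = k then 1 else 0) = A1 + A2" and B: "(if l = i then 1 else 0) = B1 + B2"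
      unfolding A1_def A2_def B1_def B2_def by (rule gl_left_right[symmetric])+
    have "gl_field i j (?P k l y) - gl_field k l (?P i j y) =
        - (gl_left K a i * A1 * gl_right K l b + gl_left K a k * (- (B2 * gl_right K j b)))
        + (gl_left K a k * B1 * gl_right K j b + gl_left K a i * (- (A2 * gl_right K l b)))"
      unfolding A1_def A2_def B1_def B2_def
      by (simp only: fields prod.case gl_field_def[of i j] gl_field_def[of k l] derivation_minus derivation_mult)
        (simp only: gl_field_def[symmetric] gl_field_left gl_field_right, simp)
    also have "\<dots> = - ((A1 + A2) * (gl_left K a i * gl_right K l b))
        + (B1 + B2) * (gl_left K a k * gl_right K j b)"
      by (simp add: algebra_simps)
    also have "\<dots> = (if j = k then ?P i l y else 0) - (if l = i then ?P k j y else 0)"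
      unfolding A[symmetric] B[symmetric] fields by simp
    finally show ?thesis .
  qed
  then have "(\<lambda>y. gl_field i j (?P k l y) - gl_field k l (?P i j y)) =
      (\<lambda>y. (if j = k then ?P i l y else 0) - (if l = i then ?P k j y else 0))"
    by (rule ext)
  then have "gl_field i j (gl_field k l f) - gl_field k l (gl_field i j f) =
      derivation (\<lambda>y. (if j = k then ?P i l y else 0) - (if l = i then ?P k j y else 0)) f"
    unfolding gl_field_def derivation_commutator by simp
  also have "\<dots> = (if j = k then gl_field i l f else 0) - (if l = i then gl_field k j f else 0)"
    by (simp add: derivation_def gl_field_def sum_subtractf left_diff_distrib sum_negf)
  finally show ?thesis .
qed

text \<open>The 1-cocycle condition, which allows a multiple of \<open>gl_cocycle K\<close> to be
  added to \<open>gl_field\<close> without disturbing the commutation relations.\<close>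

lemma gl_field_cocycle:
  "gl_field i j (gl_cocycle K k l) - gl_field k l (gl_cocycle K i j) =
     (if j = k then gl_cocycle K i l else 0) - (if l = i then gl_cocycle K k j else 0)"
proof -
  define A1 where "A1 = (if K < k then gl_right K j k else 0)"
  define A2 where "A2 = (if j \<le> K then gl_left K j k else 0)"
  define B1 where "B1 = (if K < i then gl_right K l i else 0)"
  define B2 where "B2 = (if l \<le> K then gl_left K l i else 0)"
  have A: "(if j = k then 1 else 0) = A1 + A2" and B: "(if l = i then 1 else 0) = B1 + B2"
    unfolding A1_def A2_def B1_def B2_def by (rule gl_left_right[symmetric])+
  have "gl_field i j (gl_cocycle K k l) = B2 * A1" "gl_field k l (gl_cocycle K i j) = A2 * B1"
    by (simp_all add: gl_cocycle_def gl_field_left gl_field_zero A1_def A2_def B1_def B2_def)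
  moreover have "B2 * A1 - A2 * B1 = (A1 + A2) * B2 - (B1 + B2) * A2"
    by (simp add: algebra_simps)
  moreover have "(A1 + A2) * B2 - (B1 + B2) * A2 =
      (if j = k then gl_cocycle K i l else 0) - (if l = i then gl_cocycle K k j else 0)"
    unfolding A[symmetric] B[symmetric] by (simp add: A2_def B2_def gl_cocycle_def)
  ultimately show ?thesis by simp
qed

text \<open>The numbers \<open>t K\<close> are the coordinates of \<open>wt\<close> in the basis of
  fundamental weights, the one for \<open>K\<close> being 1 on the indices \<open>i \<le> K\<close>
  and 0 elsewhere. The system is triangular and is solved downwards from the largest index.\<close>

lemma partial_sums_prescribed:
  fixes wt :: "'n::linorder \<Rightarrow> complex"
  assumes "finite A"
  shows "\<exists>t. \<forall>i\<in>A. (\<Sum>K | K \<in> A \<and> i \<le> K. t K) = wt i"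
  using assms
proof (induction A rule: finite_linorder_min_induct)
  case empty
  show ?case by simp
next
  case (insert b A)
  then obtain t where t: "\<forall>i\<in>A. (\<Sum>K | K \<in> A \<and> i \<le> K. t K) = wt i" by blast
  define t' where "t' = t(b := wt b - sum t A)"
  have b: "b \<notin> A" using insert by auto
  have eq: "sum t' B = sum t B" if "B \<subseteq> A" for B
    using that b by (intro sum.cong) (auto simp: t'_def)
  have "(\<Sum>K | K \<in> insert b A \<and> i \<le> K. t' K) = wt i" if "i \<in> insert b A" for i
  proof (cases "i = b")
    case True
    have "{K \<in> insert b A. i \<le> K} = insert b A"
      using True insert by (auto intro: less_imp_le)
    then show ?thesis using True b insert(1) eq[of A] by (simp add: t'_def)
  next
    case False
    have "{K \<in> insert b A. i \<le> K} = {K \<in> A. i \<le> K}"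
      using False that insert by auto
    then show ?thesis using False that t eq[of "{K \<in> A. i \<le> K}"] by simp
  qed
  then show ?case by blast
qed

definition gl_relations :: "('n \<Rightarrow> 'n \<Rightarrow> 'v \<Rightarrow> 'v::ab_group_add) \<Rightarrow> bool" where
  "gl_relations E \<longleftrightarrow> (\<forall>i j k l f. E i j (E k l f) - E k l (E i j f) =
     (if j = k then E i l f else 0) - (if l = i then E k j f else 0))"

text \<open>Vector fields kill the constant polynomial 1, so the cocycle alone decides how the
  matrix units act on it, and the coefficients \<open>t\<close> can be fitted to any complex
  weight.\<close>

lemma gl_polynomial_module:
  fixes wt :: "'n::{finite,linorder} \<Rightarrow> complex"
  obtains E :: "'n \<Rightarrow> 'n \<Rightarrow> ((('n \<times> 'n \<times> 'n) \<Rightarrow>\<^sub>0 nat) \<Rightarrow>\<^sub>0 complex) \<Rightarrow> ((('n \<times> 'n \<times> 'n) \<Rightarrow>\<^sub>0 nat) \<Rightarrow>\<^sub>0 complex)"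
  where "\<And>i j f g. E i j (f + g) = E i j f + E i j g"
    and "\<And>i j c f. E i j (cscale c f) = cscale c (E i j f)"
    and "gl_relations E"
    and "\<And>i j. i < j \<Longrightarrow> E i j 1 = 0"
    and "\<And>i. E i i 1 = cscale (wt i) 1"
proof -
  obtain t where t: "\<And>i. (\<Sum>K | i \<le> K. t K) = wt i"
    using partial_sums_prescribed[of "UNIV :: 'n set" wt] by auto
  define c where "c i j = (\<Sum>K\<in>UNIV. cscale (t K) (gl_cocycle K i j))" for i j
  define E where "E i j f = gl_field i j f + c i j * f" for i j f
  have c: "gl_field i j (c k l) - gl_field k l (c i j) =
      (if j = k then c i l else 0) - (if l = i then c k j else 0)" for i j k l
  proof -
    have "gl_field i j (c k l) - gl_field k l (c i j) = (\<Sum>K\<in>UNIV. cscale (t K)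
        (gl_field i j (gl_cocycle K k l) - gl_field k l (gl_cocycle K i j)))"
      by (simp add: c_def gl_field_def derivation_sum derivation_cscale sum_subtractf cscale_diff_right)
    also have "\<dots> = (if j = k then c i l else 0) - (if l = i then c k j else 0)"
      unfolding gl_field_cocycle by (simp add: c_def cscale_diff_right sum_subtractf)
    finally show ?thesis .
  qed
  show ?thesis
  proof
    fix i j f g d
    show "E i j (f + g) = E i j f + E i j g"
      by (simp add: E_def gl_field_def derivation_add algebra_simps)
    show "E i j (cscale d f) = cscale d (E i j f)"
      by (simp add: E_def gl_field_def derivation_cscale cscale_add_right cscale_mult_right)
  next
    show "gl_relations E"
      unfolding gl_relations_def
    proof (intro allI)
      fix i j k l f
      have "E i j (E k l f) - E k l (E i j f) =
          (gl_field i j (gl_field k l f) - gl_field k l (gl_field i j f))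
          + (gl_field i j (c k l) - gl_field k l (c i j)) * f"
        by (simp add: E_def gl_field_def derivation_add derivation_mult algebra_simps)
      also have "\<dots> = (if j = k then E i l f else 0) - (if l = i then E k j f else 0)"
        unfolding c gl_field_commutator by (simp add: E_def algebra_simps)
      finally show "E i j (E k l f) - E k l (E i j f) =
          (if j = k then E i l f else 0) - (if l = i then E k j f else 0)" .
    qed
  next
    fix i j :: 'n
    assume "i < j"
    then have "gl_cocycle K i j = 0" for K
      by (auto simp: gl_cocycle_def gl_left_def)
    then show "E i j 1 = 0"
      by (simp add: E_def c_def gl_field_def derivation_one)
  next
    fix i
    have "c i i = (\<Sum>K\<in>UNIV. if i \<le> K then cscale (t K) 1 else 0)"
      unfolding c_def by (rule sum.cong) (auto simp: gl_cocycle_def gl_left_def)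
    also have "\<dots> = (\<Sum>K | i \<le> K. cscale (t K) 1)"
      by (simp add: sum.If_cases)
    also have "\<dots> = cscale (wt i) 1"
      unfolding t[symmetric]
      by (rule poly_mapping_eqI) (simp add: lookup_cscale lookup_sum sum_distrib_right)
    finally show "E i i 1 = cscale (wt i) 1"
      by (simp add: E_def gl_field_def derivation_one)
  qed
qed

section \<open>Irreducible quotients in coordinates\<close>

lemma free_space_subspace: "module.subspace cscale (free_space B)"
proof -
  interpret vector_space cscale by (rule vector_space_cscale)
  show ?thesis
  proof (rule subspaceI)
    show "x + y \<in> free_space B" if "x \<in> free_space B" "y \<in> free_space B" for x y
      using that keys_add[of x y] by (auto simp: free_space_def)
    show "cscale c x \<in> free_space B" if "x \<in> free_space B" for c x
      using that by (auto simp: free_space_def in_keys_iff lookup_cscale)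
  qed (simp add: free_space_def)
qed

lemma single_in_free_space: "b \<in> B \<Longrightarrow> Poly_Mapping.single b c \<in> free_space B"
  by (auto simp: free_space_def)

lemma single_one_eq_iff [simp]:
  "Poly_Mapping.single a (1 :: complex) = Poly_Mapping.single b 1 \<longleftrightarrow> a = b"
  by (metis lookup_single_eq lookup_single_not_eq zero_neq_one)

text \<open>The definition of a gl(N) irrep asks for a space \<open>free_space B\<close> with
  \<open>B\<close> a set of naturals, so the quotient by \<open>J\<close> needs explicit
  coordinates. A basis \<open>C\<close> of \<open>J\<close> is extended to a basis \<open>D\<close>
  of the whole space by unit vectors; the labels of these, numbered by \<open>to_nat\<close>, form
  \<open>B\<close>.\<close>

lemma quotient_coordinates:
  fixes J :: "('b::countable \<Rightarrow>\<^sub>0 complex) set"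
  assumes J: "module.subspace cscale J"
  obtains B and pr :: "('b \<Rightarrow>\<^sub>0 complex) \<Rightarrow> (nat \<Rightarrow>\<^sub>0 complex)" and sec
  where "\<And>f g. pr (f + g) = pr f + pr g" "\<And>c f. pr (cscale c f) = cscale c (pr f)"
    and "\<And>v w. sec (v + w) = sec v + sec w" "\<And>c v. sec (cscale c v) = cscale c (sec v)"
    and "\<And>f. pr f \<in> free_space B" "\<And>v. v \<in> free_space B \<Longrightarrow> pr (sec v) = v"
    and "\<And>f. pr f = 0 \<longleftrightarrow> f \<in> J"
proof -
  interpret X: vector_space "cscale :: complex \<Rightarrow> ('b \<Rightarrow>\<^sub>0 complex) \<Rightarrow> _" by (rule vector_space_cscale)
  interpret Y: vector_space "cscale :: complex \<Rightarrow> (nat \<Rightarrow>\<^sub>0 complex) \<Rightarrow> _" by (rule vector_space_cscale)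
  interpret XY: vector_space_pair "cscale :: complex \<Rightarrow> ('b \<Rightarrow>\<^sub>0 complex) \<Rightarrow> _"
      "cscale :: complex \<Rightarrow> (nat \<Rightarrow>\<^sub>0 complex) \<Rightarrow> _" ..
  let ?e = "\<lambda>b. Poly_Mapping.single b 1 :: 'b \<Rightarrow>\<^sub>0 complex"
  obtain C where C: "C \<subseteq> J" "X.independent C" "J \<subseteq> X.span C"
    by (rule X.basis_exists)
  obtain D where D: "C \<subseteq> D" "D \<subseteq> C \<union> range ?e" "X.independent D" "C \<union> range ?e \<subseteq> X.span D"
    by (rule X.maximal_independent_subset_extend[OF Un_upper1[of C "range ?e"] C(2)])
  have "f \<in> X.span (range ?e)" for f
  proof (induction f rule: poly_mapping_single_induct)
    case (single b c)
    have "cscale c (?e b) \<in> X.span (range ?e)"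
      by (intro X.span_scale X.span_base) auto
    then show ?case by (simp add: cscale_single)
  qed (rule X.span_add)
  moreover have "X.span (range ?e) \<subseteq> X.span D"
    using D(4) by (intro X.span_minimal X.subspace_span) simp
  ultimately have span_D: "f \<in> X.span D" for f by blast
  define B where "B = {n. \<exists>b. n = to_nat b \<and> ?e b \<in> D - C}"
  define h where "h x = (if x \<in> C then 0 else Poly_Mapping.single (to_nat (SOME b. ?e b = x)) (1::complex))" for x
  obtain pr where pr: "Vector_Spaces.linear cscale cscale pr" "\<forall>x\<in>D. pr x = h x"
    using XY.linear_independent_extend[OF D(3), of h] by blast
  have pr_add: "pr (f + g) = pr f + pr g" and pr_scale: "pr (cscale c f) = cscale c (pr f)" for f g c
    using pr(1) by (simp_all add: Vector_Spaces.linear_iff)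
  define sec where "sec = lext cscale (\<lambda>n. if n \<in> B then ?e (from_nat n) else 0)"
  have sec_add: "sec (v + w) = sec v + sec w" and sec_scale: "sec (cscale c v) = cscale c (sec v)" for v w c
    unfolding sec_def by (rule lext_add[OF vector_space_cscale] lext_cscale[OF vector_space_cscale])+
  have sec_single: "sec (Poly_Mapping.single n c) = (if n \<in> B then cscale c (?e (from_nat n)) else 0)" for n c
    by (simp add: sec_def lext_single[OF vector_space_cscale])
  have pr_C: "pr x = 0" if "x \<in> C" for x
    using pr(2) D(1) that by (auto simp: h_def)
  have pr_word: "pr (?e b) = Poly_Mapping.single (to_nat b) 1" if "?e b \<in> D - C" for b
    using pr(2) that by (auto simp: h_def)
  have e_cases: "\<exists>b. x = ?e b \<and> ?e b \<in> D - C \<and> to_nat b \<in> B" if "x \<in> D - C" for x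
    using that D(2) by (auto simp: B_def)
  have pr_free: "pr f \<in> free_space B" for f
    using span_D[of f]
  proof (induction rule: X.span_induct_alt)
    case base
    show ?case using pr_scale[of 0 0] by (simp add: Y.subspace_0[OF free_space_subspace])
  next
    case (step c x y)
    have "pr x \<in> free_space B"
    proof (cases "x \<in> C")
      case True
      then show ?thesis by (simp add: pr_C Y.subspace_0[OF free_space_subspace])
    next
      case False
      with step e_cases obtain b where "x = ?e b" "?e b \<in> D - C" "to_nat b \<in> B" by blast
      then show ?thesis by (simp add: pr_word single_in_free_space)
    qed
    with step show ?case
      by (simp add: pr_add pr_scale Y.subspace_add[OF free_space_subspace] Y.subspace_scale[OF free_space_subspace])
  qed
  have pr_sec: "pr (sec v) = v" if v: "v \<in> free_space B" for v
  proof -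
    have "pr (sec (Poly_Mapping.single n c)) = Poly_Mapping.single n c" if "n \<in> B" for n c
    proof -
      from that obtain b where "n = to_nat b" "?e b \<in> D - C" by (auto simp: B_def)
      then show ?thesis
        using that pr_scale[of c "?e b"] by (simp add: sec_single pr_word cscale_single)
    qed
    then have "pr (sec (\<Sum>n\<in>A. Poly_Mapping.single n (u n))) = (\<Sum>n\<in>A. Poly_Mapping.single n (u n))"
      if "A \<subseteq> B" for A u
      using that pr_scale[of 0 0] sec_scale[of 0 0]
      by (induction A rule: infinite_finite_induct) (auto simp: pr_add sec_add)
    from this[of "Poly_Mapping.keys v" "Poly_Mapping.lookup v"] v show ?thesis
      by (simp add: poly_mapping_sum_single[symmetric] free_space_def)
  qed
  have diff: "f - sec (pr f) \<in> J" for f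
    using span_D[of f]
  proof (induction rule: X.span_induct_alt)
    case base
    show ?case using pr_scale[of 0 0] sec_scale[of 0 0] by (simp add: X.subspace_0[OF J])
  next
    case (step c x y)
    have "x - sec (pr x) \<in> J"
    proof (cases "x \<in> C")
      case True
      then show ?thesis using C(1) sec_scale[of 0 0] by (auto simp: pr_C)
    next
      case False
      with step e_cases obtain b where "x = ?e b" "?e b \<in> D - C" "to_nat b \<in> B" by blast
      then show ?thesis by (simp add: pr_word sec_single X.subspace_0[OF J])
    qed
    then have "cscale c (x - sec (pr x)) + (y - sec (pr y)) \<in> J"
      using step by (intro X.subspace_add[OF J] X.subspace_scale[OF J])
    then show ?case
      by (simp add: pr_add pr_scale sec_add sec_scale cscale_diff_right algebra_simps)
  qed
  have "pr f = 0 \<longleftrightarrow> f \<in> J" for f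
  proof
    assume "pr f = 0"
    then show "f \<in> J" using diff[of f] sec_scale[of 0 0] by simp
  next
    assume "f \<in> J"
    then have "f \<in> X.span C" using C(3) by blast
    then show "pr f = 0"
    proof (induction rule: X.span_induct_alt)
      case base
      show ?case using pr_scale[of 0 0] by simp
    qed (simp add: pr_add pr_scale pr_C)
  qed
  with pr_add pr_scale sec_add sec_scale pr_free pr_sec show ?thesis by (rule that)
qed

instance free_monoid :: (countable) countable
proof
  have "inj (\<lambda>w :: 'a free_monoid. to_nat (case w of Word xs \<Rightarrow> xs))"
    by (rule injI) (auto split: free_monoid.splits)
  then show "\<exists>to_nat :: 'a free_monoid \<Rightarrow> nat. inj to_nat" by blast
qed

definition left_ideal :: "('g free_monoid \<Rightarrow>\<^sub>0 complex) set \<Rightarrow> bool" where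
  "left_ideal J \<longleftrightarrow> 0 \<in> J \<and> (\<forall>a\<in>J. \<forall>b\<in>J. a + b \<in> J) \<and> (\<forall>a. \<forall>b\<in>J. a * b \<in> J)"

lemma left_ideal_subspace:
  assumes "left_ideal J"
  shows "module.subspace cscale J"
proof -
  interpret vector_space "cscale :: complex \<Rightarrow> ('a free_monoid \<Rightarrow>\<^sub>0 complex) \<Rightarrow> _"
    by (rule vector_space_cscale)
  show ?thesis
  proof (rule subspaceI)
    show "cscale c x \<in> J" if "x \<in> J" for c x
      using that assms by (subst cscale_eq_mult) (auto simp: left_ideal_def)
  qed (use assms in \<open>auto simp: left_ideal_def\<close>)
qed

lemma maximal_left_ideal:
  assumes I: "left_ideal I" "1 \<notin> I"
  obtains J where "left_ideal J" "1 \<notin> J" "I \<subseteq> J"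
    "\<And>L. left_ideal L \<Longrightarrow> J \<subseteq> L \<Longrightarrow> 1 \<notin> L \<Longrightarrow> L = J"
proof -
  let ?A = "{J. left_ideal J \<and> 1 \<notin> J \<and> I \<subseteq> J}"
  have "\<exists>M\<in>?A. \<forall>X\<in>?A. M \<subseteq> X \<longrightarrow> X = M"
  proof (rule subset_Zorn_nonempty)
    show "?A \<noteq> {}" using I by blast
  next
    fix \<C> assume "\<C> \<noteq> {}" and ch: "subset.chain ?A \<C>"
    then obtain J0 where J0: "J0 \<in> \<C>" by blast
    have A: "left_ideal J" "1 \<notin> J" "I \<subseteq> J" if "J \<in> \<C>" for J
      using ch that by (auto simp: subset.chain_def)
    have "left_ideal (\<Union>\<C>)"
      unfolding left_ideal_def
    proof (intro conjI ballI allI)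
      show "0 \<in> \<Union>\<C>" using J0 A(1) by (auto simp: left_ideal_def)
      show "a * b \<in> \<Union>\<C>" if "b \<in> \<Union>\<C>" for a b
        using that A(1) unfolding left_ideal_def by blast
      fix a b assume "a \<in> \<Union>\<C>" "b \<in> \<Union>\<C>"
      then obtain P Q where PQ: "a \<in> P" "b \<in> Q" "P \<in> \<C>" "Q \<in> \<C>" by blast
      then have "P \<subseteq> Q \<or> Q \<subseteq> P" using ch by (auto simp: subset.chain_def)
      then show "a + b \<in> \<Union>\<C>"
        using PQ A(1) unfolding left_ideal_def by blast
    qed
    moreover have "I \<subseteq> \<Union>\<C>" using J0 A(3) by blast
    ultimately show "\<Union>\<C> \<in> ?A" using A(2) by blast
  qed
  then obtain J where J: "J \<in> ?A" and max: "\<forall>X\<in>?A. J \<subseteq> X \<longrightarrow> X = J" by (elim bexE)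
  show ?thesis
  proof (rule that[of J])
    show "L = J" if "left_ideal L" "J \<subseteq> L" "1 \<notin> L" for L
      using that J by (intro max[rule_format]) auto
  qed (use J in auto)
qed

text \<open>The module is the free algebra on the matrix units modulo a maximal left ideal; the
  polynomial module serves to show that the annihilator below it is proper. Linearity and the
  commutation relations are asserted on the whole ambient space, because tensor products are later
  formed from operators defined there.\<close>

lemma gl_irrep_exists:
  fixes wt :: "'n::{finite,linorder} \<Rightarrow> complex"
  obtains B \<pi> \<eta> where "gl_highest_weight_irrep B \<pi> \<eta>"
    and "\<And>i. \<pi> (matrix_unit i i) \<eta> = cscale (wt i) \<eta>"
    and "\<And>X v w. \<pi> X (v + w) = \<pi> X v + \<pi> X w"
    and "\<And>X c v. \<pi> X (cscale c v) = cscale c (\<pi> X v)"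
    and "gl_relations (\<lambda>i j. \<pi> (matrix_unit i j))"
proof -
  obtain E :: "'n \<Rightarrow> 'n \<Rightarrow> ((('n \<times> 'n \<times> 'n) \<Rightarrow>\<^sub>0 nat) \<Rightarrow>\<^sub>0 complex) \<Rightarrow> ((('n \<times> 'n \<times> 'n) \<Rightarrow>\<^sub>0 nat) \<Rightarrow>\<^sub>0 complex)"
    where E_add: "\<And>i j f g. E i j (f + g) = E i j f + E i j g"
      and E_scale: "\<And>i j c f. E i j (cscale c f) = cscale c (E i j f)"
      and E_rel: "gl_relations E"
      and E_raise: "\<And>i j. i < j \<Longrightarrow> E i j 1 = 0"
      and E_wt: "\<And>i. E i i 1 = cscale (wt i) 1"
    by (rule gl_polynomial_module[of wt]) (rule that)
  interpret A: free_module cscale "feval cscale (\<lambda>(i, j). E i j)" UNIV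
    by (rule free_module_feval)
      (auto simp: vector_space_cscale module.subspace_UNIV[OF vector_space_cscale[unfolded module_iff_vector_space[symmetric]]] E_add E_scale)
  define act where "act = feval cscale (\<lambda>(i, j). E i j)"
  define g where "g i j = word [(i, j)]" for i j :: 'n
  have act_g: "act (g i j) f = E i j f" for i j f
    by (simp add: act_def g_def word_def feval_letter[OF vector_space_cscale])
  note act = A.act_add_left[folded act_def] A.act_mult[folded act_def] A.act_zero_left[folded act_def]
    A.act_diff_left[folded act_def] A.act_one[folded act_def] A.act_const[folded act_def]
    A.act_zero_right[folded act_def]
  have Ann: "left_ideal {a. act a 1 = 0}" "1 \<notin> {a. act a 1 = 0}"
    by (auto simp: left_ideal_def act)
  obtain J where J: "left_ideal J" "1 \<notin> J" "{a. act a 1 = 0} \<subseteq> J"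
    and J_max: "\<And>L. left_ideal L \<Longrightarrow> J \<subseteq> L \<Longrightarrow> 1 \<notin> L \<Longrightarrow> L = J"
    by (rule maximal_left_ideal[OF Ann]) (rule that)
  have J_left: "b \<in> J \<Longrightarrow> a * b \<in> J" for a b using J(1) by (auto simp: left_ideal_def)
  obtain B and pr :: "(('n \<times> 'n) free_monoid \<Rightarrow>\<^sub>0 complex) \<Rightarrow> (nat \<Rightarrow>\<^sub>0 complex)" and sec
    where pr_add: "\<And>f g. pr (f + g) = pr f + pr g" and pr_scale: "\<And>c f. pr (cscale c f) = cscale c (pr f)"
    and sec_add: "\<And>v w. sec (v + w) = sec v + sec w" and sec_scale: "\<And>c v. sec (cscale c v) = cscale c (sec v)"
    and pr_free: "\<And>f. pr f \<in> free_space B" and pr_sec: "\<And>v. v \<in> free_space B \<Longrightarrow> pr (sec v) = v"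
    and pr_zero: "\<And>f. pr f = 0 \<longleftrightarrow> f \<in> J"
    by (rule quotient_coordinates[OF left_ideal_subspace[OF J(1)]]) (rule that)
  have pr_diff: "pr (a - b) = pr a - pr b" for a b
    using pr_add[of "a - b" b] by (simp add: algebra_simps)
  have pr_0: "pr 0 = 0" using pr_diff[of 0 0] by simp
  have pr_mult: "pr (a * sec (pr b)) = pr (a * b)" for a b
  proof -
    have "pr (b - sec (pr b)) = 0" by (simp add: pr_diff pr_sec pr_free)
    then have "pr (a * (b - sec (pr b))) = 0" using J_left pr_zero by blast
    then show ?thesis by (simp add: right_diff_distrib pr_diff)
  qed
  \<comment> \<open>A section \<open>sec\<close> of \<open>pr\<close> that is linear on the whole ambient space makes the relations hold there, not only on \<open>free_space B\<close>.\<close>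
  define e where "e i j v = pr (g i j * sec v)" for i j v
  have e_add: "e i j (v + w) = e i j v + e i j w" for i j v w
    by (simp add: e_def sec_add distrib_left pr_add)
  have e_scale: "e i j (cscale c v) = cscale c (e i j v)" for i j c v
    by (simp add: e_def sec_scale cscale_mult_right pr_scale)
  have e_pr: "e i j (pr a) = pr (g i j * a)" for i j a
    by (simp add: e_def pr_mult)
  have e_rel: "e i j (e k l v) - e k l (e i j v) =
      (if j = k then e i l v else 0) - (if l = i then e k j v else 0)" for i j k l v
  proof -
    \<comment> \<open>This element kills every polynomial. Hence its product with any further factor
      on the right still annihilates 1 and lies in \<open>J\<close>, although \<open>J\<close> is
      only a left ideal.\<close>
    let ?x = "g i j * g k l - g k l * g i j - ((if j = k then g i l else 0) - (if l = i then g k j else 0))"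
    have "act ?x f = 0" for f
      using E_rel by (simp add: act act_g gl_relations_def)
    then have "act (?x * sec v) 1 = 0" by (simp add: act)
    then have "pr (?x * sec v) = 0" using J(3) pr_zero by blast
    then show ?thesis
      unfolding e_def[of k l v] e_def[of i j v] e_pr
      by (auto simp: left_diff_distrib pr_diff mult.assoc e_def pr_0 split: if_splits)
  qed
  define \<pi> where "\<pi> X v = (\<Sum>i\<in>UNIV. \<Sum>j\<in>UNIV. cscale (X $ i $ j) (e i j v))" for X :: "'n gl" and v
  interpret V: vector_space "cscale :: complex \<Rightarrow> (nat \<Rightarrow>\<^sub>0 complex) \<Rightarrow> _" by (rule vector_space_cscale)
  have \<pi>_unit: "\<pi> (matrix_unit i j) v = e i j v" for i j v
  proof -
    have "cscale (matrix_unit i j $ a $ b) (e a b v) = (if b = j then (if a = i then e i j v else 0) else 0)" for a b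
      by (simp add: matrix_unit_def)
    then show ?thesis by (simp add: \<pi>_def)
  qed
  have \<pi>_add: "\<pi> X (v + w) = \<pi> X v + \<pi> X w" for X v w
    by (simp add: \<pi>_def e_add cscale_add_right sum.distrib)
  have \<pi>_scale: "\<pi> X (cscale c v) = cscale c (\<pi> X v)" for X c v
    by (simp add: \<pi>_def e_scale V.scale_sum_right mult.commute)
  have \<pi>_sum: "\<pi> X (\<Sum>i\<in>S. f i) = (\<Sum>i\<in>S. \<pi> X (f i))" for X S and f :: "'n \<Rightarrow> _"
    using \<pi>_scale[of X 0 0] by (induction S rule: infinite_finite_induct) (simp_all add: \<pi>_add)
  have e_sum: "e i j (\<Sum>k\<in>S. f k) = (\<Sum>k\<in>S. e i j (f k))" for i j S and f :: "'n \<Rightarrow> _"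
    using e_scale[of i j 0 0] by (induction S rule: infinite_finite_induct) (simp_all add: e_add)
  have prod: "\<pi> X (\<pi> Y v) = (\<Sum>i\<in>UNIV. \<Sum>j\<in>UNIV. \<Sum>k\<in>UNIV. \<Sum>l\<in>UNIV.
      cscale (X $ i $ j * Y $ k $ l) (e i j (e k l v)))" for X Y v
    by (simp add: \<pi>_def e_sum e_scale V.scale_sum_right)
  \<comment> \<open>The sums are brought into the order of \<open>prod\<close>, so that the two
    products can be subtracted term by term.\<close>
  have prod': "\<pi> Y (\<pi> X v) = (\<Sum>i\<in>UNIV. \<Sum>j\<in>UNIV. \<Sum>k\<in>UNIV. \<Sum>l\<in>UNIV.
      cscale (X $ i $ j * Y $ k $ l) (e k l (e i j v)))" for X Y v
  proof -
    have "\<pi> Y (\<pi> X v) = (\<Sum>k\<in>UNIV. \<Sum>l\<in>UNIV. \<Sum>i\<in>UNIV. \<Sum>j\<in>UNIV.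
      cscale (X $ i $ j * Y $ k $ l) (e k l (e i j v)))"
      unfolding prod by (simp add: mult.commute)
    also have "\<dots> = (\<Sum>k\<in>UNIV. \<Sum>i\<in>UNIV. \<Sum>l\<in>UNIV. \<Sum>j\<in>UNIV.
      cscale (X $ i $ j * Y $ k $ l) (e k l (e i j v)))"
      by (intro sum.cong refl sum.swap)
    also have "\<dots> = (\<Sum>i\<in>UNIV. \<Sum>k\<in>UNIV. \<Sum>j\<in>UNIV. \<Sum>l\<in>UNIV.
      cscale (X $ i $ j * Y $ k $ l) (e k l (e i j v)))"
      by (subst sum.swap) (intro sum.cong refl sum.swap)
    also have "\<dots> = (\<Sum>i\<in>UNIV. \<Sum>j\<in>UNIV. \<Sum>k\<in>UNIV. \<Sum>l\<in>UNIV.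
      cscale (X $ i $ j * Y $ k $ l) (e k l (e i j v)))"
      by (intro sum.cong refl sum.swap)
    finally show ?thesis .
  qed
  have bracket: "\<pi> (X ** Y - Y ** X) v = \<pi> X (\<pi> Y v) - \<pi> Y (\<pi> X v)" for X Y v
  proof -
    have if_scale: "cscale c (if P then x else 0) = (if P then cscale c x else 0)" for c P and x :: "nat \<Rightarrow>\<^sub>0 complex"
      by simp
    have "\<pi> X (\<pi> Y v) - \<pi> Y (\<pi> X v) = (\<Sum>i\<in>UNIV. \<Sum>j\<in>UNIV. \<Sum>k\<in>UNIV. \<Sum>l\<in>UNIV.
      cscale (X $ i $ j * Y $ k $ l) ((if j = k then e i l v else 0) - (if l = i then e k j v else 0)))"
      unfolding prod[of X Y] prod'[of Y X] sum_subtractf[symmetric] cscale_diff_right[symmetric] e_rel ..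
    also have "\<dots> = (\<Sum>i\<in>UNIV. \<Sum>j\<in>UNIV. \<Sum>k\<in>UNIV. \<Sum>l\<in>UNIV. if j = k then cscale (X $ i $ j * Y $ k $ l) (e i l v) else 0)
      - (\<Sum>i\<in>UNIV. \<Sum>j\<in>UNIV. \<Sum>k\<in>UNIV. \<Sum>l\<in>UNIV. if l = i then cscale (X $ i $ j * Y $ k $ l) (e k j v) else 0)"
      by (simp only: cscale_diff_right sum_subtractf if_scale)
    also have "(\<Sum>i\<in>UNIV. \<Sum>j\<in>UNIV. \<Sum>k\<in>UNIV. \<Sum>l\<in>UNIV. if j = k then cscale (X $ i $ j * Y $ k $ l) (e i l v) else 0)
      = (\<Sum>i\<in>UNIV. \<Sum>l\<in>UNIV. \<Sum>j\<in>UNIV. cscale (X $ i $ j * Y $ j $ l) (e i l v))"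
    proof -
      have "(\<Sum>k\<in>UNIV. \<Sum>l\<in>UNIV. if j = k then cscale (X $ i $ j * Y $ k $ l) (e i l v) else 0)
        = (\<Sum>l\<in>UNIV. cscale (X $ i $ j * Y $ j $ l) (e i l v))" for i j
        by (subst sum.swap) simp
      then show ?thesis by simp (intro sum.cong refl sum.swap)
    qed
    also have "(\<Sum>i\<in>UNIV. \<Sum>j\<in>UNIV. \<Sum>k\<in>UNIV. \<Sum>l\<in>UNIV. if l = i then cscale (X $ i $ j * Y $ k $ l) (e k j v) else 0)
      = (\<Sum>k\<in>UNIV. \<Sum>j\<in>UNIV. \<Sum>i\<in>UNIV. cscale (Y $ k $ i * X $ i $ j) (e k j v))"
    proof -
      have "(\<Sum>i\<in>UNIV. \<Sum>j\<in>UNIV. \<Sum>k\<in>UNIV. \<Sum>l\<in>UNIV. if l = i then cscale (X $ i $ j * Y $ k $ l) (e k j v) else 0)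
        = (\<Sum>i\<in>UNIV. \<Sum>j\<in>UNIV. \<Sum>k\<in>UNIV. cscale (Y $ k $ i * X $ i $ j) (e k j v))"
        by (simp add: mult.commute)
      also have "\<dots> = (\<Sum>i\<in>UNIV. \<Sum>k\<in>UNIV. \<Sum>j\<in>UNIV. cscale (Y $ k $ i * X $ i $ j) (e k j v))"
        by (intro sum.cong refl sum.swap)
      also have "\<dots> = (\<Sum>k\<in>UNIV. \<Sum>j\<in>UNIV. \<Sum>i\<in>UNIV. cscale (Y $ k $ i * X $ i $ j) (e k j v))"
        by (subst sum.swap) (intro sum.cong refl sum.swap)
      finally show ?thesis .
    qed
    also have "(\<Sum>i\<in>UNIV. \<Sum>l\<in>UNIV. \<Sum>j\<in>UNIV. cscale (X $ i $ j * Y $ j $ l) (e i l v))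
       - (\<Sum>k\<in>UNIV. \<Sum>j\<in>UNIV. \<Sum>i\<in>UNIV. cscale (Y $ k $ i * X $ i $ j) (e k j v)) = \<pi> (X ** Y - Y ** X) v"
      by (simp add: \<pi>_def matrix_matrix_mult_def V.scale_sum_left V.scale_left_diff_distrib sum_subtractf)
    finally show ?thesis ..
  qed
  have \<pi>_free: "\<pi> X v \<in> free_space B" for X v
    unfolding \<pi>_def e_def
    by (intro V.subspace_sum[OF free_space_subspace] V.subspace_scale[OF free_space_subspace] pr_free)
  have "gl_rep B \<pi>"
    unfolding gl_rep_def linear_map_on_def
    using \<pi>_add \<pi>_scale \<pi>_free bracket
    by (auto simp: \<pi>_def V.scale_left_distrib sum.distrib V.scale_sum_right)
  moreover have "irreducible_rep cscale UNIV \<pi> (free_space B)"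
    unfolding irreducible_rep_def
  proof (intro conjI allI impI)
    show "free_space B \<noteq> {0}" using pr_free[of 1] pr_zero[of 1] J(2) by auto
    fix S assume "S \<subseteq> free_space B \<and> invariant_subspace cscale UNIV \<pi> S"
    then have S: "S \<subseteq> free_space B" "V.subspace S" "\<And>X v. v \<in> S \<Longrightarrow> \<pi> X v \<in> S"
      by (auto simp: invariant_subspace_def)
    \<comment> \<open>Submodules of the quotient correspond to left ideals that contain
      \<open>J\<close>, which turns maximality of \<open>J\<close> into irreducibility.\<close>
    let ?L = "{a. pr a \<in> S}"
    have "word xs * b \<in> ?L" if "b \<in> ?L" for xs b
    proof (induction xs)
      case (Cons x xs)
      obtain i j where "x = (i, j)" by (cases x)
      then have "word (x # xs) = g i j * word xs"
        by (simp add: g_def word_def mult_single)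
      then have "pr (word (x # xs) * b) = \<pi> (matrix_unit i j) (pr (word xs * b))"
        by (simp add: \<pi>_unit e_pr mult.assoc)
      then show ?case using Cons S(3) by simp
    qed (use that in simp)
    then have "a * b \<in> ?L" if "b \<in> ?L" for a b
      using that S(2)
      by (induction a rule: word_induct)
        (auto simp: cscale_mult_left pr_scale distrib_right pr_add V.subspace_scale V.subspace_add)
    then have "left_ideal ?L"
      using S(2) by (auto simp: left_ideal_def pr_0 pr_add V.subspace_0 V.subspace_add)
    moreover have "J \<subseteq> ?L"
      using pr_zero V.subspace_0[OF S(2)] by (metis mem_Collect_eq subsetI)
    ultimately have "1 \<in> ?L \<or> ?L = J" using J_max by blast
    then show "S = {0} \<or> S = free_space B"
    proof
      assume 1: "1 \<in> ?L"
      have "v \<in> S" if "v \<in> free_space B" for v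
      proof -
        have "sec v * 1 \<in> ?L" using 1 \<open>left_ideal ?L\<close> unfolding left_ideal_def by blast
        then show ?thesis by (simp add: pr_sec that)
      qed
      then show ?thesis using S(1) by blast
    next
      assume L: "?L = J"
      have "v = 0" if "v \<in> S" for v
      proof -
        have "pr (sec v) = v" using that S(1) pr_sec by blast
        then show "v = 0" using that L pr_zero[of "sec v"] by auto
      qed
      then show ?thesis using V.subspace_0[OF S(2)] by blast
    qed
  qed
  moreover have \<pi>_wt: "\<pi> (matrix_unit i i) (pr 1) = cscale (wt i) (pr 1)" for i
  proof -
    have "act (g i i - cscale (wt i) 1) 1 = 0" by (simp add: act act_g E_wt)
    then have "pr (g i i - cscale (wt i) 1) = 0" using J(3) pr_zero by blast
    then show ?thesis by (simp add: \<pi>_unit e_pr pr_diff pr_scale)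
  qed
  moreover have "gl_highest_weight_vector \<pi> (pr 1)"
    unfolding gl_highest_weight_vector_def
  proof (intro conjI allI impI)
    show "pr 1 \<noteq> 0" using pr_zero[of 1] J(2) by simp
    show "\<exists>wt. \<forall>i. \<pi> (matrix_unit i i) (pr 1) = cscale (wt i) (pr 1)" using \<pi>_wt by blast
    fix i j :: 'n assume "i < j"
    then have "act (g i j) 1 = 0" by (simp add: act_g E_raise)
    then have "pr (g i j) = 0" using J(3) pr_zero by blast
    then show "\<pi> (matrix_unit i j) (pr 1) = 0" by (simp add: \<pi>_unit e_pr)
  qed
  ultimately have "gl_highest_weight_irrep B \<pi> (pr 1)"
    using pr_free by (simp add: gl_highest_weight_irrep_def)
  moreover have "gl_relations (\<lambda>i j. \<pi> (matrix_unit i j))"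
    using e_rel by (simp add: gl_relations_def \<pi>_unit)
  ultimately show ?thesis using \<pi>_wt \<pi>_add \<pi>_scale by (intro that)
qed

section \<open>The coproduct\<close>

text \<open>
  The defining relations in telescoped form. Integer indices allow \<open>T\<^sub>m = 0\<close> for \<open>m < 0\<close>.
\<close>

definition yangian_relation :: "('n \<Rightarrow> 'n \<Rightarrow> int \<Rightarrow> 'r::ring) \<Rightarrow> bool" where
  "yangian_relation T \<longleftrightarrow> (\<forall>i j k l m n.
     (T i j (m + 1) * T k l n - T k l n * T i j (m + 1)) - (T i j m * T k l (n + 1) - T k l (n + 1) * T i j m) =
     T k j m * T i l n - T k j n * T i l m)"

text \<open>In generating series the new operators are (1 + E u^-1) T(u): the coproduct with one
  evaluation factor on the left, E acting on that factor and T(u) on the others. As the entries of E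
  and T commute, all that has to be controlled is the reordering of two entries of E.\<close>

lemma yangian_relation_coproduct:
  fixes T :: "'n::finite \<Rightarrow> 'n \<Rightarrow> int \<Rightarrow> 'r::ring" and E :: "'n \<Rightarrow> 'n \<Rightarrow> 'r"
  assumes T: "yangian_relation T"
    and ET: "\<And>i j k l m. E i j * T k l m = T k l m * E i j"
    and EE: "\<And>i j k l. E i j * E k l - E k l * E i j = (if j = k then E i l else 0) - (if l = i then E k j else 0)"
  shows "yangian_relation (\<lambda>i j m. T i j m + (\<Sum>a\<in>UNIV. E i a * T a j (m - 1)))"
proof -
  define S where "S i j m = T i j m + (\<Sum>a\<in>UNIV. E i a * T a j (m - 1))" for i j m
  define C where "C i j m k l n = T i j m * T k l n - T k l n * T i j m" for i j m k l n
  have C_step: "C i j (m + 1) k l n - C i j m k l (n + 1) = T k j m * T i l n - T k j n * T i l m" for i j k l m n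
    using T by (simp add: yangian_relation_def C_def)
  have pass: "T i j m * (E k l * x) = E k l * (T i j m * x)" for i j m k l x
    by (metis ET mult.assoc)
  have prod: "S i j m * S k l n = T i j m * T k l n + (\<Sum>b\<in>UNIV. E k b * (T i j m * T b l (n - 1)))
      + (\<Sum>a\<in>UNIV. E i a * (T a j (m - 1) * T k l n))
      + (\<Sum>a\<in>UNIV. \<Sum>b\<in>UNIV. E i a * (E k b * (T a j (m - 1) * T b l (n - 1))))" for i j m k l n
    by (simp add: S_def distrib_left distrib_right sum_distrib_left sum_distrib_right sum.distrib
        mult.assoc pass) (subst sum.swap, rule refl)
  have prod': "S k l n * S i j m = T k l n * T i j m + (\<Sum>b\<in>UNIV. E k b * (T b l (n - 1) * T i j m))
      + (\<Sum>a\<in>UNIV. E i a * (T k l n * T a j (m - 1)))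
      + (\<Sum>a\<in>UNIV. \<Sum>b\<in>UNIV. E k b * (E i a * (T b l (n - 1) * T a j (m - 1))))" for i j m k l n
    unfolding prod by (subst sum.swap) (simp add: algebra_simps)
  have EE': "E k b * (E i a * x) = E i a * (E k b * x)
      - (if a = k then E i b * x else 0) + (if b = i then E k a * x else 0)" for a b i k x
  proof -
    have "E k b * E i a = E i a * E k b - ((if a = k then E i b else 0) - (if b = i then E k a else 0))"
      unfolding EE[symmetric] by simp
    then have "E k b * E i a * x = E i a * E k b * x - ((if a = k then E i b * x else 0) - (if b = i then E k a * x else 0))"
      by (auto simp: left_diff_distrib)
    then show ?thesis by (simp add: mult.assoc)
  qed
  have EE_sum: "(\<Sum>a\<in>UNIV. \<Sum>b\<in>UNIV. E k b * (E i a * x a b)) =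
      (\<Sum>a\<in>UNIV. \<Sum>b\<in>UNIV. E i a * (E k b * x a b))
      - (\<Sum>a\<in>UNIV. \<Sum>b\<in>UNIV. if a = k then E i b * x a b else 0)
      + (\<Sum>a\<in>UNIV. \<Sum>b\<in>UNIV. if b = i then E k a * x a b else 0)" for i k x
  proof -
    have "(\<Sum>a\<in>UNIV. \<Sum>b\<in>UNIV. E k b * (E i a * x a b)) =
      (\<Sum>a\<in>UNIV. \<Sum>b\<in>UNIV. E i a * (E k b * x a b)
        - (if a = k then E i b * x a b else 0) + (if b = i then E k a * x a b else 0))"
      by (intro sum.cong refl EE')
    then show ?thesis by (simp only: sum.distrib sum_subtractf)
  qed
  have comm: "S i j m * S k l n - S k l n * S i j m = C i j m k l n
      + (\<Sum>b\<in>UNIV. E k b * C i j m b l (n - 1)) + (\<Sum>a\<in>UNIV. E i a * C a j (m - 1) k l n)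
      + (\<Sum>a\<in>UNIV. \<Sum>b\<in>UNIV. E i a * (E k b * C a j (m - 1) b l (n - 1)))
      + (\<Sum>b\<in>UNIV. E i b * (T b l (n - 1) * T k j (m - 1)))
      - (\<Sum>a\<in>UNIV. E k a * (T i l (n - 1) * T a j (m - 1)))" for i j m k l n
  proof -
    have "(\<Sum>a\<in>UNIV. \<Sum>b\<in>UNIV. E k b * (E i a * (T b l (n - 1) * T a j (m - 1)))) =
        (\<Sum>a\<in>UNIV. \<Sum>b\<in>UNIV. E i a * (E k b * (T b l (n - 1) * T a j (m - 1))))
        - (\<Sum>a\<in>UNIV. \<Sum>b\<in>UNIV. if a = k then E i b * (T b l (n - 1) * T a j (m - 1)) else 0)
        + (\<Sum>a\<in>UNIV. \<Sum>b\<in>UNIV. if b = i then E k a * (T b l (n - 1) * T a j (m - 1)) else 0)"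
      by (rule EE_sum)
    also have "(\<Sum>a\<in>UNIV. \<Sum>b\<in>UNIV. if a = k then E i b * (T b l (n - 1) * T a j (m - 1)) else 0)
        = (\<Sum>b\<in>UNIV. E i b * (T b l (n - 1) * T k j (m - 1)))"
      by (subst sum.swap) simp
    also have "(\<Sum>a\<in>UNIV. \<Sum>b\<in>UNIV. if b = i then E k a * (T b l (n - 1) * T a j (m - 1)) else 0)
        = (\<Sum>a\<in>UNIV. E k a * (T i l (n - 1) * T a j (m - 1)))"
      by simp
    finally show ?thesis
      unfolding prod[of i j m k l n] prod'[of k l n i j m]
      by (simp add: C_def right_diff_distrib sum_subtractf)
  qed
  have "(S i j (m + 1) * S k l n - S k l n * S i j (m + 1)) - (S i j m * S k l (n + 1) - S k l (n + 1) * S i j m) =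
     S k j m * S i l n - S k j n * S i l m" for i j k l m n
  proof -
    \<comment> \<open>\<open>Z\<close> is the right side of the relation for the terms with two
      entries of E. Reordering these entries leaves linear terms in \<open>Z k b = W b\<close> and
      \<open>Z a i = U a\<close>. They cancel the \<open>U\<close> and \<open>W\<close> that come
      from the terms with a single entry of E.\<close>
    define U where "U b = T i j (m - 1) * T b l (n - 1) - T i j (n - 1) * T b l (m - 1)" for b
    define W where "W b = T b j (m - 1) * T k l (n - 1) - T b j (n - 1) * T k l (m - 1)" for b
    define Z where "Z a b = T b j (m - 1) * T a l (n - 1) - T b j (n - 1) * T a l (m - 1)" for a b
    have lhs: "(S i j (m + 1) * S k l n - S k l n * S i j (m + 1)) - (S i j m * S k l (n + 1) - S k l (n + 1) * S i j m)
      = (C i j (m + 1) k l n - C i j m k l (n + 1))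
      + (\<Sum>b\<in>UNIV. E k b * ((C i j (m + 1) b l (n - 1) - C i j m b l (n - 1 + 1))
           - T i l (n - 1) * T b j m + T i l n * T b j (m - 1)))
      + (\<Sum>a\<in>UNIV. E i a * ((C a j (m - 1 + 1) k l n - C a j (m - 1) k l (n + 1))
           + T a l (n - 1) * T k j m - T a l n * T k j (m - 1)))
      + (\<Sum>a\<in>UNIV. \<Sum>b\<in>UNIV. E i a * (E k b * (C a j (m - 1 + 1) b l (n - 1) - C a j (m - 1) b l (n - 1 + 1))))"
      unfolding comm
      by (simp add: right_diff_distrib distrib_left sum_subtractf sum.distrib)
    have 1: "(C i j (m + 1) b l (n - 1) - C i j m b l (n - 1 + 1))
           - T i l (n - 1) * T b j m + T i l n * T b j (m - 1)
        = (T b j (m - 1) * T i l n - T b j (n - 1) * T i l m) + U b" for b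
    proof -
      have "T b j m * T i l (n - 1) = T i l (n - 1) * T b j m
          + (T b j (m - 1) * T i l n - T i l n * T b j (m - 1)) + U b"
        using C_step[of b j "m - 1" i l "n - 1"] by (simp add: C_def U_def algebra_simps)
      then show ?thesis unfolding C_step by simp
    qed
    have 2: "(C a j (m - 1 + 1) k l n - C a j (m - 1) k l (n + 1)) + T a l (n - 1) * T k j m - T a l n * T k j (m - 1)
        = (T k j m * T a l (n - 1) - T k j n * T a l (m - 1)) - W a" for a
    proof -
      have "T k j m * T a l (n - 1) = T a l (n - 1) * T k j m
          + (T k j (m - 1) * T a l n - T a l n * T k j (m - 1)) + W a"
        using C_step[of k j "m - 1" a l "n - 1"] by (simp add: C_def W_def algebra_simps)
      then show ?thesis unfolding C_step by simp
    qed
    have 3: "C a j (m - 1 + 1) b l (n - 1) - C a j (m - 1) b l (n - 1 + 1) = Z a b" for a b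
      unfolding C_step by (simp add: Z_def)
    have "(\<Sum>a\<in>UNIV. \<Sum>b\<in>UNIV. E k b * (E i a * Z a b)) =
        (\<Sum>a\<in>UNIV. \<Sum>b\<in>UNIV. E i a * (E k b * Z a b))
        - (\<Sum>a\<in>UNIV. \<Sum>b\<in>UNIV. if a = k then E i b * Z a b else 0)
        + (\<Sum>a\<in>UNIV. \<Sum>b\<in>UNIV. if b = i then E k a * Z a b else 0)"
      by (rule EE_sum)
    also have "(\<Sum>a\<in>UNIV. \<Sum>b\<in>UNIV. if a = k then E i b * Z a b else 0) = (\<Sum>b\<in>UNIV. E i b * W b)"
      by (subst sum.swap) (simp add: Z_def W_def)
    also have "(\<Sum>a\<in>UNIV. \<Sum>b\<in>UNIV. if b = i then E k a * Z a b else 0) = (\<Sum>a\<in>UNIV. E k a * U a)"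
      by (simp add: Z_def U_def)
    finally have 4: "(\<Sum>a\<in>UNIV. \<Sum>b\<in>UNIV. E i a * (E k b * Z a b)) =
        (\<Sum>a\<in>UNIV. \<Sum>b\<in>UNIV. E k b * (E i a * Z a b))
        + (\<Sum>b\<in>UNIV. E i b * W b) - (\<Sum>b\<in>UNIV. E k b * U b)"
      by (simp add: algebra_simps)
    have 5: "(\<Sum>a\<in>UNIV. \<Sum>b\<in>UNIV. E k b * (E i a * Z a b)) =
        (\<Sum>a\<in>UNIV. \<Sum>b\<in>UNIV. E k a * (E i b * (T a j (m - 1) * T b l (n - 1))))
        - (\<Sum>a\<in>UNIV. \<Sum>b\<in>UNIV. E k a * (E i b * (T a j (n - 1) * T b l (m - 1))))"
      by (subst sum.swap) (simp add: Z_def right_diff_distrib sum_subtractf)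
    show ?thesis
      unfolding lhs unfolding 1 2 3 unfolding 4 5 prod C_step
      by (simp add: right_diff_distrib distrib_left sum_subtractf sum.distrib)
  qed
  then show ?thesis by (simp add: yangian_relation_def S_def)
qed

text \<open>Telescoping lowers the first index to 0 and produces the sum over \<open>r < m\<close>.
  It remains to shorten the range to \<open>min m n\<close>.\<close>

lemma yangian_relation_sum:
  fixes T :: "'n \<Rightarrow> 'n \<Rightarrow> int \<Rightarrow> 'r::ring"
  assumes T: "yangian_relation T" and neg: "\<And>i j m. m < 0 \<Longrightarrow> T i j m = 0"
    and double: "\<And>x :: 'r. x + x = 0 \<Longrightarrow> x = 0"
  shows "T i j (int m) * T k l (int n) - T k l (int n) * T i j (int m) =
    (\<Sum>r<min m n. T k j (int r) * T i l (int (m + n - r - 1)) - T k j (int (m + n - r - 1)) * T i l (int r))"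
proof -
  have *: "T i j (int m) * T k l (int n) - T k l (int n) * T i j (int m) =
    (\<Sum>r<m. T k j (int r) * T i l (int (m + n - r - 1)) - T k j (int (m + n - r - 1)) * T i l (int r))" for m n
  proof (induction m arbitrary: n)
    case 0
    show ?case
      \<comment> \<open>At first index -1 all terms but one commutator contain a generator of
        negative index, so level 0 generators commute with everything.\<close>
      using T[unfolded yangian_relation_def, rule_format, of i j "-1" k l "int n"] by (simp add: neg)
  next
    case (Suc m)
    have "T i j (int (Suc m)) * T k l (int n) - T k l (int n) * T i j (int (Suc m)) =
        (T i j (int m) * T k l (int (Suc n)) - T k l (int (Suc n)) * T i j (int m))
        + (T k j (int m) * T i l (int n) - T k j (int n) * T i l (int m))"
      using T[unfolded yangian_relation_def, rule_format, of i j "int m" k l "int n"]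
      by (simp add: algebra_simps)
    also have "\<dots> = (\<Sum>r<Suc m. T k j (int r) * T i l (int (Suc m + n - r - 1)) - T k j (int (Suc m + n - r - 1)) * T i l (int r))"
      unfolding Suc.IH[of "Suc n"] by simp
    finally show ?case .
  qed
  show ?thesis
  proof (cases "m \<le> n")
    case True
    then show ?thesis unfolding * by (simp add: min_def)
  next
    case False
    define g where "g r = T k j (int r) * T i l (int (m + n - r - 1)) - T k j (int (m + n - r - 1)) * T i l (int r)" for r
    \<comment> \<open>The summand changes sign under the reflection of the interval that sends
      \<open>r\<close> to \<open>m + n - r - 1\<close>, so the surplus is its own negative, and
      \<open>double\<close> makes it vanish.\<close>
    have "sum g {n..<m} = (\<Sum>r\<in>{n..<m}. g (m + n - r - 1))"
      by (rule sum.reindex_bij_witness[of _ "\<lambda>r. m + n - r - 1" "\<lambda>r. m + n - r - 1"])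
        (auto simp: g_def)
    also have "\<dots> = - sum g {n..<m}"
      unfolding sum_negf[symmetric] by (rule sum.cong) (auto simp: g_def)
    finally have "sum g {n..<m} + sum g {n..<m} = 0" by (simp only: eq_neg_iff_add_eq_0)
    then have "sum g {n..<m} = 0" by (rule double)
    moreover have "sum g {..<m} = sum g {..<n} + sum g {n..<m}"
      using False sum.atLeastLessThan_concat[of 0 n m g] by (simp add: lessThan_atLeast0)
    ultimately show ?thesis using False unfolding * by (simp add: g_def min_def)
  qed
qed

section \<open>Tensor products of vectors and operators in coordinates\<close>

lemma lookup_tensor_cons:
  "Poly_Mapping.lookup (tensor_cons v w) zs =
     (case zs of [] \<Rightarrow> 0 | x # ys \<Rightarrow> Poly_Mapping.lookup v x * Poly_Mapping.lookup w ys)"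
proof (cases zs)
  case Nil
  then show ?thesis by (simp add: tensor_cons_def lookup_sum lookup_single)
next
  case (Cons z zs')
  have "Poly_Mapping.lookup (tensor_cons v w) zs = (\<Sum>x\<in>Poly_Mapping.keys v. \<Sum>ys\<in>Poly_Mapping.keys w.
      if ys = zs' then (if x = z then Poly_Mapping.lookup v z * Poly_Mapping.lookup w zs' else 0) else 0)"
    unfolding tensor_cons_def lookup_sum
    by (intro sum.cong refl) (auto simp: Cons lookup_single when_def)
  also have "\<dots> = Poly_Mapping.lookup v z * Poly_Mapping.lookup w zs'"
    by (cases "Poly_Mapping.lookup w zs' = 0") (auto simp: in_keys_iff)
  finally show ?thesis by (simp add: Cons)
qed

lemma tensor_cons_add_left: "tensor_cons (v + v') w = tensor_cons v w + tensor_cons v' w"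
  by (rule poly_mapping_eqI) (simp add: lookup_tensor_cons lookup_add algebra_simps split: list.split)

lemma tensor_cons_add_right: "tensor_cons v (w + w') = tensor_cons v w + tensor_cons v w'"
  by (rule poly_mapping_eqI) (simp add: lookup_tensor_cons lookup_add algebra_simps split: list.split)

lemma tensor_cons_cscale_left: "tensor_cons (cscale c v) w = cscale c (tensor_cons v w)"
  by (rule poly_mapping_eqI) (simp add: lookup_tensor_cons lookup_cscale split: list.split)

lemma tensor_cons_cscale_right: "tensor_cons v (cscale c w) = cscale c (tensor_cons v w)"
  by (rule poly_mapping_eqI) (simp add: lookup_tensor_cons lookup_cscale split: list.split)

lemma tensor_cons_zero_left [simp]: "tensor_cons 0 w = 0"
  by (rule poly_mapping_eqI) (simp add: lookup_tensor_cons split: list.split)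

lemma tensor_cons_zero_right [simp]: "tensor_cons v 0 = 0"
  by (rule poly_mapping_eqI) (simp add: lookup_tensor_cons split: list.split)

lemma tensor_cons_single:
  "tensor_cons (Poly_Mapping.single x c) (Poly_Mapping.single ys d) = Poly_Mapping.single (x # ys) (c * d)"
  by (rule poly_mapping_eqI)
    (auto simp: lookup_tensor_cons lookup_single when_def split: list.split)

lemma tensor_cons_nonzero:
  assumes "v \<noteq> 0" "w \<noteq> 0"
  shows "tensor_cons v w \<noteq> 0"
proof -
  obtain x y where "Poly_Mapping.lookup v x \<noteq> 0" "Poly_Mapping.lookup w y \<noteq> 0"
    using assms by (metis lookup_zero poly_mapping_eqI)
  then have "Poly_Mapping.lookup (tensor_cons v w) (x # y) \<noteq> 0"
    by (simp add: lookup_tensor_cons)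
  then show ?thesis by auto
qed

lemma tensor_cons_in_free_space:
  "v \<in> free_space B \<Longrightarrow> w \<in> free_space L \<Longrightarrow> tensor_cons v w \<in> free_space (set_Cons B L)"
  by (auto simp: free_space_def subset_iff in_keys_iff lookup_tensor_cons set_Cons_def split: list.splits)

lemma tensor_op_eq_lext:
  "tensor_op F G = lext cscale (\<lambda>zs. tensor_cons (F (Poly_Mapping.single (hd zs) 1)) (G (Poly_Mapping.single (tl zs) 1)))"
  by (rule ext) (simp add: tensor_op_def lext_def)

lemma tensor_op_add_vector: "tensor_op F G (f + g) = tensor_op F G f + tensor_op F G g"
  unfolding tensor_op_eq_lext by (rule lext_add[OF vector_space_cscale])

lemma tensor_op_cscale_vector: "tensor_op F G (cscale c f) = cscale c (tensor_op F G f)"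
  unfolding tensor_op_eq_lext by (rule lext_cscale[OF vector_space_cscale])

lemma tensor_op_single:
  "tensor_op F G (Poly_Mapping.single zs c) =
     cscale c (tensor_cons (F (Poly_Mapping.single (hd zs) 1)) (G (Poly_Mapping.single (tl zs) 1)))"
  unfolding tensor_op_eq_lext by (rule lext_single[OF vector_space_cscale])

abbreviation linear_operator :: "(('b \<Rightarrow>\<^sub>0 complex) \<Rightarrow> ('b \<Rightarrow>\<^sub>0 complex)) \<Rightarrow> bool" where
  "linear_operator F \<equiv> linear_map_on cscale UNIV cscale F"

lemma linear_operator_tensor_op: "linear_operator (tensor_op F G)"
  by (simp add: linear_map_on_def tensor_op_add_vector tensor_op_cscale_vector)

lemma tensor_op_tensor_cons:
  assumes "linear_operator F" "linear_operator G"
  shows "tensor_op F G (tensor_cons v w) = tensor_cons (F v) (G w)"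
proof (induction v rule: poly_mapping_single_induct)
  case (single x c)
  show ?case
  proof (induction w rule: poly_mapping_single_induct)
    case (single ys d)
    have "F (Poly_Mapping.single x c) = cscale c (F (Poly_Mapping.single x 1))"
      "G (Poly_Mapping.single ys d) = cscale d (G (Poly_Mapping.single ys 1))"
      using assms by (metis UNIV_I cscale_single linear_map_on_def mult.right_neutral)+
    then show ?case
      by (simp add: tensor_cons_single tensor_op_single tensor_cons_cscale_left
          tensor_cons_cscale_right mult.commute)
  next
    case (add w w')
    then show ?case
      using assms(2) by (simp add: tensor_cons_add_right tensor_op_add_vector linear_map_on_def)
  qed
next
  case (add v v')
  then show ?case
    using assms(1) by (simp add: tensor_cons_add_left tensor_op_add_vector linear_map_on_def)
qed

lemma tensor_op_compose:
  assumes "linear_operator F" "linear_operator G"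
  shows "tensor_op F G (tensor_op F' G' f) = tensor_op (\<lambda>v. F (F' v)) (\<lambda>w. G (G' w)) f"
proof (induction f rule: poly_mapping_single_induct)
  case (single zs c)
  show ?case
    by (simp add: tensor_op_single tensor_op_cscale_vector tensor_op_tensor_cons[OF assms])
qed (simp add: tensor_op_add_vector)

lemma tensor_op_add_left: "tensor_op (\<lambda>v. F v + F' v) G f = tensor_op F G f + tensor_op F' G f"
  by (induction f rule: poly_mapping_single_induct)
    (simp_all add: tensor_op_single tensor_op_add_vector tensor_cons_add_left cscale_add_right)

lemma tensor_op_add_right: "tensor_op F (\<lambda>v. G v + G' v) f = tensor_op F G f + tensor_op F G' f"
  by (induction f rule: poly_mapping_single_induct)
    (simp_all add: tensor_op_single tensor_op_add_vector tensor_cons_add_right cscale_add_right)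

lemma tensor_op_zero_left: "tensor_op (\<lambda>v. 0) G f = 0"
  by (simp add: tensor_op_def)

lemma tensor_op_zero_right: "tensor_op F (\<lambda>v. 0) f = 0"
  by (simp add: tensor_op_def)

lemma tensor_op_in_free_space:
  assumes "f \<in> free_space (set_Cons B L)"
    and "\<And>v. v \<in> free_space B \<Longrightarrow> F v \<in> free_space B" "\<And>w. w \<in> free_space L \<Longrightarrow> G w \<in> free_space L"
  shows "tensor_op F G f \<in> free_space (set_Cons B L)"
  unfolding tensor_op_eq_lext
proof (rule lext_in_subspace[OF vector_space_cscale free_space_subspace])
  fix zs assume "zs \<in> Poly_Mapping.keys f"
  then obtain x ys where "zs = x # ys" "x \<in> B" "ys \<in> L"
    using assms(1) by (auto simp: free_space_def set_Cons_def)
  then show "tensor_cons (F (Poly_Mapping.single (hd zs) 1)) (G (Poly_Mapping.single (tl zs) 1))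
      \<in> free_space (set_Cons B L)"
    by (simp add: tensor_cons_in_free_space assms single_in_free_space)
qed

lemma tensor_op_id:
  assumes f: "f \<in> free_space (set_Cons B L)" and G: "\<And>w. w \<in> free_space L \<Longrightarrow> G w = w"
  shows "tensor_op (\<lambda>v. v) G f = f"
proof -
  have "tensor_op (\<lambda>v. v) G f =
      (\<Sum>zs\<in>Poly_Mapping.keys f. Poly_Mapping.single zs (Poly_Mapping.lookup f zs))"
    unfolding tensor_op_def
  proof (rule sum.cong[OF refl])
    fix zs assume "zs \<in> Poly_Mapping.keys f"
    then obtain x ys where "zs = x # ys" "ys \<in> L"
      using f by (auto simp: free_space_def set_Cons_def)
    then show "cscale (Poly_Mapping.lookup f zs)
        (tensor_cons (Poly_Mapping.single (hd zs) 1) (G (Poly_Mapping.single (tl zs) 1))) =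
        Poly_Mapping.single zs (Poly_Mapping.lookup f zs)"
      by (simp add: G single_in_free_space tensor_cons_single cscale_single)
  qed
  then show ?thesis by (simp add: poly_mapping_sum_single[symmetric])
qed

text \<open>Linear maps of the whole ambient space are made a type of class \<open>ring\<close>, so
  that the two lemmas on \<open>yangian_relation\<close> apply to them. That class has no unit, so
  the identity is the separate constant \<open>id_operator\<close>.\<close>

typedef 'b operator = "{F :: ('b \<Rightarrow>\<^sub>0 complex) \<Rightarrow> ('b \<Rightarrow>\<^sub>0 complex). linear_operator F}"
  morphisms apply_op Operator
  by (rule exI[of _ "\<lambda>v. 0"]) (simp add: linear_map_on_def)

setup_lifting type_definition_operator

instantiation operator :: (type) ring
begin

lift_definition zero_operator :: "'a operator" is "\<lambda>v. 0"
  by (simp add: linear_map_on_def)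

lift_definition plus_operator :: "'a operator \<Rightarrow> 'a operator \<Rightarrow> 'a operator" is "\<lambda>F G v. F v + G v"
  by (simp add: linear_map_on_def cscale_add_right)

lift_definition minus_operator :: "'a operator \<Rightarrow> 'a operator \<Rightarrow> 'a operator" is "\<lambda>F G v. F v - G v"
  by (simp add: linear_map_on_def cscale_diff_right)

lift_definition uminus_operator :: "'a operator \<Rightarrow> 'a operator" is "\<lambda>F v. 0 - F v"
  by (simp add: linear_map_on_def cscale_diff_right flip: cscale_diff_right[of _ 0, simplified])

lift_definition times_operator :: "'a operator \<Rightarrow> 'a operator \<Rightarrow> 'a operator" is "\<lambda>F G v. F (G v)"
  by (simp add: linear_map_on_def)

instance
  by standard (transfer; simp add: fun_eq_iff linear_map_on_def algebra_simps)+

end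

lemma apply_op_add: "apply_op (F + G) v = apply_op F v + apply_op G v"
  by transfer simp

lemma apply_op_diff: "apply_op (F - G) v = apply_op F v - apply_op G v"
  by transfer simp

lemma apply_op_mult: "apply_op (F * G) v = apply_op F (apply_op G v)"
  by transfer simp

lemma apply_op_zero: "apply_op 0 v = 0"
  by transfer simp

lemma apply_op_sum: "apply_op (\<Sum>i\<in>A. F i) v = (\<Sum>i\<in>A. apply_op (F i) v)"
  by (induction A rule: infinite_finite_induct) (simp_all add: apply_op_add apply_op_zero)

lemma apply_op_Operator: "linear_operator F \<Longrightarrow> apply_op (Operator F) v = F v"
  by (simp add: Operator_inverse)

lemma operator_eqI: "(\<And>v. apply_op F v = apply_op G v) \<Longrightarrow> F = G"
  by transfer (simp add: fun_eq_iff)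

lemma linear_operator_apply_op: "linear_operator (apply_op F)"
  using apply_op by blast

lemma operator_double_eq_zero:
  fixes F :: "'b operator"
  assumes "F + F = 0"
  shows "F = 0"
proof (rule operator_eqI)
  fix v
  have "apply_op F v + apply_op F v = 0"
    using assms by (metis apply_op_add apply_op_zero)
  then have "Poly_Mapping.lookup (apply_op F v + apply_op F v) b = 0" for b by simp
  then have "Poly_Mapping.lookup (apply_op F v) b = 0" for b by (simp add: lookup_add)
  then show "apply_op F v = apply_op 0 v"
    by (intro poly_mapping_eqI) (simp add: apply_op_zero)
qed

lift_definition id_operator :: "'b operator" is "\<lambda>v. v"
  by (simp add: linear_map_on_def)

lemma apply_id_operator [simp]: "apply_op id_operator v = v"
  by transfer simp

lemma id_operator_mult [simp]: "id_operator * F = F" "F * id_operator = F"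
  by (transfer; simp)+

definition tensor_operator :: "'b operator \<Rightarrow> 'b list operator \<Rightarrow> 'b list operator" where
  "tensor_operator F G = Operator (tensor_op (apply_op F) (apply_op G))"

lemma apply_tensor_operator: "apply_op (tensor_operator F G) f = tensor_op (apply_op F) (apply_op G) f"
  by (simp add: tensor_operator_def apply_op_Operator linear_operator_tensor_op)

lemma tensor_operator_mult:
  "tensor_operator F G * tensor_operator F' G' = tensor_operator (F * F') (G * G')"
  by (rule operator_eqI)
    (simp add: apply_tensor_operator times_operator.rep_eq tensor_op_compose linear_operator_apply_op)

lemma tensor_operator_add_left: "tensor_operator (F + F') G = tensor_operator F G + tensor_operator F' G"
  by (rule operator_eqI) (simp add: apply_tensor_operator plus_operator.rep_eq tensor_op_add_left)

lemma tensor_operator_add_right: "tensor_operator F (G + G') = tensor_operator F G + tensor_operator F G'"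
  by (rule operator_eqI) (simp add: apply_tensor_operator plus_operator.rep_eq tensor_op_add_right)

lemma tensor_operator_zero_left [simp]: "tensor_operator 0 G = 0"
  by (rule operator_eqI) (simp add: apply_tensor_operator zero_operator.rep_eq tensor_op_zero_left)

lemma tensor_operator_zero_right [simp]: "tensor_operator F 0 = 0"
  by (rule operator_eqI) (simp add: apply_tensor_operator zero_operator.rep_eq tensor_op_zero_right)

lemma tensor_operator_diff_left: "tensor_operator (F - F') G = tensor_operator F G - tensor_operator F' G"
  using tensor_operator_add_left[of "F - F'" F' G] by (simp add: algebra_simps)

lemma tensor_operator_diff_right: "tensor_operator F (G - G') = tensor_operator F G - tensor_operator F G'"
  using tensor_operator_add_right[of F "G - G'" G'] by (simp add: algebra_simps)

section \<open>Tensor products of evaluation representations\<close>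

text \<open>An evaluation representation is 1 + E u^-1 in generating series, so only the terms
  \<open>r = 0\<close> and \<open>r = 1\<close> of the coproduct survive. This is the shape that
  \<open>yangian_relation_coproduct\<close> treats.\<close>

lemma ev_tensor_op_Cons:
  "ev_tensor_op (\<pi> # \<pi>s) i j m f = tensor_op (\<lambda>v. v) (ev_tensor_op \<pi>s i j m) f +
     (if m = 0 then 0 else \<Sum>a\<in>UNIV. tensor_op (\<pi> (matrix_unit i a)) (ev_tensor_op \<pi>s a j (m - 1)) f)"
proof -
  have ev: "ev_op \<pi> i a 0 = (if i = a then (\<lambda>v. v) else (\<lambda>v. 0))"
      "ev_op \<pi> i a (Suc 0) = \<pi> (matrix_unit i a)" "ev_op \<pi> i a (Suc (Suc r)) = (\<lambda>v. 0)" for a r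
    by (auto simp: ev_op_def fun_eq_iff)
  have "(\<Sum>r\<le>m. tensor_op (ev_op \<pi> i a r) (ev_tensor_op \<pi>s a j (m - r)) f) =
      (if i = a then tensor_op (\<lambda>v. v) (ev_tensor_op \<pi>s i j m) f else 0) +
      (if m = 0 then 0 else tensor_op (\<pi> (matrix_unit i a)) (ev_tensor_op \<pi>s a j (m - 1)) f)" for a
  proof (cases m)
    case 0
    then show ?thesis by (simp add: ev tensor_op_zero_left)
  next
    case (Suc m')
    have "(\<Sum>r\<le>m'. tensor_op (ev_op \<pi> i a (Suc r)) (ev_tensor_op \<pi>s a j (m' - r)) f) =
        (\<Sum>r\<le>m'. if r = 0 then tensor_op (\<pi> (matrix_unit i a)) (ev_tensor_op \<pi>s a j m') f else 0)"
      by (rule sum.cong[OF refl]) (auto simp: ev tensor_op_zero_left gr0_conv_Suc)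
    then show ?thesis
      unfolding Suc sum.atMost_Suc_shift by (simp add: ev tensor_op_zero_left)
  qed
  then show ?thesis by (simp add: sum.distrib)
qed

lemma linear_operator_ev_tensor_op:
  fixes \<pi>s :: "('n::finite gl \<Rightarrow> ('b \<Rightarrow>\<^sub>0 complex) \<Rightarrow> ('b \<Rightarrow>\<^sub>0 complex)) list"
  shows "linear_operator (ev_tensor_op \<pi>s i j m)"
proof (cases \<pi>s)
  case Nil
  then show ?thesis by (auto simp: linear_map_on_def)
next
  case (Cons \<pi> \<pi>s')
  interpret vector_space "cscale :: complex \<Rightarrow> ('b list \<Rightarrow>\<^sub>0 complex) \<Rightarrow> _" by (rule vector_space_cscale)
  show ?thesis
    unfolding Cons linear_map_on_def ev_tensor_op_Cons
    by (simp add: tensor_op_add_vector tensor_op_cscale_vector cscale_add_right sum.distrib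
        scale_sum_right)
qed

text \<open>Each evaluation factor raises the degree in u^-1 by at most one.\<close>

lemma ev_tensor_op_truncated: "length \<pi>s < m \<Longrightarrow> ev_tensor_op \<pi>s i j m = (\<lambda>f. 0)"
proof (induction \<pi>s arbitrary: i j m)
  case (Cons \<pi> \<pi>s)
  then show ?case
    by (intro ext) (simp add: ev_tensor_op_Cons tensor_op_zero_right del: ev_tensor_op.simps)
qed auto

definition tensor_generator ::
  "('n::finite gl \<Rightarrow> ('b \<Rightarrow>\<^sub>0 complex) \<Rightarrow> ('b \<Rightarrow>\<^sub>0 complex)) list \<Rightarrow> 'n \<Rightarrow> 'n \<Rightarrow> int \<Rightarrow> 'b list operator"
where
  "tensor_generator \<pi>s i j m = (if m < 0 then 0 else Operator (ev_tensor_op \<pi>s i j (nat m)))"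

lemma apply_tensor_generator:
  "apply_op (tensor_generator \<pi>s i j m) f = (if m < 0 then 0 else ev_tensor_op \<pi>s i j (nat m) f)"
  by (simp add: tensor_generator_def apply_op_Operator linear_operator_ev_tensor_op apply_op_zero)

lemma tensor_generator_Nil:
  "tensor_generator [] i j m = (if i = j \<and> m = 0 then id_operator else 0)"
  by (rule operator_eqI) (auto simp: apply_tensor_generator apply_op_zero)

lemma tensor_generator_Cons:
  assumes "\<And>X. linear_operator (\<pi> X)"
  shows "tensor_generator (\<pi> # \<pi>s) i j m = tensor_operator id_operator (tensor_generator \<pi>s i j m) +
     (\<Sum>a\<in>UNIV. tensor_operator (Operator (\<pi> (matrix_unit i a))) id_operator *
        tensor_operator id_operator (tensor_generator \<pi>s a j (m - 1)))"
proof (cases "m < 0")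
  case True
  then show ?thesis by (simp add: tensor_generator_def)
next
  case False
  have funs: "apply_op (Operator (\<pi> X)) = \<pi> X" "apply_op id_operator = (\<lambda>v. v)" for X
    using assms by (auto simp: apply_op_Operator)
  have gen: "apply_op (tensor_generator \<pi>s a j (m - 1)) =
      (if m = 0 then (\<lambda>f. 0) else ev_tensor_op \<pi>s a j (nat m - 1))" for a
    using False by (auto simp: apply_tensor_generator nat_diff_distrib)
  have gen': "apply_op (tensor_generator \<pi>s i j m) = ev_tensor_op \<pi>s i j (nat m)"
    using False by (auto simp: apply_tensor_generator)
  show ?thesis
  proof (rule operator_eqI)
    fix f
    show "apply_op (tensor_generator (\<pi> # \<pi>s) i j m) f = apply_op (tensor_operator id_operator (tensor_generator \<pi>s i j m) +
       (\<Sum>a\<in>UNIV. tensor_operator (Operator (\<pi> (matrix_unit i a))) id_operator *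
          tensor_operator id_operator (tensor_generator \<pi>s a j (m - 1)))) f"
      using False
      by (simp add: apply_tensor_generator[of "\<pi> # \<pi>s"] ev_tensor_op_Cons apply_op_add apply_op_sum
          tensor_operator_mult apply_tensor_operator funs gen gen' tensor_op_zero_right
          del: ev_tensor_op.simps)
  qed
qed

lemma yangian_relation_tensor_generator:
  assumes "\<And>\<pi>. \<pi> \<in> set \<pi>s \<Longrightarrow> gl_relations (\<lambda>i j. \<pi> (matrix_unit i j))"
    and "\<And>\<pi> X. \<pi> \<in> set \<pi>s \<Longrightarrow> linear_operator (\<pi> X)"
  shows "yangian_relation (tensor_generator \<pi>s)"
  using assms
proof (induction \<pi>s)
  case Nil
  show ?case by (auto simp: yangian_relation_def tensor_generator_Nil)
next
  case (Cons \<pi> \<pi>s)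
  let ?I = "id_operator"
  let ?P = "\<lambda>i j. Operator (\<pi> (matrix_unit i j))"
  have lin: "linear_operator (\<pi> X)" for X using Cons.prems by simp
  have gl: "?P i j * ?P k l - ?P k l * ?P i j = (if j = k then ?P i l else 0) - (if l = i then ?P k j else 0)"
    for i j k l
  proof (rule operator_eqI)
    fix v
    show "apply_op (?P i j * ?P k l - ?P k l * ?P i j) v =
        apply_op ((if j = k then ?P i l else 0) - (if l = i then ?P k j else 0)) v"
      using Cons.prems(1)[of \<pi>]
      by (simp add: gl_relations_def apply_op_diff apply_op_mult apply_op_Operator lin apply_op_zero)
  qed
  have "yangian_relation (tensor_generator \<pi>s)" using Cons by simp
  then have T: "yangian_relation (\<lambda>i j m. tensor_operator ?I (tensor_generator \<pi>s i j m) :: 'b list operator)"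
    unfolding yangian_relation_def
    by (simp add: tensor_operator_mult tensor_operator_diff_right[symmetric])
  have "yangian_relation (\<lambda>i j m. tensor_operator ?I (tensor_generator \<pi>s i j m) +
      (\<Sum>a\<in>UNIV. tensor_operator (?P i a) ?I * tensor_operator ?I (tensor_generator \<pi>s a j (m - 1))))"
  proof (rule yangian_relation_coproduct[OF T])
    show "tensor_operator (?P i j) ?I * tensor_operator ?I (tensor_generator \<pi>s k l m) =
        tensor_operator ?I (tensor_generator \<pi>s k l m) * tensor_operator (?P i j) ?I" for i j k l m
      by (simp add: tensor_operator_mult)
    show "tensor_operator (?P i j) ?I * tensor_operator (?P k l) ?I - tensor_operator (?P k l) ?I * tensor_operator (?P i j) ?I =
        (if j = k then tensor_operator (?P i l) ?I else 0) - (if l = i then tensor_operator (?P k j) ?I else 0)" for i j k l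
      unfolding tensor_operator_mult id_operator_mult tensor_operator_diff_left[symmetric] gl
      unfolding tensor_operator_diff_left by simp
  qed
  then show ?case by (simp only: tensor_generator_Cons[OF lin])
qed

text \<open>A tensor product is specified by a list of indices into one family, which keeps spaces,
  actions and highest weight vectors aligned. The last three assumptions hold on the ambient space,
  as the operator ring requires.\<close>

locale gl_irrep_family =
  fixes B :: "'k \<Rightarrow> nat set"
    and \<pi> :: "'k \<Rightarrow> 'n::{finite,linorder} gl \<Rightarrow> (nat \<Rightarrow>\<^sub>0 complex) \<Rightarrow> (nat \<Rightarrow>\<^sub>0 complex)"
    and \<eta> :: "'k \<Rightarrow> nat \<Rightarrow>\<^sub>0 complex"
    and wt :: "'k \<Rightarrow> 'n \<Rightarrow> complex"
  assumes irrep: "gl_highest_weight_irrep (B k) (\<pi> k) (\<eta> k)"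
    and weight: "\<pi> k (matrix_unit i i) (\<eta> k) = cscale (wt k i) (\<eta> k)"
    and additive: "\<pi> k X (v + w) = \<pi> k X v + \<pi> k X w"
    and homogeneous: "\<pi> k X (cscale c v) = cscale c (\<pi> k X v)"
    and relations: "gl_relations (\<lambda>i j. \<pi> k (matrix_unit i j))"
begin

lemma linear: "linear_operator (\<pi> k X)"
  by (simp add: linear_map_on_def additive homogeneous)

lemma closed: "v \<in> free_space (B k) \<Longrightarrow> \<pi> k X v \<in> free_space (B k)"
  using irrep[of k] by (auto simp: gl_highest_weight_irrep_def gl_rep_def)

abbreviation space where "space ks \<equiv> free_space (listset (map B ks))"
abbreviation op where "op ks \<equiv> ev_tensor_op (map \<pi> ks)"

lemma op_closed: "f \<in> space ks \<Longrightarrow> op ks i j m f \<in> space ks"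
proof (induction ks arbitrary: i j m f)
  case Nil
  interpret vector_space "cscale :: complex \<Rightarrow> (nat list \<Rightarrow>\<^sub>0 complex) \<Rightarrow> _" by (rule vector_space_cscale)
  show ?case using Nil by (simp add: subspace_0[OF free_space_subspace])
next
  case (Cons k ks)
  interpret vector_space "cscale :: complex \<Rightarrow> (nat list \<Rightarrow>\<^sub>0 complex) \<Rightarrow> _" by (rule vector_space_cscale)
  have f: "f \<in> free_space (set_Cons (B k) (listset (map B ks)))" using Cons.prems by simp
  have "op (k # ks) i j m f \<in> free_space (set_Cons (B k) (listset (map B ks)))"
    unfolding list.map ev_tensor_op_Cons
    by (auto intro!: subspace_add[OF free_space_subspace] subspace_sum[OF free_space_subspace]
        subspace_0[OF free_space_subspace] tensor_op_in_free_space[OF f] Cons.IH closed)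
  then show ?case by simp
qed

text \<open>
  Only on this subspace: on the basis element \<open>[]\<close> of the ambient space \<^const>\<open>tensor_op\<close> involves
  the junk value \<open>hd []\<close>. The other relations hold on the whole ambient space.
\<close>

lemma op_zero: "f \<in> space ks \<Longrightarrow> op ks i j 0 f = (if i = j then f else 0)"
proof (induction ks arbitrary: f)
  case (Cons k ks)
  show ?case
  proof (cases "i = j")
    case True
    then have "tensor_op (\<lambda>v. v) (op ks i j 0) f = f"
      by (intro tensor_op_id[of f "B k" "listset (map B ks)"]) (use Cons in auto)
    then show ?thesis using True by (simp add: ev_tensor_op_Cons del: ev_tensor_op.simps)
  next
    case False
    interpret vector_space "cscale :: complex \<Rightarrow> (nat list \<Rightarrow>\<^sub>0 complex) \<Rightarrow> _" by (rule vector_space_cscale)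
    have "tensor_op (\<lambda>v. v) (op ks i j 0) f = tensor_op (\<lambda>v. v) (\<lambda>w. 0) f"
      unfolding tensor_op_def
    proof (rule sum.cong[OF refl])
      fix zs assume "zs \<in> Poly_Mapping.keys f"
      then have "tl zs \<in> listset (map B ks)"
        using Cons.prems by (auto simp: free_space_def set_Cons_def)
      then have "op ks i j 0 (Poly_Mapping.single (tl zs) 1) = 0"
        using Cons.IH[of "Poly_Mapping.single (tl zs) 1"] False by (simp add: single_in_free_space)
      then show "cscale (Poly_Mapping.lookup f zs) (tensor_cons (Poly_Mapping.single (hd zs) 1)
            (op ks i j 0 (Poly_Mapping.single (tl zs) 1))) =
          cscale (Poly_Mapping.lookup f zs) (tensor_cons (Poly_Mapping.single (hd zs) 1) 0)"
        by simp
    qed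
    then show ?thesis using False by (simp add: ev_tensor_op_Cons tensor_op_zero_right del: ev_tensor_op.simps)
  qed
qed simp

lemma op_commutator:
  "op ks i j m (op ks k l n f) - op ks k l n (op ks i j m f) =
     (\<Sum>r<min m n. op ks k j r (op ks i l (m + n - r - 1) f) - op ks k j (m + n - r - 1) (op ks i l r f))"
proof -
  let ?T = "tensor_generator (map \<pi> ks)"
  have gl: "gl_relations (\<lambda>i j. \<rho> (matrix_unit i j))" and lin: "linear_operator (\<rho> X)"
    if "\<rho> \<in> set (map \<pi> ks)" for \<rho> X
    using that relations linear by auto
  have neg: "?T i j m = 0" if "m < 0" for i j m
    using that by (simp add: tensor_generator_def)
  have "yangian_relation ?T"
    by (rule yangian_relation_tensor_generator; (rule gl | rule lin))
  then have "?T i j (int m) * ?T k l (int n) - ?T k l (int n) * ?T i j (int m) =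
    (\<Sum>r<min m n. ?T k j (int r) * ?T i l (int (m + n - r - 1)) - ?T k j (int (m + n - r - 1)) * ?T i l (int r))"
    by (rule yangian_relation_sum[OF _ neg operator_double_eq_zero])
  from arg_cong[OF this, of "\<lambda>F. apply_op F f"] show ?thesis
    by (simp only: apply_op_diff apply_op_mult apply_op_sum apply_tensor_generator
        of_nat_less_0_iff if_False nat_int)
qed

abbreviation hw where "hw ks \<equiv> pure_tensor (map \<eta> ks)"

lemma hw_Cons: "hw (k # ks) = tensor_cons (\<eta> k) (hw ks)"
  by (simp add: pure_tensor_def)

lemma hw_nonzero: "hw ks \<noteq> 0"
proof (induction ks)
  case Nil
  show ?case by (simp add: pure_tensor_def) (metis lookup_single_eq lookup_zero zero_neq_one)
next
  case (Cons k ks)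
  have "\<eta> k \<noteq> 0"
    using irrep[of k] by (simp add: gl_highest_weight_irrep_def gl_highest_weight_vector_def)
  with Cons show ?case unfolding hw_Cons by (intro tensor_cons_nonzero)
qed

lemma hw_in_space: "hw ks \<in> space ks"
proof (induction ks)
  case Nil
  show ?case by (simp add: pure_tensor_def free_space_def)
next
  case (Cons k ks)
  then show ?case
    using irrep[of k] unfolding hw_Cons
    by (simp add: tensor_cons_in_free_space gl_highest_weight_irrep_def)
qed

lemma op_hw_Cons:
  "op (k # ks) i j m (hw (k # ks)) = tensor_cons (\<eta> k) (op ks i j m (hw ks)) +
     (if m = 0 then 0 else \<Sum>a\<in>UNIV. tensor_cons (\<pi> k (matrix_unit i a) (\<eta> k)) (op ks a j (m - 1) (hw ks)))"
proof -
  have id: "linear_operator (\<lambda>v. v)" by (simp add: linear_map_on_def)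
  show ?thesis
    unfolding list.map ev_tensor_op_Cons
    by (simp add: hw_Cons[simplified] tensor_op_tensor_cons[OF id linear_operator_ev_tensor_op]
        tensor_op_tensor_cons[OF linear linear_operator_ev_tensor_op])
qed

lemma raising_zero: "i < j \<Longrightarrow> \<pi> k (matrix_unit i j) (\<eta> k) = 0"
  using irrep[of k] by (simp add: gl_highest_weight_irrep_def gl_highest_weight_vector_def)

text \<open>For each intermediate index \<open>a\<close> of the coproduct, either
  \<open>i < a\<close> and the first factor vanishes, or \<open>a \<le> i < j\<close> and the
  remaining factors do.\<close>

lemma op_raising: "i < j \<Longrightarrow> op ks i j m (hw ks) = 0"
proof (induction ks arbitrary: i j m)
  case (Cons k ks)
  have "tensor_cons (\<pi> k (matrix_unit i a) (\<eta> k)) (op ks a j (m - 1) (hw ks)) = 0" for a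
    using Cons.prems Cons.IH[of a j "m - 1"] raising_zero[of i a k] by (cases "i < a") auto
  then show ?case unfolding op_hw_Cons using Cons by simp
qed auto

text \<open>Only the intermediate index \<open>a = i\<close> contributes: larger ones are killed in
  the first factor, smaller ones in the rest. Hence the weight series multiply; the polynomial
  variable stands for u^-1.\<close>

lemma op_cartan:
  "op ks i i m (hw ks) = cscale (coeff (\<Prod>k\<leftarrow>ks. [:1, wt k i:]) m) (hw ks)"
proof (induction ks arbitrary: m)
  case (Cons k ks)
  have "tensor_cons (\<pi> k (matrix_unit i a) (\<eta> k)) (op ks a i n (hw ks)) =
      (if a = i then cscale (wt k i * coeff (\<Prod>k\<leftarrow>ks. [:1, wt k i:]) n) (hw (k # ks)) else 0)" for a n
  proof (cases "a = i")
    case True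
    then show ?thesis
      by (simp add: Cons.IH weight tensor_cons_cscale_left tensor_cons_cscale_right
          hw_Cons[simplified] mult.commute)
  next
    case False
    then consider "i < a" | "a < i" by force
    then show ?thesis using False by cases (simp_all add: raising_zero op_raising)
  qed
  then have "op (k # ks) i i m (hw (k # ks)) =
      cscale (coeff (\<Prod>k\<leftarrow>ks. [:1, wt k i:]) m) (hw (k # ks)) +
      (if m = 0 then 0 else cscale (wt k i * coeff (\<Prod>k\<leftarrow>ks. [:1, wt k i:]) (m - 1)) (hw (k # ks)))"
    unfolding op_hw_Cons by (simp add: Cons.IH tensor_cons_cscale_right hw_Cons[simplified])
  moreover have "coeff (\<Prod>k\<leftarrow>k # ks. [:1, wt k i:]) m = coeff (\<Prod>k\<leftarrow>ks. [:1, wt k i:]) m +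
      (if m = 0 then 0 else wt k i * coeff (\<Prod>k\<leftarrow>ks. [:1, wt k i:]) (m - 1))"
    by (cases m) (simp_all add: mult_pCons_left)
  moreover have "cscale (c + d) v = cscale c v + cscale d v" for c d and v :: "nat list \<Rightarrow>\<^sub>0 complex"
    by (rule poly_mapping_eqI) (simp add: lookup_cscale lookup_add distrib_right)
  ultimately show ?case by simp
qed (auto simp: pure_tensor_def)

theorem ev_tensor_rep_exists:
  assumes "length ks \<le> p"
  obtains \<sigma> where "ev_tensor_rep p (map B ks) (map \<pi> ks) \<sigma>"
    and "hw_vector cscale (\<lambda>a. \<sigma> (W_class p a)) (\<lambda>i. coeff (\<Prod>k\<leftarrow>ks. [:1, wt k i:])) (hw ks)"
proof -
  define act where "act = feval cscale (\<lambda>(i, j, m). op ks i j m)"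
  have fm: "free_module cscale act (space ks)"
    unfolding act_def
  proof (rule free_module_feval[OF vector_space_cscale free_space_subspace])
    fix x v w c
    show "(case x of (i, j, m) \<Rightarrow> op ks i j m) v \<in> space ks" if "v \<in> space ks"
      using that by (cases x) (simp add: op_closed)
    show "(case x of (i, j, m) \<Rightarrow> op ks i j m) (v + w) =
        (case x of (i, j, m) \<Rightarrow> op ks i j m) v + (case x of (i, j, m) \<Rightarrow> op ks i j m) w"
      "(case x of (i, j, m) \<Rightarrow> op ks i j m) (cscale c v) = cscale c ((case x of (i, j, m) \<Rightarrow> op ks i j m) v)"
      using linear_operator_ev_tensor_op[of "map \<pi> ks"]
      by (cases x; simp add: linear_map_on_def)+
  qed
  interpret free_module cscale act "space ks" by (rule fm)
  have act_gen: "act (gen i j m) v = op ks i j m v" for i j m v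
    by (simp add: act_def gen_def feval_letter[OF vector_space_cscale])
  have rel: "act r v = 0" if "r \<in> yangian_relators \<union> truncation_relators p" and v: "v \<in> space ks" for r v
  proof -
    from that(1) consider (zero) i j where "r = gen i j 0 - (if i = j then 1 else 0)"
      | (comm) i j k l m n where "r = (gen i j m * gen k l n - gen k l n * gen i j m) -
          (\<Sum>r<min m n. gen k j r * gen i l (m + n - r - 1) - gen k j (m + n - r - 1) * gen i l r)"
      | (trunc) i j n where "r = gen i j n" "p < n"
      unfolding yangian_relators_def truncation_relators_def by blast
    then show ?thesis
    proof cases
      case zero
      then show ?thesis
        using v by (simp add: act_diff_left act_gen op_zero act_one act_zero_left)
    next
      case comm
      show ?thesis
        unfolding comm act_diff_left[OF v] act_sum_left[OF v] act_mult[OF v] act_gen op_commutator by simp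
    next
      case trunc
      then show ?thesis
        using assms by (simp add: act_gen ev_tensor_op_truncated)
    qed
  qed
  let ?\<sigma> = "W_action p act"
  have on_class: "?\<sigma> (W_class p a) v = act a v" if "v \<in> space ks" for a v
    by (rule W_action_class[OF fm rel that])
  have "ev_tensor_rep p (map B ks) (map \<pi> ks) ?\<sigma>"
    unfolding ev_tensor_rep_def
    using W_rep_W_action[OF fm rel] on_class act_gen by simp
  moreover have "hw_vector cscale (\<lambda>a. ?\<sigma> (W_class p a)) (\<lambda>i. coeff (\<Prod>k\<leftarrow>ks. [:1, wt k i:])) (hw ks)"
    unfolding hw_vector_def on_class[OF hw_in_space] act_gen
    by (simp add: hw_nonzero op_raising op_cartan)
  ultimately show ?thesis by (rule that)
qed

end

section \<open>Highest weight vectors in finite dimension\<close>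

text \<open>The constant term 1 keeps 0 from being a root, so a factor at a root \<open>z\<close>
  can be rescaled to \<open>[:1, - (1 / z):]\<close>. When the degree is too small, factors with
  \<open>z = 0\<close> in \<open>[:1, z:]\<close> pad the product to length
  \<open>p\<close>.\<close>

lemma poly_linear_factors:
  fixes q :: "complex poly"
  assumes "coeff q 0 = 1" "degree q \<le> p"
  shows "\<exists>a. q = (\<Prod>k\<leftarrow>[0..<p]. [:1, a k:])"
  using assms
proof (induction p arbitrary: q)
  case 0
  then obtain c where "q = [:c:]" by (metis degree_eq_zeroE le_zero_eq)
  with 0 show ?case by simp
next
  case (Suc p)
  have "\<exists>r z. q = r * [:1, z:] \<and> coeff r 0 = 1 \<and> degree r \<le> p"
  proof (cases "degree q \<le> p")
    case True
    then show ?thesis using Suc.prems by (intro exI[of _ q] exI[of _ 0]) simp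
  next
    case False
    then have "\<not> constant (poly q)" by (simp add: constant_degree)
    then obtain z where z: "poly q z = 0" using fundamental_theorem_of_algebra by blast
    then have "z \<noteq> 0" using Suc.prems(1) by (auto simp: poly_0_coeff_0)
    from z obtain r where r: "q = [:-z, 1:] * r" by (auto simp: poly_eq_0_iff_dvd elim: dvdE)
    have "r \<noteq> 0" using r False by auto
    have eq: "q = smult (- z) r * [:1, - (1 / z):]"
      using \<open>z \<noteq> 0\<close> unfolding r by (simp add: algebra_simps)
    then have "coeff (smult (- z) r) 0 = 1"
      using Suc.prems(1) by (simp add: coeff_mult)
    moreover have "degree q = Suc (degree r)"
      unfolding r using \<open>r \<noteq> 0\<close> by (subst degree_mult_eq) auto
    then have "degree (smult (- z) r) \<le> p"
      using Suc.prems(2) by simp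
    ultimately show ?thesis using eq by blast
  qed
  then obtain r z where r: "q = r * [:1, z:]" "coeff r 0 = 1" "degree r \<le> p" by blast
  obtain a where a: "r = (\<Prod>k\<leftarrow>[0..<p]. [:1, a k:])" using Suc.IH[OF r(2,3)] by blast
  have "(\<Prod>k\<leftarrow>[0..<p]. [:1, a k:]) = (\<Prod>k\<leftarrow>[0..<p]. [:1, (a(p := z)) k:])"
    by (intro arg_cong[of _ _ prod_list] map_cong) auto
  then have "q = (\<Prod>k\<leftarrow>[0..<Suc p]. [:1, (a(p := z)) k:])"
    using r(1) a by simp
  then show ?case by blast
qed

section \<open>Eigenvectors in finite dimensional complex spaces\<close>

locale finite_dimensional_complex_space = finite_dimensional_vector_space s Basis
  for s :: "complex \<Rightarrow> 'v::ab_group_add \<Rightarrow> 'v" and Basis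
begin

definition poly_apply :: "complex poly \<Rightarrow> ('v \<Rightarrow> 'v) \<Rightarrow> 'v \<Rightarrow> 'v" where
  "poly_apply q T v = (\<Sum>i\<le>degree q. s (coeff q i) ((T ^^ i) v))"

lemma poly_apply_superset:
  "degree q \<le> n \<Longrightarrow> poly_apply q T v = (\<Sum>i\<le>n. s (coeff q i) ((T ^^ i) v))"
  unfolding poly_apply_def by (intro sum.mono_neutral_left) (auto simp: coeff_eq_0)

lemma poly_apply_eigen:
  fixes r :: "complex poly"
  assumes S: "subspace S" "v \<in> S" and closed: "\<And>x. x \<in> S \<Longrightarrow> T x \<in> S"
    and add: "\<And>x y. x \<in> S \<Longrightarrow> y \<in> S \<Longrightarrow> T (x + y) = T x + T y"
    and scale: "\<And>c x. x \<in> S \<Longrightarrow> T (s c x) = s c (T x)"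
  shows "poly_apply ([:- z, 1:] * r) T v = T (poly_apply r T v) - s z (poly_apply r T v)"
    and "poly_apply r T v \<in> S"
proof -
  have pow: "(T ^^ i) v \<in> S" for i by (induction i) (auto simp: S closed)
  show "poly_apply r T v \<in> S"
    unfolding poly_apply_def by (intro subspace_sum[OF S(1)] subspace_scale[OF S(1)] pow)
  have T0: "T 0 = 0" using scale[of v 0] S(2) by simp
  have T_sum: "T (\<Sum>i\<in>A. s (c i) ((T ^^ i) v)) = (\<Sum>i\<in>A. s (c i) ((T ^^ Suc i) v))" for A c
    by (induction A rule: infinite_finite_induct)
      (simp_all add: T0 add scale pow subspace_sum[OF S(1)] subspace_scale[OF S(1)])
  let ?n = "degree r"
  have "degree ([:- z, 1:] * r) \<le> Suc ?n"
    using degree_mult_le[of "[:- z, 1:]" r] by simp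
  then have "poly_apply ([:- z, 1:] * r) T v = (\<Sum>i\<le>Suc ?n. s (coeff ([:- z, 1:] * r) i) ((T ^^ i) v))"
    by (rule poly_apply_superset)
  also have "\<dots> = (\<Sum>i\<le>Suc ?n. s (coeff (pCons 0 r) i) ((T ^^ i) v)) - (\<Sum>i\<le>Suc ?n. s (z * coeff r i) ((T ^^ i) v))"
    by (simp add: sum_subtractf[symmetric] scale_left_diff_distrib[symmetric] mult_pCons_left
        del: sum.atMost_Suc)
  also have "(\<Sum>i\<le>Suc ?n. s (coeff (pCons 0 r) i) ((T ^^ i) v)) = T (poly_apply r T v)"
    unfolding poly_apply_def T_sum sum.atMost_Suc_shift by simp
  also have "(\<Sum>i\<le>Suc ?n. s (z * coeff r i) ((T ^^ i) v)) = s z (poly_apply r T v)"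
    by (simp add: poly_apply_def scale_sum_right coeff_eq_0)
  finally show "poly_apply ([:- z, 1:] * r) T v = T (poly_apply r T v) - s z (poly_apply r T v)" .
qed

text \<open>Among \<open>card Basis + 1\<close> iterates of \<open>v\<close> there is a linear
  relation. Coinciding iterates are a separate case because \<open>independent\<close> speaks of
  sets and not of families.\<close>

lemma annihilating_poly: "\<exists>q. q \<noteq> 0 \<and> poly_apply q T v = 0"
proof -
  let ?f = "\<lambda>i. (T ^^ i) v" and ?n = "card Basis"
  show ?thesis
  proof (cases "inj_on ?f {..?n}")
    case True
    then have "card (?f ` {..?n}) = Suc ?n" by (simp add: card_image)
    then have "\<not> independent (?f ` {..?n})"
      using independent_card_le_dim[of "?f ` {..?n}" UNIV] by (auto simp: dim_UNIV)
    then obtain g x where g: "(\<Sum>y\<in>?f ` {..?n}. s (g y) y) = 0" "x \<in> ?f ` {..?n}" "g x \<noteq> 0"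
      using independent_if_scalars_zero[of "?f ` {..?n}"] by auto
    define q where "q = (\<Sum>i\<le>?n. monom (g (?f i)) i)"
    have coeff: "coeff q i = (if i \<le> ?n then g (?f i) else 0)" for i
      by (auto simp: q_def coeff_sum)
    have "degree q \<le> ?n" by (rule degree_le) (simp add: coeff)
    then have "poly_apply q T v = (\<Sum>i\<le>?n. s (g (?f i)) (?f i))"
      by (simp add: poly_apply_superset coeff)
    also have "\<dots> = 0" using g(1) by (simp add: sum.reindex[OF True])
    finally have "poly_apply q T v = 0" .
    moreover obtain i where "i \<le> ?n" "x = ?f i" using g(2) by auto
    then have "coeff q i \<noteq> 0" using g(3) by (simp add: coeff)
    then have "q \<noteq> 0" by auto
    ultimately show ?thesis by blast
  next
    case False
    then obtain i j where ij: "?f i = ?f j" "i \<noteq> j" by (auto simp: inj_on_def)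
    define q :: "complex poly" where "q = monom 1 i - monom 1 j"
    have "poly_apply q T v = (\<Sum>k\<le>max i j. s (coeff q k) (?f k))"
      by (rule poly_apply_superset) (auto simp: q_def intro!: degree_le)
    also have "\<dots> = (\<Sum>k\<le>max i j. if k = i then ?f k else 0) - (\<Sum>k\<le>max i j. if k = j then ?f k else 0)"
      unfolding sum_subtractf[symmetric]
      by (rule sum.cong) (auto simp: q_def coeff_monom scale_left_diff_distrib)
    also have "\<dots> = 0" using ij by simp
    finally have "poly_apply q T v = 0" .
    moreover have "coeff q i \<noteq> 0" using ij by (simp add: q_def)
    ultimately show ?thesis by (intro exI[of _ q]) auto
  qed
qed

text \<open>Take a nonzero polynomial \<open>q\<close> of least degree whose value at
  \<open>T\<close> kills \<open>v\<close>, and split off a linear factor at a root. By minimality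
  the cofactor does not kill \<open>v\<close>, and its value on \<open>v\<close> is the
  eigenvector.\<close>

lemma eigenvector_exists:
  assumes S: "subspace S" "S \<noteq> {0}" and closed: "\<And>x. x \<in> S \<Longrightarrow> T x \<in> S"
    and lin: "linear_map_on s S s T"
  shows "\<exists>c. \<exists>v\<in>S. v \<noteq> 0 \<and> T v = s c v"
proof -
  obtain v where v: "v \<in> S" "v \<noteq> 0" using S subspace_0 by blast
  let ?Q = "\<lambda>q. q \<noteq> 0 \<and> poly_apply q T v = 0"
  obtain q0 where "?Q q0" using annihilating_poly by blast
  from ex_has_least_nat[of ?Q, OF this, of degree]
  obtain q where q: "?Q q \<and> (\<forall>r. ?Q r \<longrightarrow> degree q \<le> degree r)" ..
  note min = q[THEN conjunct2]
  from q have q: "q \<noteq> 0" "poly_apply q T v = 0" by simp_all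
  have "degree q \<noteq> 0"
  proof
    assume "degree q = 0"
    then obtain c where "q = [:c:]" by (metis degree_eq_zeroE)
    then show False using q v by (simp add: poly_apply_def)
  qed
  then have "\<not> constant (poly q)" by (simp add: constant_degree)
  then obtain z where "poly q z = 0" using fundamental_theorem_of_algebra by blast
  then obtain r where r: "q = [:-z, 1:] * r" by (auto simp: poly_eq_0_iff_dvd elim: dvdE)
  have "r \<noteq> 0" using r q by auto
  then have "degree q = Suc (degree r)" unfolding r by (subst degree_mult_eq) auto
  then have nz: "poly_apply r T v \<noteq> 0" using min[rule_format, of r] \<open>r \<noteq> 0\<close> by auto
  have *: "poly_apply ([:- z, 1:] * r) T v = T (poly_apply r T v) - s z (poly_apply r T v)"
    "poly_apply r T v \<in> S"
    using poly_apply_eigen(1)[OF S(1) v(1) closed, where z = z and r = r]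
      poly_apply_eigen(2)[OF S(1) v(1) closed, where r = r] lin by (auto simp: linear_map_on_def)
  then have "T (poly_apply r T v) = s z (poly_apply r T v)" using q(2) r by simp
  then show ?thesis using nz *(2) by blast
qed

text \<open>The family may be infinite, so operators are not treated one at a time. On a nonzero
  invariant subspace of least dimension every operator is a scalar, since its eigenspaces there are
  again invariant by commutativity.\<close>

lemma common_eigenvector_exists:
  assumes S: "subspace S" "S \<noteq> {0}" and closed: "\<And>a x. x \<in> S \<Longrightarrow> T a x \<in> S"
    and lin: "\<And>a. linear_map_on s S s (T a)"
    and comm: "\<And>a b x. x \<in> S \<Longrightarrow> T a (T b x) = T b (T a x)"
  shows "\<exists>v\<in>S. v \<noteq> 0 \<and> (\<forall>a. \<exists>c. T a v = s c v)"
proof -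
  let ?P = "\<lambda>W. subspace W \<and> W \<subseteq> S \<and> W \<noteq> {0} \<and> (\<forall>a. \<forall>x\<in>W. T a x \<in> W)"
  have "?P S" using S closed by blast
  from ex_has_least_nat[of ?P, OF this, of dim]
  obtain W where "?P W \<and> (\<forall>X. ?P X \<longrightarrow> dim W \<le> dim X)" ..
  then have W: "?P W" and min: "\<forall>X. ?P X \<longrightarrow> dim W \<le> dim X" by (rule conjunct1, rule conjunct2)
  have lin': "linear_map_on s W s (T a)" for a
    using lin[of a] W unfolding linear_map_on_def by blast
  have scalar: "\<exists>c. \<forall>x\<in>W. T a x = s c x" for a
  proof -
    obtain c v where v: "v \<in> W" "v \<noteq> 0" "T a v = s c v"
      using eigenvector_exists[of W "T a"] W lin' by blast
    let ?X = "{x \<in> W. T a x = s c x}"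
    have add: "T b (x + y) = T b x + T b y" and scale: "T b (s d x) = s d (T b x)"
      if "x \<in> W" "y \<in> W" for b x y d
      using lin'[of b] that by (auto simp: linear_map_on_def)
    have 1: "subspace ?X"
    proof (rule subspaceI)
      have "T a 0 = 0" using scale[of v v a 0] v by simp
      then show "0 \<in> ?X" using W by (simp add: subspace_0)
    qed (use W in \<open>auto simp: add scale subspace_add subspace_scale scale_right_distrib mult.commute\<close>)
    moreover have "\<forall>b. \<forall>x\<in>?X. T b x \<in> ?X"
    proof (intro allI ballI)
      fix b x assume x: "x \<in> ?X"
      then have "T a (T b x) = s c (T b x)"
        using W comm[of x a b] scale[of x x b c] by auto
      then show "T b x \<in> ?X" using x W by auto
    qed
    ultimately have "dim W \<le> dim ?X" using v W by (intro min[rule_format]) auto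
    then have "?X = W" using 1 W by (intro subspace_dim_equal) auto
    then show ?thesis by blast
  qed
  obtain v where "v \<in> W" "v \<noteq> 0" using W subspace_0 by blast
  then show ?thesis using scalar W by blast
qed

definition eigenvalues :: "('v \<Rightarrow> 'v) \<Rightarrow> complex set" where
  "eigenvalues T = {c. \<exists>v. v \<noteq> 0 \<and> T v = s c v}"

lemma eigenvectors_independent:
  assumes lin: "linear_map_on s UNIV s T"
    and "finite F" "\<And>c. c \<in> F \<Longrightarrow> T (v c) = s c (v c)" "(\<Sum>c\<in>F. v c) = 0" "c \<in> F"
  shows "v c = 0"
  using assms(2-)
proof (induction F arbitrary: v c rule: finite_induct)
  case (insert d F)
  have T0: "T 0 = 0" using lin by (metis (no_types, lifting) UNIV_I linear_map_on_def scale_zero_left)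
  have T_sum: "T (\<Sum>c\<in>F. v c) = (\<Sum>c\<in>F. T (v c))" for F
    using lin T0 by (induction F rule: infinite_finite_induct) (auto simp: linear_map_on_def)
  \<comment> \<open>Applying \<open>T - d\<close> to the relation removes the term for
    \<open>d\<close> and rescales the others by nonzero factors.\<close>
  have "0 = T (\<Sum>c\<in>insert d F. v c) - s d (\<Sum>c\<in>insert d F. v c)"
    using insert.prems(2) by (simp add: T0 del: sum.insert)
  also have "\<dots> = (\<Sum>c\<in>insert d F. s (c - d) (v c))"
    unfolding T_sum scale_sum_right sum_subtractf[symmetric]
    by (rule sum.cong) (auto simp: insert.prems(1) scale_left_diff_distrib)
  also have "\<dots> = (\<Sum>c\<in>F. s (c - d) (v c))" using insert.hyps by simp
  finally have sum: "(\<Sum>c\<in>F. s (c - d) (v c)) = 0" by simp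
  have "s (c - d) (v c) = 0" if "c \<in> F" for c
  proof (rule insert.IH[OF _ sum that])
    show "T (s (c - d) (v c)) = s c (s (c - d) (v c))" if "c \<in> F" for c
      using lin that insert.prems(1)[of c] by (simp add: linear_map_on_def mult.commute)
  qed
  then have F: "v c = 0" if "c \<in> F" for c using that insert.hyps(2) by auto
  then have "v d = 0" using insert.prems(2) insert.hyps by simp
  then show ?case using F insert.prems(3) by auto
qed simp

lemma finite_eigenvalues:
  assumes lin: "linear_map_on s UNIV s T"
  shows "finite (eigenvalues T)"
proof (rule ccontr)
  assume "infinite (eigenvalues T)"
  then obtain F where F: "F \<subseteq> eigenvalues T" "finite F" "card F = Suc (card Basis)"
    using infinite_arbitrarily_large by blast
  have "\<forall>c\<in>F. \<exists>v. v \<noteq> 0 \<and> T v = s c v"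
    using F(1) by (auto simp: eigenvalues_def)
  from bchoice[OF this] obtain e where "\<forall>c\<in>F. e c \<noteq> 0 \<and> T (e c) = s c (e c)" ..
  then have e: "e c \<noteq> 0 \<and> T (e c) = s c (e c)" if "c \<in> F" for c using that by (rule bspec)
  have inj: "inj_on e F"
    by (rule inj_onI) (metis e scale_cancel_right)
  have "independent (e ` F)"
  proof (rule independent_if_scalars_zero)
    fix g x assume sum: "(\<Sum>x\<in>e ` F. s (g x) x) = 0" and "x \<in> e ` F"
    then obtain c where c: "c \<in> F" "x = e c" by blast
    have "s (g (e c)) (e c) = 0"
    proof (rule eigenvectors_independent[OF lin F(2) _ _ c(1)])
      show "T (s (g (e c)) (e c)) = s c (s (g (e c)) (e c))" if "c \<in> F" for c
        using lin e[OF that] by (simp add: linear_map_on_def mult.commute)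
      show "(\<Sum>c\<in>F. s (g (e c)) (e c)) = 0" using sum by (simp add: sum.reindex[OF inj])
    qed
    then show "g x = 0" using e[OF c(1)] c by simp
  qed (use F in simp)
  then have "card (e ` F) \<le> card Basis"
    using independent_card_le_dim[of "e ` F" UNIV] by (simp add: dim_UNIV)
  then show False using F(3) by (simp add: card_image[OF inj])
qed

end

section \<open>Existence of a highest weight vector\<close>

lemma hw_vector_exists:
  fixes s :: "complex \<Rightarrow> 'v::ab_group_add \<Rightarrow> 'v" and Basis :: "'v set"
    and act :: "'n::{finite,linorder} free_yangian \<Rightarrow> 'v \<Rightarrow> 'v"
  assumes fd: "finite_dimensional_vector_space s Basis" and fm: "free_module s act UNIV"
    and rel: "\<And>r v. r \<in> yangian_relators \<Longrightarrow> act r v = 0" and nonzero: "(UNIV :: 'v set) \<noteq> {0}"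
  shows "\<exists>wt \<eta>. hw_vector s act wt \<eta>"
proof -
  interpret finite_dimensional_complex_space s Basis
    unfolding finite_dimensional_complex_space_def by (rule fd)
  interpret M: free_module s act UNIV by (rule fm)
  note act = M.act_add_left[OF UNIV_I] M.act_diff_left[OF UNIV_I] M.act_mult[OF UNIV_I]
    M.act_sum_left[OF UNIV_I] M.act_cscale[OF UNIV_I] M.act_add_right[OF UNIV_I UNIV_I]
    M.act_scale[OF UNIV_I] M.act_zero_right M.act_zero_left[OF UNIV_I]
  interpret yangian_ideal "{a. \<forall>v. act a v = 0}"
    by unfold_locales (auto simp: act rel)
  have lin: "linear_map_on s S s (act a)" for S a by (simp add: linear_map_on_def act)
  have "\<exists>c. \<exists>v\<in>UNIV. v \<noteq> 0 \<and> act grading v = s c v"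
    by (rule eigenvector_exists) (use nonzero lin in auto)
  then have ne: "eigenvalues (act grading) \<noteq> {}" by (auto simp: eigenvalues_def)
  have fin: "finite (eigenvalues (act grading))" by (rule finite_eigenvalues[OF lin])
  define R where "R = Max (Re ` eigenvalues (act grading))"
  have "R \<in> Re ` eigenvalues (act grading)" unfolding R_def using ne fin by (intro Max_in) auto
  then obtain \<mu> where \<mu>: "\<mu> \<in> eigenvalues (act grading)" "Re \<mu> = R" by auto
  have max: "Re c \<le> Re \<mu>" if "c \<in> eigenvalues (act grading)" for c
    using that fin by (simp add: \<mu>(2) R_def)
  define E where "E = {v. act grading v = s \<mu> v}"
  have sub: "subspace E"
    by (rule subspaceI) (auto simp: E_def act scale_right_distrib mult.commute)
  have "E \<noteq> {0}" using \<mu>(1) by (auto simp: E_def eigenvalues_def)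
  have shift: "act grading (act (gen i j n) v) = s (\<mu> + (of_nat (height j) - of_nat (height i))) (act (gen i j n) v)"
    if "v \<in> E" for i j n v
  proof -
    have "act (grading * gen i j n - gen i j n * grading
        - cscale (of_nat (height j) - of_nat (height i)) (gen i j n)) v = 0"
      using grading_gen[of i j n] by blast
    then show ?thesis
      using that by (simp add: act E_def scale_left_distrib diff_eq_eq add.commute)
  qed
  have raise: "act (gen i j n) v = 0" if "v \<in> E" "i < j" for i j n v
  proof (rule ccontr)
    assume "act (gen i j n) v \<noteq> 0"
    then have "\<mu> + (of_nat (height j) - of_nat (height i)) \<in> eigenvalues (act grading)"
      using shift[OF that(1)] by (auto simp: eigenvalues_def)
    from max[OF this] show False using height_less[OF that(2)] by simp
  qed
  have closed: "act (gen i i n) v \<in> E" if "v \<in> E" for i n v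
    using shift[OF that, of i i n] by (simp add: E_def)
  have comm_expand: "act (gen i i m) (act (gen k k n) v) - act (gen k k n) (act (gen i i m) v) =
      (\<Sum>r<min m n. act (gen k i r) (act (gen i k (m + n - r - 1)) v) - act (gen k i (m + n - r - 1)) (act (gen i k r) v))"
    for i k m n v
  proof -
    have "act ((gen i i m * gen k k n - gen k k n * gen i i m) -
      (\<Sum>r<min m n. gen k i r * gen i k (m + n - r - 1) - gen k i (m + n - r - 1) * gen i k r)) v = 0"
      using gen_commutator[of i i m k k n] by blast
    then show ?thesis by (simp only: act right_minus_eq)
  qed
  \<comment> \<open>Every summand of the commutator applies some \<open>gen i k r\<close> to
    \<open>v\<close> first, and these are raising when \<open>i < k\<close>.\<close>
  have comm_less: "act (gen i i m) (act (gen k k n) v) = act (gen k k n) (act (gen i i m) v)"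
    if "i < k" "v \<in> E" for i k m n v
    using comm_expand[of i m k n v] raise[OF that(2,1)] by (simp add: act)
  \<comment> \<open>For equal indices each summand is itself a commutator, of generators whose
    levels add up to \<open>m + n - 1\<close>.\<close>
  have comm_same: "act (gen i i m) (act (gen i i n) v) = act (gen i i n) (act (gen i i m) v)"
    if "v \<in> E" for i m n v
    using that
  proof (induction "m + n" arbitrary: m n rule: less_induct)
    case less
    have "(\<Sum>r<min m n. act (gen i i r) (act (gen i i (m + n - r - 1)) v) - act (gen i i (m + n - r - 1)) (act (gen i i r) v)) = 0"
      by (rule sum.neutral) (use less in auto)
    then show ?case using comm_expand[of i m i n v] by simp
  qed
  have comm: "act (gen i i m) (act (gen k k n) v) = act (gen k k n) (act (gen i i m) v)"
    if "v \<in> E" for i k m n v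
    using comm_less[of i k v m n] comm_less[of k i v n m] comm_same[of v i m n] that
    by (cases i k rule: linorder_cases) auto
  have "\<exists>v\<in>E. v \<noteq> 0 \<and> (\<forall>a. \<exists>c. (case a of (i, n) \<Rightarrow> act (gen i i n)) v = s c v)"
    by (rule common_eigenvector_exists[OF sub \<open>E \<noteq> {0}\<close>])
      (auto simp: lin closed comm split: prod.splits)
  then obtain \<eta> where \<eta>: "\<eta> \<in> E" "\<eta> \<noteq> 0" "\<And>i n. \<exists>c. act (gen i i n) \<eta> = s c \<eta>" by auto
  then obtain wt where "\<And>i n. act (gen i i n) \<eta> = s (wt i n) \<eta>" by metis
  then have "hw_vector s act wt \<eta>" using \<eta> raise by (simp add: hw_vector_def)
  then show ?thesis by blast
qed

section \<open>Classification\<close>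

theorem theorem5p1:
  fixes p :: nat
    and s :: "complex \<Rightarrow> 'v::ab_group_add \<Rightarrow> 'v"
    and Basis :: "'v set"
    and \<rho> :: "'n::{finite,linorder} free_yangian set \<Rightarrow> 'v \<Rightarrow> 'v"
  assumes "p \<ge> 1"
    and "finite_dimensional_vector_space s Basis"
    and "W_rep p s \<rho> UNIV"
    and "irreducible_rep s (carrier (W_algebra p)) \<rho> UNIV"
  shows
    "(\<exists>B (\<pi> :: 'n gl \<Rightarrow> (nat \<Rightarrow>\<^sub>0 complex) \<Rightarrow> (nat \<Rightarrow>\<^sub>0 complex)) \<eta> \<sigma>.
        gl_highest_weight_irrep B \<pi> \<eta> \<and> evaluation_rep p B \<pi> \<sigma> \<and>
        W_isomorphic p s \<rho> UNIV cscale \<sigma> (free_space B))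
     \<or>
     (\<exists>n Bs (\<pi>s :: ('n gl \<Rightarrow> (nat \<Rightarrow>\<^sub>0 complex) \<Rightarrow> (nat \<Rightarrow>\<^sub>0 complex)) list) \<eta>s \<sigma> M.
        1 \<le> n \<and> n \<le> p \<and> length Bs = n \<and> length \<pi>s = n \<and> length \<eta>s = n \<and>
        (\<forall>k<n. gl_highest_weight_irrep (Bs ! k) (\<pi>s ! k) (\<eta>s ! k)) \<and>
        ev_tensor_rep p Bs \<pi>s \<sigma> \<and>
        M = generated_submodule cscale (carrier (W_algebra p)) \<sigma> (pure_tensor \<eta>s) \<and>
        W_isomorphic_quotient p s \<rho> UNIV cscale \<sigma> M
          (proper_submodule_sum cscale (carrier (W_algebra p)) \<sigma> M))"
proof (rule disjI2)
  interpret finite_dimensional_vector_space s Basis by fact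
  have vs: "vector_space s" by (rule vector_space_axioms)
  let ?act = "\<lambda>a. \<rho> (W_class p a)"
  interpret M: free_module s ?act UNIV by (rule free_module_of_W_rep[OF vs assms(3)])
  have rel: "?act r v = 0" if "r \<in> yangian_relators \<union> truncation_relators p" for r v
    by (rule W_rep_relator[OF vs assms(3) that UNIV_I])
  obtain wt \<eta> where hw: "hw_vector s ?act wt \<eta>"
    using hw_vector_exists[OF assms(2) M.free_module_axioms] rel assms(4)
    unfolding irreducible_rep_def by blast
  then have nz: "\<eta> \<noteq> 0" and wt: "?act (gen i i n) \<eta> = s (wt i n) \<eta>" for i n
    by (auto simp: hw_vector_def)
  have wt_0: "wt i 0 = 1" for i
  proof -
    have "?act (gen i i 0 - 1) \<eta> = 0"
      by (rule rel) (force simp: yangian_relators_def)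
    then have "s (wt i 0) \<eta> = s 1 \<eta>" by (simp add: M.act_diff_left M.act_one wt)
    then show ?thesis using nz unfolding scale_cancel_right by simp
  qed
  have wt_truncated: "wt i n = 0" if "p < n" for i n
  proof -
    have "?act (gen i i n) \<eta> = 0"
      by (rule rel) (use that in \<open>auto simp: truncation_relators_def\<close>)
    then show ?thesis using nz by (simp add: wt)
  qed
  have "\<exists>a. \<forall>n. coeff (\<Prod>k\<leftarrow>[0..<p]. [:1, a k:]) n = wt i n" for i
  proof -
    \<comment> \<open>The weight series as a polynomial in u^-1. Its constant term is 1 by the level
      0 relators, and the truncation bounds its degree by \<open>p\<close>, so that exactly
      \<open>p\<close> linear factors suffice.\<close>
    let ?q = "\<Sum>n\<le>p. monom (wt i n) n"
    have coeff: "coeff ?q n = wt i n" for n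
      by (auto simp: coeff_sum wt_truncated)
    have "degree ?q \<le> p" by (rule degree_le) (simp add: coeff wt_truncated)
    then have "\<exists>a. ?q = (\<Prod>k\<leftarrow>[0..<p]. [:1, a k:])"
      by (intro poly_linear_factors) (simp_all add: coeff wt_0)
    then show ?thesis using coeff by metis
  qed
  then obtain a where a: "\<And>i n. coeff (\<Prod>k\<leftarrow>[0..<p]. [:1, a i k:]) n = wt i n" by metis
  \<comment> \<open>One predicate on triples, so that a single choice over \<open>k\<close> yields
    space, action and highest weight vector together.\<close>
  define Q where "Q k X \<longleftrightarrow> gl_highest_weight_irrep (fst X) (fst (snd X)) (snd (snd X)) \<and>
      (\<forall>i. fst (snd X) (matrix_unit i i) (snd (snd X)) = cscale (a i k) (snd (snd X))) \<and>
      (\<forall>Y v w. fst (snd X) Y (v + w) = fst (snd X) Y v + fst (snd X) Y w) \<and>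
      (\<forall>Y c v. fst (snd X) Y (cscale c v) = cscale c (fst (snd X) Y v)) \<and>
      gl_relations (\<lambda>i j. fst (snd X) (matrix_unit i j))"
    for k and X :: "nat set \<times> ('n gl \<Rightarrow> (nat \<Rightarrow>\<^sub>0 complex) \<Rightarrow> (nat \<Rightarrow>\<^sub>0 complex)) \<times> (nat \<Rightarrow>\<^sub>0 complex)"
  have "\<exists>X. Q k X" for k
  proof (rule gl_irrep_exists[of "\<lambda>i. a i k"])
    fix B \<pi> \<eta>
    assume "gl_highest_weight_irrep B \<pi> \<eta>" "\<And>i. \<pi> (matrix_unit i i) \<eta> = cscale (a i k) \<eta>"
      "\<And>X v w. \<pi> X (v + w) = \<pi> X v + \<pi> X w" "\<And>X c v. \<pi> X (cscale c v) = cscale c (\<pi> X v)"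
      "gl_relations (\<lambda>i j. \<pi> (matrix_unit i j))"
    then show ?thesis by (intro exI[of _ "(B, \<pi>, \<eta>)"]) (simp add: Q_def)
  qed
  then obtain X where X: "\<And>k. Q k (X k)" by metis
  define B where "B k = fst (X k)" for k
  define \<pi> where "\<pi> k = fst (snd (X k))" for k
  define \<theta> where "\<theta> k = snd (snd (X k))" for k
  interpret gl_irrep_family B \<pi> \<theta> "\<lambda>k i. a i k"
    using X by unfold_locales (simp_all add: Q_def B_def \<pi>_def \<theta>_def)
  let ?ks = "[0..<p]"
  obtain \<sigma> where \<sigma>: "ev_tensor_rep p (map B ?ks) (map \<pi> ?ks) \<sigma>"
    and "hw_vector cscale (\<lambda>x. \<sigma> (W_class p x)) (\<lambda>i. coeff (\<Prod>k\<leftarrow>?ks. [:1, a i k:])) (pure_tensor (map \<theta> ?ks))"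
    by (rule ev_tensor_rep_exists[of ?ks p]) simp_all
  moreover have "(\<lambda>i. coeff (\<Prod>k\<leftarrow>?ks. [:1, a i k:])) = wt"
    using a by (intro ext)
  ultimately have hw': "hw_vector cscale (\<lambda>x. \<sigma> (W_class p x)) wt (pure_tensor (map \<theta> ?ks))"
    by simp
  let ?N = "generated_submodule cscale (carrier (W_algebra p)) \<sigma> (pure_tensor (map \<theta> ?ks))"
  have "W_isomorphic_quotient p s \<rho> UNIV cscale \<sigma> ?N
      (proper_submodule_sum cscale (carrier (W_algebra p)) \<sigma> ?N)"
    using \<sigma> unfolding ev_tensor_rep_def
    by (intro irreducible_hw_quotient[OF vs assms(3,4) UNIV_I hw vector_space_cscale _ hw_in_space hw'])
      blast
  then show "\<exists>n Bs (\<pi>s :: ('n gl \<Rightarrow> (nat \<Rightarrow>\<^sub>0 complex) \<Rightarrow> (nat \<Rightarrow>\<^sub>0 complex)) list) \<eta>s \<sigma> M.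
        1 \<le> n \<and> n \<le> p \<and> length Bs = n \<and> length \<pi>s = n \<and> length \<eta>s = n \<and>
        (\<forall>k<n. gl_highest_weight_irrep (Bs ! k) (\<pi>s ! k) (\<eta>s ! k)) \<and>
        ev_tensor_rep p Bs \<pi>s \<sigma> \<and>
        M = generated_submodule cscale (carrier (W_algebra p)) \<sigma> (pure_tensor \<eta>s) \<and>
        W_isomorphic_quotient p s \<rho> UNIV cscale \<sigma> M
          (proper_submodule_sum cscale (carrier (W_algebra p)) \<sigma> M)"
    using assms(1) \<sigma> irrep
    by (intro exI[of _ p] exI[of _ "map B ?ks"] exI[of _ "map \<pi> ?ks"] exI[of _ "map \<theta> ?ks"]
        exI[of _ \<sigma>] exI[of _ ?N]) simp
qed

end
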